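(* For each $r=1,\dots,N$, the element $Z_r\in W(\lambda)$ lies in $\mathrm{F}_{r-d_r}W(\lambda)$ and $\varphi(\mathrm{gr}_{r-d_r}Z_r)=(-1)^{r-d_r}z_r$. In particular, $z_1,\dots,z_N$ belong to the center of $U(\mathfrak{g}_e)$.
   Context: $F$ is an algebraically closed field of characteristic zero. $\lambda=(\lambda_1,\dots,\lambda_n)$ is a composition of $N$ with positive parts and $\lambda_1\le\cdots\le\lambda_n$; $\sigma=(s_{i,j})$ with $s_{i,j}:=\lambda_j-\min(\lambda_i,\lambda_j)$ (an upper triangular shift matrix). Yangian data: $Y_n$ is the $F$-algebra with generators $T_{i,j}^{(r)}$ ($1\le i,j\le n$, $r\ge1$) and relations $[T_{i,j}^{(r)},T_{k,l}^{(s)}]=\sum_{t=0}^{\min(r,s)-1}(T_{k,j}^{(t)}T_{i,l}^{(r+s-1-t)}-T_{k,j}^{(r+s-1-t)}T_{i,l}^{(t)})$, $T_{i,j}^{(0)}=\delta_{i,j}$. Writing $T(u)=(\sum_r T_{i,j}^{(r)}u^{-r})_{i,j}$ with Gauss factorization $T(u)=F(u)D(u)E(u)$ ($D$ diagonal with entries $D_i(u)=\sum_{r\ge0}D_i^{(r)}u^{-r}$, $E$ upper unitriangular with entries $E_{i,j}(u)=\sum_{r\ge1} E_{i,j}^{(r)}u^{-r}$, $F$ lower unitriangular with $(j,i)$-entries $F_{i,j}(u)=\sum_{r\ge1} F_{i,j}^{(r)}u^{-r}$), the shifted Yangian $Y_n(\sigma)\subseteq Y_n$ is the subalgebra generated by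 $D_i^{(r)}$ ($r>0$), $E_i^{(r)}:=E_{i,i+1}^{(r)}$ ($r>s_{i,i+1}$), $F_i^{(r)}:=F_{i,i+1}^{(r)}$ ($r>s_{i+1,i}$). Define ${}^\sigma E_{i,i+1}^{(r)}=E_i^{(r)}$, ${}^\sigma E_{i,j}^{(r)}=[{}^\sigma E_{i,j-1}^{(r-s_{j-1,j})},E_{j-1}^{(s_{j-1,j}+1)}]$ ($r>s_{i,j}$), ${}^\sigma F_{i,i+1}^{(r)}=F_i^{(r)}$, ${}^\sigma F_{i,j}^{(r)}=[F_{j-1}^{(s_{j,j-1}+1)},{}^\sigma F_{i,j-1}^{(r-s_{j,j-1})}]$ ($r>s_{j,i}$), the series ${}^\sigma E_{i,j}(u)=\sum_{r>s_{i,j}}{}^\sigma E_{i,j}^{(r)}u^{-r}$, ${}^\sigma F_{i,j}(u)=\sum_{r>s_{j,i}}{}^\sigma F_{i,j}^{(r)}u^{-r}$, ${}^\sigma E_{i,i}={}^\sigma F_{i,i}=1$, and ${}^\sigma T_{i,j}(u)=\sum_{r\ge0}{}^\sigma T_{i,j}^{(r)}u^{-r}:=\sum_{k=1}^{\min(i,j)}{}^\sigma F_{k,i}(u)D_k(u){}^\sigma E_{k,j}(u)$. $W(\lambda)$ is the quotient of $Y_n(\sigma)$ by the two-sided ideal generated by $\{D_1^{(r)}:r>\lambda_1\}$; $T_{i,j}^{(r)}$ now denotes the image of ${}^\sigma T_{i,j}^{(r)}$ in $W(\lambda)$. It is known that $T_{i,j}^{(r)}=0$ in $W(\lambda)$ for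 $r>\lambda_j$, so $u^{\lambda_j}T_{i,j}(u)\in W(\lambda)[u]$ where $T_{i,j}(u)=\sum_r T_{i,j}^{(r)}u^{-r}$. Define $Z(u):=\mathrm{cdet}\big((u-j+1)^{\lambda_j}T_{i,j}(u-j+1)\big)_{1\le i,j\le n}$, where $\mathrm{cdet}(a_{i,j}):=\sum_{w\in S_n}\mathrm{sgn}(w)a_{w1,1}\cdots a_{wn,n}$; then $Z(u)=u^N+Z_1u^{N-1}+\cdots+Z_N$ with $Z_r\in W(\lambda)$. Loop filtration: $\mathrm{F}_rW(\lambda)$ is the span of monomials $T_{i_1,j_1}^{(r_1+1)}\cdots T_{i_k,j_k}^{(r_k+1)}$ with $r_1+\cdots+r_k\le r$; $\mathrm{gr}_r x$ is the image of $x\in\mathrm{F}_rW(\lambda)$ in the $r$th component of $\mathrm{gr}W(\lambda)$. Centralizer data: $e\in\mathfrak{gl}_N(F)$ is nilpotent with Jordan blocks $\lambda_1,\dots,\lambda_n$ down the diagonal; with the diagram of rows of lengths $\lambda_i$ filled with $1,\dots,N$ along rows and $\mathrm{row}(h),\mathrm{col}(h)$ the row/column of $h$, set $e_{i,j;r}:=\sum_{\mathrm{row}(h)=i,\mathrm{row}(k)=j,\mathrm{col}(k)-\mathrm{col}(h)=r}e_{h,k}$ for $s_{i,j}\le r<\lambda_j$; these form a basis of $\mathfrak{g}_e$, graded by $\deg e_{i,j;r}=r$. It is known that there is a unique graded algebra isomorphism $\varphi:\mathrm{gr}W(\lambda)\to U(\mathfrak{g}_e)$ with $\varphi(\mathrm{gr}_rT_{i,j}^{(r+1)})=(-1)^re_{i,j;r}$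 for $s_{i,j}\le r<\lambda_j$. $(d_1,\dots,d_N)$ is the sequence consisting of $\lambda_n$ copies of $1$, then $\lambda_{n-1}$ copies of $2$, ..., then $\lambda_1$ copies of $n$. For $\mu\subseteq\lambda$ (meaning $0\le\mu_i\le\lambda_i$), $|\mu|=\sum\mu_i$, $\ell(\mu)$ = number of nonzero parts. Set $\tilde e_{i,j;r}:=e_{i,j;r}-\delta_{r,0}\delta_{i,j}(i-1)\lambda_i$ and, for $\mu$ with $\ell(\mu)=d_{|\mu|}=d$ and nonzero parts at $i_1<\cdots<i_d$, $\mathrm{cdet}(\mu):=\sum_{w\in S_d}\mathrm{sgn}(w)\tilde e_{i_{w1},i_1;\mu_{i_1}-1}\cdots\tilde e_{i_{wd},i_d;\mu_{i_d}-1}$; finally $z_r:=\sum_{\mu\subseteq\lambda,|\mu|=r,\ell(\mu)=d_r}\mathrm{cdet}(\mu)$. *)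

theory Defs
  imports "HOL-Library.Poly_Mapping" "HOL-Computational_Algebra.Formal_Power_Series"
          "HOL-Computational_Algebra.Polynomial" "HOL-Combinatorics.Permutations"
begin

text \<open>Words over an alphabet, with concatenation as (noncommutative) monoid addition;
  the free associative algebra over a ring 'a on generators 'x is then the
  monoid algebra of finitely supported functions from words to 'a.\<close>

datatype 'x word = Word "'x list"

instantiation word :: (type) monoid_add
begin
definition zero_word :: "'x word" where "zero_word = Word []"
fun plus_word :: "'x word \<Rightarrow> 'x word \<Rightarrow> 'x word" where
  "plus_word (Word a) (Word b) = Word (a @ b)"
instance
proof
  fix a b c :: "'x word"
  show "a + b + c = a + (b + c)" by (cases a; cases b; cases c) simp
  show "0 + a = a" by (cases a) (simp add: zero_word_def)
  show "a + 0 = a" by (cases a) (simp add: zero_word_def)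
qed
end

type_synonym ('x, 'a) falg = "'x word \<Rightarrow>\<^sub>0 'a"

definition fgen :: "'x \<Rightarrow> ('x, 'a::ring_1) falg" where
  "fgen x = Poly_Mapping.single (Word [x]) 1"

definition fconst :: "'a::ring_1 \<Rightarrow> ('x, 'a) falg" where
  "fconst c = Poly_Mapping.single 0 c"

definition ideal_gen :: "'r::ring set \<Rightarrow> 'r set" where
  "ideal_gen G = {x. \<exists>(m::nat) a b g. (\<forall>k<m. g k \<in> G) \<and> x = (\<Sum>k<m. a k * g k * b k)}"

definition ideal_in :: "'r::ring set \<Rightarrow> 'r set \<Rightarrow> 'r set" where
  "ideal_in S G = {x. \<exists>(m::nat) a b g. (\<forall>k<m. g k \<in> G \<and> a k \<in> S \<and> b k \<in> S) \<and> x = (\<Sum>k<m. a k * g k * b k)}"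

inductive_set subalg :: "('x, 'a::ring_1) falg set \<Rightarrow> ('x, 'a) falg set" for X where
  const: "fconst c \<in> subalg X"
| gen: "x \<in> X \<Longrightarrow> x \<in> subalg X"
| add: "x \<in> subalg X \<Longrightarrow> y \<in> subalg X \<Longrightarrow> x + y \<in> subalg X"
| mult: "x \<in> subalg X \<Longrightarrow> y \<in> subalg X \<Longrightarrow> x * y \<in> subalg X"

definition fspan :: "('x, 'a::ring_1) falg set \<Rightarrow> ('x, 'a) falg set" where
  "fspan X = {x. \<exists>(m::nat) c v. (\<forall>k<m. v k \<in> X) \<and> x = (\<Sum>k<m. fconst (c k) * v k)}"

definition comm :: "'r::ring \<Rightarrow> 'r \<Rightarrow> 'r" where
  "comm x y = x * y - y * x"

section \<open>The Yangian Y_n (lifted to the free algebra on the T_{i,j}^{(r)})\<close>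

type_synonym 'a yfree = "(nat \<times> nat \<times> nat, 'a) falg"

definition T0 :: "nat \<Rightarrow> nat \<Rightarrow> nat \<Rightarrow> 'a::ring_1 yfree" where
  "T0 i j r = (if r = 0 then (if i = j then 1 else 0) else fgen (i, j, r))"

definition yrel :: "nat \<Rightarrow> 'a::ring_1 yfree set" where
  "yrel n = {comm (T0 i j r) (T0 k l s)
       - (\<Sum>t<min r s. T0 k j t * T0 i l (r + s - 1 - t) - T0 k j (r + s - 1 - t) * T0 i l t)
     | i j k l r s. i \<in> {1..n} \<and> j \<in> {1..n} \<and> k \<in> {1..n} \<and> l \<in> {1..n} \<and> r \<ge> 1 \<and> s \<ge> 1}"

text \<open>Kernel of the map from the free algebra onto Y_n.\<close>
definition Ryang :: "nat \<Rightarrow> 'a::ring_1 yfree set" where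
  "Ryang n = ideal_gen (yrel n)"

text \<open>Power series in u^{-1}: coefficient r of an fps is the coefficient of u^{-r}.\<close>
definition Tser :: "nat \<Rightarrow> nat \<Rightarrow> 'a::ring_1 yfree fps" where
  "Tser i j = Abs_fps (T0 i j)"

text \<open>Inverse of a series with constant term 1 (noncommutative coefficients).\<close>
definition sinv :: "'r::ring_1 fps \<Rightarrow> 'r fps" where
  "sinv a = Abs_fps (\<lambda>r. fps_nth (\<Sum>m\<le>r. (1 - a) ^ m) r)"

text \<open>Gauss decomposition T = F D E via successive Schur complements.\<close>
primrec resid :: "nat \<Rightarrow> nat \<Rightarrow> nat \<Rightarrow> 'a::ring_1 yfree fps" where
  "resid 0 i j = Tser i j"
| "resid (Suc k) i j = resid k i j
     - resid k i (Suc k) * sinv (resid k (Suc k) (Suc k)) * resid k (Suc k) j"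

definition Dser :: "nat \<Rightarrow> 'a::ring_1 yfree fps" where
  "Dser k = resid (k - 1) k k"

definition Eser :: "nat \<Rightarrow> nat \<Rightarrow> 'a::ring_1 yfree fps" where
  "Eser k j = sinv (Dser k) * resid (k - 1) k j"

text \<open>F_{k,i}(u) (k < i), the (i,k)-entry of F(u).\<close>
definition Fser :: "nat \<Rightarrow> nat \<Rightarrow> 'a::ring_1 yfree fps" where
  "Fser k i = resid (k - 1) i k * sinv (Dser k)"

definition Dc :: "nat \<Rightarrow> nat \<Rightarrow> 'a::ring_1 yfree" where
  "Dc i r = fps_nth (Dser i) r"

definition Ec :: "nat \<Rightarrow> nat \<Rightarrow> 'a::ring_1 yfree" where
  "Ec i r = fps_nth (Eser i (i + 1)) r"

definition Fc :: "nat \<Rightarrow> nat \<Rightarrow> 'a::ring_1 yfree" where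
  "Fc i r = fps_nth (Fser i (i + 1)) r"

definition sh :: "(nat \<Rightarrow> nat) \<Rightarrow> nat \<Rightarrow> nat \<Rightarrow> nat" where
  "sh lam i j = lam j - min (lam i) (lam j)"

definition Ygens :: "nat \<Rightarrow> (nat \<Rightarrow> nat) \<Rightarrow> 'a::ring_1 yfree set" where
  "Ygens n lam =
     {Dc i r | i r. i \<in> {1..n} \<and> r > 0}
   \<union> {Ec i r | i r. 1 \<le> i \<and> i < n \<and> r > sh lam i (i + 1)}
   \<union> {Fc i r | i r. 1 \<le> i \<and> i < n \<and> r > sh lam (i + 1) i}"

text \<open>Lift of Y_n(sigma) to the free algebra.\<close>
definition Sgen :: "nat \<Rightarrow> (nat \<Rightarrow> nat) \<Rightarrow> 'a::ring_1 yfree set" where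
  "Sgen n lam = subalg (Ygens n lam)"

text \<open>sigE lam i d r = {}^sigma E_{i,i+d+1}^{(r)}.\<close>
primrec sigE :: "(nat \<Rightarrow> nat) \<Rightarrow> nat \<Rightarrow> nat \<Rightarrow> nat \<Rightarrow> 'a::ring_1 yfree" where
  "sigE lam i 0 r = Ec i r"
| "sigE lam i (Suc d) r =
     comm (sigE lam i d (r - sh lam (i + d + 1) (i + d + 2)))
          (Ec (i + d + 1) (sh lam (i + d + 1) (i + d + 2) + 1))"

text \<open>sigF lam i d r = {}^sigma F_{i,i+d+1}^{(r)}.\<close>
primrec sigF :: "(nat \<Rightarrow> nat) \<Rightarrow> nat \<Rightarrow> nat \<Rightarrow> nat \<Rightarrow> 'a::ring_1 yfree" where
  "sigF lam i 0 r = Fc i r"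
| "sigF lam i (Suc d) r =
     comm (Fc (i + d + 1) (sh lam (i + d + 2) (i + d + 1) + 1))
          (sigF lam i d (r - sh lam (i + d + 2) (i + d + 1)))"

definition sigEser :: "(nat \<Rightarrow> nat) \<Rightarrow> nat \<Rightarrow> nat \<Rightarrow> 'a::ring_1 yfree fps" where
  "sigEser lam i j = (if i = j then 1 else
      Abs_fps (\<lambda>r. if sh lam i j < r then sigE lam i (j - i - 1) r else 0))"

definition sigFser :: "(nat \<Rightarrow> nat) \<Rightarrow> nat \<Rightarrow> nat \<Rightarrow> 'a::ring_1 yfree fps" where
  "sigFser lam i j = (if i = j then 1 else
      Abs_fps (\<lambda>r. if sh lam j i < r then sigF lam i (j - i - 1) r else 0))"

definition sigT :: "(nat \<Rightarrow> nat) \<Rightarrow> nat \<Rightarrow> nat \<Rightarrow> 'a::ring_1 yfree fps" where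
  "sigT lam i j = (\<Sum>k\<in>{1..min i j}. sigFser lam k i * Dser k * sigEser lam k j)"

definition Tw :: "(nat \<Rightarrow> nat) \<Rightarrow> nat \<Rightarrow> nat \<Rightarrow> nat \<Rightarrow> 'a::ring_1 yfree" where
  "Tw lam i j r = fps_nth (sigT lam i j) r"

text \<open>Kernel of the composite Y_n(sigma) -> W(lambda), lifted to the free algebra:
  x, y in Sgen are equal in W(lambda) iff x - y is in Jset.\<close>
definition Jset :: "nat \<Rightarrow> (nat \<Rightarrow> nat) \<Rightarrow> 'a::ring_1 yfree set" where
  "Jset n lam = {x + \<rho> | x \<rho>.
      x \<in> ideal_in (Sgen n lam) {Dc 1 r | r. r > lam 1} \<and> \<rho> \<in> Ryang n}"

text \<open>Polynomials in the commuting variable u are fps in fps_X (all finite).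
  Entry (u-j+1)^{lambda_j} T_{i,j}(u-j+1); terms with r > lambda_j vanish in W(lambda).\<close>
definition Zentry :: "(nat \<Rightarrow> nat) \<Rightarrow> nat \<Rightarrow> nat \<Rightarrow> 'a::ring_1 yfree fps" where
  "Zentry lam i j = (\<Sum>r\<le>lam j. fps_const (Tw lam i j r) * (fps_X - of_nat (j - 1)) ^ (lam j - r))"

definition Zpoly :: "nat \<Rightarrow> (nat \<Rightarrow> nat) \<Rightarrow> 'a::ring_1 yfree fps" where
  "Zpoly n lam = (\<Sum>w\<in>{w. w permutes {1..n}}.
      of_int (sign w) * prod_list (map (\<lambda>j. Zentry lam (w j) j) [1..<n + 1]))"

definition NN :: "nat \<Rightarrow> (nat \<Rightarrow> nat) \<Rightarrow> nat" where
  "NN n lam = (\<Sum>i\<in>{1..n}. lam i)"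

text \<open>Z(u) = u^N + Z_1 u^{N-1} + ... + Z_N.\<close>
definition Zc :: "nat \<Rightarrow> (nat \<Rightarrow> nat) \<Rightarrow> nat \<Rightarrow> 'a::ring_1 yfree" where
  "Zc n lam r = fps_nth (Zpoly n lam) (NN n lam - r)"

definition Tmonos :: "nat \<Rightarrow> (nat \<Rightarrow> nat) \<Rightarrow> nat \<Rightarrow> 'a::ring_1 yfree set" where
  "Tmonos n lam m = {prod_list (map (\<lambda>(i, j, r). Tw lam i j (r + 1)) l) | l.
      (\<forall>(i, j, r)\<in>set l. i \<in> {1..n} \<and> j \<in> {1..n}) \<and> sum_list (map (\<lambda>(i, j, r). r) l) \<le> m}"

definition Filt :: "nat \<Rightarrow> (nat \<Rightarrow> nat) \<Rightarrow> nat \<Rightarrow> 'a::ring_1 yfree set" where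
  "Filt n lam m = {x. \<exists>y\<in>fspan (Tmonos n lam m). x - y \<in> Jset n lam}"

text \<open>Lift of F_{m-1} W(lambda) (F_{-1} = 0).\<close>
definition Fprev :: "nat \<Rightarrow> (nat \<Rightarrow> nat) \<Rightarrow> nat \<Rightarrow> 'a::ring_1 yfree set" where
  "Fprev n lam m = (if m = 0 then Jset n lam else Filt n lam (m - 1))"

definition rowof :: "nat \<Rightarrow> (nat \<Rightarrow> nat) \<Rightarrow> nat \<Rightarrow> nat" where
  "rowof n lam h = (LEAST i. h \<le> (\<Sum>k\<in>{1..i}. lam k))"

definition colof :: "nat \<Rightarrow> (nat \<Rightarrow> nat) \<Rightarrow> nat \<Rightarrow> nat" where
  "colof n lam h = h - (\<Sum>k\<in>{1..<rowof n lam h}. lam k)"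

definition emat :: "nat \<Rightarrow> (nat \<Rightarrow> nat) \<Rightarrow> nat \<times> nat \<times> nat \<Rightarrow> nat \<Rightarrow> nat \<Rightarrow> 'a::ring_1" where
  "emat n lam b h k = (case b of (i, j, r) \<Rightarrow>
     if h \<in> {1..NN n lam} \<and> k \<in> {1..NN n lam} \<and> rowof n lam h = i \<and> rowof n lam k = j
        \<and> colof n lam k = colof n lam h + r then 1 else 0)"

definition mcomm :: "nat \<Rightarrow> (nat \<Rightarrow> nat \<Rightarrow> 'a::ring_1) \<Rightarrow> (nat \<Rightarrow> nat \<Rightarrow> 'a) \<Rightarrow> nat \<Rightarrow> nat \<Rightarrow> 'a" where
  "mcomm NN' M M' h k = (\<Sum>t\<in>{1..NN'}. M h t * M' t k - M' h t * M t k)"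

text \<open>Index set of the basis e_{i,j;r} of g_e.\<close>
definition gbasis :: "nat \<Rightarrow> (nat \<Rightarrow> nat) \<Rightarrow> (nat \<times> nat \<times> nat) set" where
  "gbasis n lam = {(i, j, r). i \<in> {1..n} \<and> j \<in> {1..n} \<and> sh lam i j \<le> r \<and> r < lam j}"

type_synonym 'a ufree = "(nat \<times> nat \<times> nat, 'a) falg"

text \<open>Defining relations of U(g_e) on the free algebra (generators outside the basis
  index set are killed).\<close>
definition Urel :: "nat \<Rightarrow> (nat \<Rightarrow> nat) \<Rightarrow> 'a::ring_1 ufree set" where
  "Urel n lam =
     {fgen b * fgen b' - fgen b' * fgen b - (\<Sum>c\<in>gbasis n lam. fconst (a c) * fgen c) | b b' a.
        b \<in> gbasis n lam \<and> b' \<in> gbasis n lam \<and>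
        (\<forall>h k. mcomm (NN n lam) (emat n lam b) (emat n lam b') h k
                 = (\<Sum>c\<in>gbasis n lam. a c * emat n lam c h k))}
   \<union> {fgen b | b. b \<notin> gbasis n lam}"

definition Kset :: "nat \<Rightarrow> (nat \<Rightarrow> nat) \<Rightarrow> 'a::ring_1 ufree set" where
  "Kset n lam = ideal_gen (Urel n lam)"

definition egen :: "nat \<Rightarrow> nat \<Rightarrow> nat \<Rightarrow> 'a::ring_1 ufree" where
  "egen i j r = fgen (i, j, r)"

definition etil :: "(nat \<Rightarrow> nat) \<Rightarrow> nat \<Rightarrow> nat \<Rightarrow> nat \<Rightarrow> 'a::ring_1 ufree" where
  "etil lam i j r = egen i j r - (if r = 0 \<and> i = j then fconst (of_nat ((i - 1) * lam i)) else 0)"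

definition Udeg :: "nat \<Rightarrow> (nat \<Rightarrow> nat) \<Rightarrow> nat \<Rightarrow> 'a::ring_1 ufree set" where
  "Udeg n lam m = {x. \<exists>y\<in>fspan {prod_list (map fgen l) | l.
        set l \<subseteq> gbasis n lam \<and> sum_list (map (\<lambda>(i, j, r). r) l) = m}. x - y \<in> Kset n lam}"

text \<open>d_r: lambda_n copies of 1, then lambda_{n-1} copies of 2, ..., lambda_1 copies of n.\<close>
definition dseq :: "nat \<Rightarrow> (nat \<Rightarrow> nat) \<Rightarrow> nat \<Rightarrow> nat" where
  "dseq n lam r = (LEAST k. r \<le> (\<Sum>t<k. lam (n - t)))"

definition supp_mu :: "nat \<Rightarrow> (nat \<Rightarrow> nat) \<Rightarrow> nat set" where
  "supp_mu n mu = {i \<in> {1..n}. mu i \<noteq> 0}"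

definition Mus :: "nat \<Rightarrow> (nat \<Rightarrow> nat) \<Rightarrow> nat \<Rightarrow> (nat \<Rightarrow> nat) set" where
  "Mus n lam r = {mu. (\<forall>i. mu i \<le> (if i \<in> {1..n} then lam i else 0))
      \<and> (\<Sum>i\<in>{1..n}. mu i) = r \<and> card (supp_mu n mu) = dseq n lam r}"

definition cdet_mu :: "nat \<Rightarrow> (nat \<Rightarrow> nat) \<Rightarrow> (nat \<Rightarrow> nat) \<Rightarrow> 'a::ring_1 ufree" where
  "cdet_mu n lam mu = (let is = sorted_list_of_set (supp_mu n mu); d = length is in
     (\<Sum>w\<in>{w. w permutes {0..<d}}. of_int (sign w) *
        prod_list (map (\<lambda>k. etil lam (is ! w k) (is ! k) (mu (is ! k) - 1)) [0..<d])))"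

definition zU :: "nat \<Rightarrow> (nat \<Rightarrow> nat) \<Rightarrow> nat \<Rightarrow> 'a::ring_1 ufree" where
  "zU n lam r = (\<Sum>mu\<in>Mus n lam r. cdet_mu n lam mu)"

text \<open>Phi m x represents phi(gr_m x) for x in F_m W(lambda).\<close>
definition is_gr_iso :: "nat \<Rightarrow> (nat \<Rightarrow> nat) \<Rightarrow> (nat \<Rightarrow> 'a::ring_1 yfree \<Rightarrow> 'a ufree) \<Rightarrow> bool" where
  "is_gr_iso n lam Phi \<longleftrightarrow>
     (\<forall>m x. x \<in> Filt n lam m \<longrightarrow> (Phi m x \<in> Kset n lam \<longleftrightarrow> x \<in> Fprev n lam m))
   \<and> (\<forall>m x y. x \<in> Filt n lam m \<longrightarrow> y \<in> Filt n lam m \<longrightarrow>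
        Phi m (x + y) - Phi m x - Phi m y \<in> Kset n lam)
   \<and> (\<forall>m x c. x \<in> Filt n lam m \<longrightarrow> Phi m (fconst c * x) - fconst c * Phi m x \<in> Kset n lam)
   \<and> (\<forall>m m' x y. x \<in> Filt n lam m \<longrightarrow> y \<in> Filt n lam m' \<longrightarrow>
        Phi (m + m') (x * y) - Phi m x * Phi m' y \<in> Kset n lam)
   \<and> Phi 0 1 - 1 \<in> Kset n lam
   \<and> (\<forall>m x. x \<in> Filt n lam m \<longrightarrow> Phi m x \<in> Udeg n lam m)
   \<and> (\<forall>m u. u \<in> Udeg n lam m \<longrightarrow> (\<exists>x\<in>Filt n lam m. Phi m x - u \<in> Kset n lam))
   \<and> (\<forall>i j r. (i, j, r) \<in> gbasis n lam \<longrightarrow>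
        Phi r (Tw lam i j (r + 1)) - (- 1) ^ r * egen i j r \<in> Kset n lam)"

end

(* The coefficients of Z(u) are sums, over parts mu of lambda, of products of entries whose loop degree is
   mu_j - 1; so the degree of a summand is |mu| minus the number of nonzero parts, which is largest when
   mu has the minimal number d_r of parts, and the leading terms assemble to z_r.

   Centrality of z_r is proved inside U(g_e), without the Yangian. Put
     M_{ij} = delta_{ij} + x (sum_r e_{ij;r} t^r - delta_{ij} (i-1) lambda_i),
   so that z_r is the coefficient of x^d t^(r-d), d = d_r, in cdet M. It is enough to commute with
   e_{pp;s} and with the lowest e_{pq;s}, p and q adjacent. Such a commutator replaces column p of M by
   t^(-s) times column q, and row q by row p, up to truncation of the series. As p and q are adjacent no
   columns need to be reordered, and the classical cancellation leaves only commutators within column q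
   and the truncation errors. Both are confined to degrees at most the sum of the d-1 largest parts of
   lambda minus d, hence do not reach t^(r-d); at the boundary degree the commutators are compensated
   exactly by the shifts (i-1) lambda_i. *)

theory Submission
  imports Defs
begin

section \<open>Quotients by ideals\<close>

text \<open>Calculations modulo the relations of U(g_e) take place in an honest quotient ring,
  because its elements have to serve as coefficients of series in \<open>t\<close>, and these as
  coefficients of series in \<open>x\<close>. A commutator is multiplied by t^s, rather than a
  column by t^(-s), so that no negative exponents arise. The bound rests on d_r being the least
  number of parts of lambda that can sum to r: any d-1 parts sum to less than r. A factor
  \<open>x\<close> taken from column j brings at most t^(lam_j-1), so a term that effectively
  exploits only d-1 columns cannot reach t^(r-d). The constants (i-1)*lam_i come from the argument
  u-j+1: they are, up to sign, the subleading coefficients of (u-j+1)^(lam_j). In the bracket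
  computation they return for another reason: for adjacent rows of equal length they differ by
  lam_q, and in top degree column q produces exactly lam_q commutators, all equal to the same basis
  element up to sign. Diagonal and lowest adjacent elements suffice because all other basis elements
  are iterated brackets of them.\<close>

lemma ideal_gen_zero: "0 \<in> ideal_gen G"
  unfolding ideal_gen_def by (auto intro: exI[of _ 0])

lemma ideal_gen_add:
  assumes "x \<in> ideal_gen G" "y \<in> ideal_gen G"
  shows "x + y \<in> ideal_gen G"
proof -
  obtain m a b g where x: "\<forall>k<m. g k \<in> G" "x = (\<Sum>k<(m::nat). a k * g k * b k)"
    using assms(1) unfolding ideal_gen_def by blast
  obtain m' a' b' g' where y: "\<forall>k<m'. g' k \<in> G" "y = (\<Sum>k<(m'::nat). a' k * g' k * b' k)"
    using assms(2) unfolding ideal_gen_def by blast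
  let ?c = "\<lambda>f f' k. if k < m then f k else f' (k - m)"
  have "(\<Sum>k<m + m'. ?c a a' k * ?c g g' k * ?c b b' k) = x + y"
  proof -
    have "(\<Sum>k<m + m'. h k) = (\<Sum>k<m. h k) + (\<Sum>k<m'. h (m + k))" for h :: "nat \<Rightarrow> 'a"
      by (induction m') (simp_all add: add.assoc)
    then show ?thesis
      unfolding x y by simp
  qed
  moreover have "\<forall>k<m + m'. ?c g g' k \<in> G"
    using x(1) y(1) by auto
  ultimately show ?thesis
    unfolding ideal_gen_def by (intro CollectI exI[of _ "m + m'"] exI[of _ "?c a a'"]
        exI[of _ "?c b b'"] exI[of _ "?c g g'"]) simp
qed

lemma ideal_gen_mult_left: "x \<in> ideal_gen G \<Longrightarrow> c * x \<in> ideal_gen G"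
proof -
  assume "x \<in> ideal_gen G"
  then obtain m a b g where "\<forall>k<m. g k \<in> G" "x = (\<Sum>k<(m::nat). a k * g k * b k)"
    unfolding ideal_gen_def by blast
  then show ?thesis
    unfolding ideal_gen_def
    by (intro CollectI exI[of _ m] exI[of _ "\<lambda>k. c * a k"] exI[of _ b] exI[of _ g])
      (simp add: sum_distrib_left mult.assoc)
qed

lemma ideal_gen_mult_right: "x \<in> ideal_gen G \<Longrightarrow> x * c \<in> ideal_gen G"
proof -
  assume "x \<in> ideal_gen G"
  then obtain m a b g where "\<forall>k<m. g k \<in> G" "x = (\<Sum>k<(m::nat). a k * g k * b k)"
    unfolding ideal_gen_def by blast
  then show ?thesis
    unfolding ideal_gen_def
    by (intro CollectI exI[of _ m] exI[of _ a] exI[of _ "\<lambda>k. b k * c"] exI[of _ g])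
      (simp add: sum_distrib_right mult.assoc)
qed

lemma ideal_gen_uminus: "x \<in> ideal_gen G \<Longrightarrow> - x \<in> ideal_gen (G :: 'r::ring_1 set)"
  using ideal_gen_mult_left[of x G "- 1"] by simp

lemma ideal_gen_diff:
  "x \<in> ideal_gen G \<Longrightarrow> y \<in> ideal_gen G \<Longrightarrow> x - y \<in> ideal_gen (G :: 'r::ring_1 set)"
  using ideal_gen_add[of x G "- y"] ideal_gen_uminus[of y G] by simp

lemma ideal_gen_base: "x \<in> G \<Longrightarrow> x \<in> ideal_gen (G :: 'r::ring_1 set)"
  unfolding ideal_gen_def
  by (intro CollectI exI[of _ 1] exI[of _ "\<lambda>_. 1"] exI[of _ "\<lambda>_. x"]) simp

text \<open>A type cannot depend on the parameters of the ideal, so the quotients of a ring by all its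
  ideals are formed at once, as one product ring indexed by generating sets.\<close>

definition allquot_rel :: "('r::ring_1 set \<Rightarrow> 'r) \<Rightarrow> ('r set \<Rightarrow> 'r) \<Rightarrow> bool" where
  "allquot_rel f g \<longleftrightarrow> (\<forall>G. f G - g G \<in> ideal_gen G)"

quotient_type (overloaded) 'r allquot = "'r::ring_1 set \<Rightarrow> 'r" / allquot_rel
proof (rule equivpI)
  show "reflp allquot_rel"
    by (rule reflpI) (simp add: allquot_rel_def ideal_gen_zero)
  show "symp allquot_rel"
    by (rule sympI) (metis allquot_rel_def ideal_gen_uminus minus_diff_eq)
  show "transp allquot_rel"
  proof (rule transpI)
    fix f g h
    assume fg: "allquot_rel f g" and gh: "allquot_rel g h"
    have "(f G - g G) + (g G - h G) \<in> ideal_gen G" for G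
      using fg gh unfolding allquot_rel_def by (intro ideal_gen_add) auto
    then show "allquot_rel f h"
      unfolding allquot_rel_def by simp
  qed
qed

instantiation allquot :: (ring_1) "{ring, one, monoid_mult}"
begin

lift_definition zero_allquot :: "'a allquot" is "\<lambda>_. 0" .
lift_definition one_allquot :: "'a allquot" is "\<lambda>_. 1" .
lift_definition plus_allquot :: "'a allquot \<Rightarrow> 'a allquot \<Rightarrow> 'a allquot" is "\<lambda>f g G. f G + g G"
proof -
  fix f f' g g' :: "'a set \<Rightarrow> 'a"
  assume f: "allquot_rel f f'" and g: "allquot_rel g g'"
  have "f G + g G - (f' G + g' G) \<in> ideal_gen G" for G
    using ideal_gen_add[of "f G - f' G" G "g G - g' G"] f g
    by (simp add: allquot_rel_def algebra_simps)
  then show "allquot_rel (\<lambda>G. f G + g G) (\<lambda>G. f' G + g' G)"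
    by (simp add: allquot_rel_def)
qed
lift_definition uminus_allquot :: "'a allquot \<Rightarrow> 'a allquot" is "\<lambda>f G. - f G"
  by (metis (no_types, lifting) allquot_rel_def ideal_gen_uminus minus_diff_minus)
lift_definition minus_allquot :: "'a allquot \<Rightarrow> 'a allquot \<Rightarrow> 'a allquot" is "\<lambda>f g G. f G - g G"
proof -
  fix f f' g g' :: "'a set \<Rightarrow> 'a"
  assume f: "allquot_rel f f'" and g: "allquot_rel g g'"
  have "f G - g G - (f' G - g' G) \<in> ideal_gen G" for G
    using ideal_gen_diff[of "f G - f' G" G "g G - g' G"] f g
    by (simp add: allquot_rel_def algebra_simps)
  then show "allquot_rel (\<lambda>G. f G - g G) (\<lambda>G. f' G - g' G)"
    by (simp add: allquot_rel_def)
qed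
lift_definition times_allquot :: "'a allquot \<Rightarrow> 'a allquot \<Rightarrow> 'a allquot" is "\<lambda>f g G. f G * g G"
proof -
  fix f f' g g' :: "'a set \<Rightarrow> 'a"
  assume f: "allquot_rel f f'" and g: "allquot_rel g g'"
  have "f G * g G - f' G * g' G \<in> ideal_gen G" for G
    using ideal_gen_add[OF ideal_gen_mult_right[of "f G - f' G" G "g G"]
        ideal_gen_mult_left[of "g G - g' G" G "f' G"]] f g
    by (simp add: allquot_rel_def algebra_simps)
  then show "allquot_rel (\<lambda>G. f G * g G) (\<lambda>G. f' G * g' G)"
    by (simp add: allquot_rel_def)
qed

instance
  by standard (transfer, simp add: allquot_rel_def algebra_simps ideal_gen_zero)+
end

text \<open>The product ring is nontrivial because its component at the empty generating set is the ring
  itself.\<close>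

instance allquot :: (ring_1) ring_1
proof
  have "ideal_gen {} = {0 :: 'a}"
    unfolding ideal_gen_def by (auto intro!: exI[of _ 0] sum.neutral)
  then show "(0 :: 'a allquot) \<noteq> 1"
    by transfer (auto simp: allquot_rel_def intro!: exI[of _ "{}"])
qed

text \<open>Supported at the single component \<open>G0\<close>, hence additive and multiplicative
  but not unital. Expressions containing 1 or integers are therefore carried back by the relation
  \<open>represents\<close> rather than by this map.\<close>

lift_definition quot_at :: "'r::ring_1 set \<Rightarrow> 'r \<Rightarrow> 'r allquot" is
  "\<lambda>G0 x G. if G = G0 then x else 0" .

text \<open>Looks only at the component \<open>G\<close>. Being compatible with all ring operations,
  it turns an equality in the product ring into a congruence modulo
  \<open>ideal_gen G\<close>.\<close>

lift_definition represents :: "'r::ring_1 set \<Rightarrow> 'r allquot \<Rightarrow> 'r \<Rightarrow> bool" is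
  "\<lambda>G f x. f G - x \<in> ideal_gen G"
proof -
  fix G f f'
  assume "allquot_rel f f'"
  then have d: "f G - f' G \<in> ideal_gen G"
    by (simp add: allquot_rel_def)
  have "(f G - x \<in> ideal_gen G) = (f' G - x \<in> ideal_gen G)" for x
    using ideal_gen_add[OF d, of "f' G - x"] ideal_gen_diff[OF _ d, of "f G - x"] by auto
  then show "(\<lambda>x. f G - x \<in> ideal_gen G) = (\<lambda>x. f' G - x \<in> ideal_gen G)"
    by simp
qed

lemma represents_quot_at: "represents G (quot_at G x) x"
  by transfer (simp add: ideal_gen_zero)

lemma represents_0: "represents G 0 0"
  by transfer (simp add: ideal_gen_zero)

lemma represents_1: "represents G 1 1"
  by transfer (simp add: ideal_gen_zero)

lemma represents_0_iff: "represents G 0 x \<longleftrightarrow> x \<in> ideal_gen G"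
  by transfer (use ideal_gen_uminus in force)

lemma represents_add:
  "represents G a x \<Longrightarrow> represents G b y \<Longrightarrow> represents G (a + b) (x + y)"
proof transfer
  fix G :: "'a set" and a x b y
  assume "a G - x \<in> ideal_gen G" "b G - y \<in> ideal_gen G"
  from ideal_gen_add[OF this] show "a G + b G - (x + y) \<in> ideal_gen G"
    by (simp add: algebra_simps)
qed

lemma represents_uminus: "represents G a x \<Longrightarrow> represents G (- a) (- x)"
proof transfer
  fix G :: "'a set" and a x
  assume "a G - x \<in> ideal_gen G"
  from ideal_gen_uminus[OF this] show "- a G - (- x) \<in> ideal_gen G"
    by (simp add: algebra_simps)
qed

lemma represents_diff:
  "represents G a x \<Longrightarrow> represents G b y \<Longrightarrow> represents G (a - b) (x - y)"
  using represents_add[of G a x "- b" "- y"] represents_uminus[of G b y] by simp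

lemma represents_mult:
  "represents G a x \<Longrightarrow> represents G b y \<Longrightarrow> represents G (a * b) (x * y)"
proof transfer
  fix G :: "'a set" and a x b y
  assume "a G - x \<in> ideal_gen G" "b G - y \<in> ideal_gen G"
  from ideal_gen_add[OF ideal_gen_mult_right[OF this(1), of "b G"] ideal_gen_mult_left[OF this(2), of x]]
  show "a G * b G - (x * y) \<in> ideal_gen G"
    by (simp add: algebra_simps)
qed

lemma represents_of_nat: "represents G (of_nat k) (of_nat k)"
  by (induction k) (auto simp: represents_0 intro: represents_add represents_1)

lemma represents_of_int: "represents G (of_int k) (of_int k)"
  by (cases k rule: int_cases2) (auto simp: represents_of_nat intro: represents_uminus)

lemma represents_sum:
  "(\<And>i. i \<in> A \<Longrightarrow> represents G (f i) (g i)) \<Longrightarrow> represents G (sum f A) (sum g A)"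
  by (induction A rule: infinite_finite_induct) (auto simp: represents_0 intro: represents_add)

lemma represents_prod_list:
  "(\<And>i. i \<in> set l \<Longrightarrow> represents G (f i) (g i)) \<Longrightarrow>
    represents G (prod_list (map f l)) (prod_list (map g l))"
  by (induction l) (auto simp: represents_1 intro: represents_mult)

lemma quot_at_eqI: "x - y \<in> ideal_gen G \<Longrightarrow> quot_at G x = quot_at G y"
  by transfer (auto simp: allquot_rel_def ideal_gen_zero)

lemma quot_at_0 [simp]: "quot_at G 0 = 0"
  by transfer (auto simp: allquot_rel_def ideal_gen_zero)

lemma quot_at_diff: "quot_at G (x - y) = quot_at G x - quot_at G y"
  by transfer (auto simp: allquot_rel_def ideal_gen_zero)

lemma quot_at_mult: "quot_at G (x * y) = quot_at G x * quot_at G y"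
  by transfer (auto simp: allquot_rel_def ideal_gen_zero)

section \<open>Commutators of column determinants\<close>

declare upt_Suc [simp del]

text \<open>Distinctness lets position \<open>k\<close> occur exactly once, so the outer factors do
  not depend on \<open>v\<close>. The multilinearity facts below all follow from this form.\<close>

lemma prod_list_fun_upd:
  fixes a :: "'i \<Rightarrow> 'b::ring_1"
  assumes "distinct l" "k \<in> set l"
  obtains c d where "\<And>v. prod_list (map (a(k := v)) l) = c * v * d"
proof -
  obtain l1 l2 where l: "l = l1 @ k # l2"
    using assms(2) by (auto simp: in_set_conv_decomp)
  have "prod_list (map (a(k := v)) l) = prod_list (map a l1) * v * prod_list (map a l2)" for v
  proof -
    have "map (a(k := v)) l1 = map a l1" "map (a(k := v)) l2 = map a l2"
      using assms(1) l by auto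
    then show ?thesis
      unfolding l map_append list.map prod_list.append by (simp only: prod_list.Cons mult.assoc fun_upd_same)
  qed
  then show ?thesis
    by (rule that)
qed

lemma prod_list_fun_upd_diff:
  fixes a :: "'i \<Rightarrow> 'b::ring_1"
  assumes "distinct l" "k \<in> set l"
  shows "prod_list (map (a(k := u - v)) l) = prod_list (map (a(k := u)) l) - prod_list (map (a(k := v)) l)"
  by (rule prod_list_fun_upd[OF assms, of a]) (simp add: algebra_simps)

lemma prod_list_fun_upd_add:
  fixes a :: "'i \<Rightarrow> 'b::ring_1"
  assumes "distinct l" "k \<in> set l"
  shows "prod_list (map (a(k := u + v)) l) = prod_list (map (a(k := u)) l) + prod_list (map (a(k := v)) l)"
  by (rule prod_list_fun_upd[OF assms, of a]) (simp add: algebra_simps)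

lemma prod_list_fun_upd_0:
  fixes a :: "'i \<Rightarrow> 'b::ring_1"
  assumes "distinct l" "k \<in> set l"
  shows "prod_list (map (a(k := 0)) l) = 0"
  by (rule prod_list_fun_upd[OF assms, of a]) simp

lemma prod_list_fun_upd_central:
  fixes a :: "'i \<Rightarrow> 'b::ring_1"
  assumes "distinct l" "k \<in> set l" "\<And>y. t * y = y * t"
  shows "prod_list (map (a(k := t * v)) l) = t * prod_list (map (a(k := v)) l)"
  by (rule prod_list_fun_upd[OF assms(1,2), of a]) (metis assms(3) mult.assoc)

text \<open>Leibniz rule: bracketing with \<open>C\<close> is a derivation and acts on one factor at
  a time.\<close>

lemma prod_list_commutator:
  fixes a :: "'i \<Rightarrow> 'b::ring_1"
  assumes "distinct l"
  shows "prod_list (map a l) * C - C * prod_list (map a l)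
    = (\<Sum>k\<in>set l. prod_list (map (a(k := a k * C - C * a k)) l))"
  using assms
proof (induction l)
  case (Cons x l)
  let ?Q = "prod_list (map a l)"
  have "(\<Sum>k\<in>set l. prod_list (map (a(k := a k * C - C * a k)) (x # l)))
      = (\<Sum>k\<in>set l. a x * prod_list (map (a(k := a k * C - C * a k)) l))"
    using Cons.prems by (intro sum.cong) auto
  also have "\<dots> = a x * (?Q * C - C * ?Q)"
    unfolding sum_distrib_left[symmetric] by (subst Cons.IH) (use Cons.prems in auto)
  finally have 1: "(\<Sum>k\<in>set l. prod_list (map (a(k := a k * C - C * a k)) (x # l)))
      = a x * (?Q * C - C * ?Q)" .
  have 2: "map (a(x := a x * C - C * a x)) l = map a l"
    using Cons.prems by auto
  have "(\<Sum>k\<in>set (x # l). prod_list (map (a(k := a k * C - C * a k)) (x # l)))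
     = (a x * C - C * a x) * ?Q + a x * (?Q * C - C * ?Q)"
    unfolding 1[symmetric] using Cons.prems 2 by simp
  moreover have "(a x * ?Q) * C - C * (a x * ?Q) = (a x * C - C * a x) * ?Q + a x * (?Q * C - C * ?Q)"
    by (simp add: algebra_simps)
  ultimately show ?case
    by (simp only: list.map prod_list.Cons)
qed simp

text \<open>\<open>Q\<close> picks one element from each orbit of a fixed-point-free involution.
  Pairing terms in this way avoids a division by 2 and so works in every ring.\<close>

lemma sum_involution:
  assumes "finite S" "\<And>w. w \<in> S \<Longrightarrow> \<sigma> w \<in> S" "\<And>w. w \<in> S \<Longrightarrow> \<sigma> (\<sigma> w) = w"
    and "\<And>w. w \<in> S \<Longrightarrow> Q (\<sigma> w) \<longleftrightarrow> \<not> Q w"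
  shows "sum f S = (\<Sum>w\<in>{w\<in>S. Q w}. f w + f (\<sigma> w))"
proof -
  have "sum f S = sum f {w\<in>S. Q w} + sum f {w\<in>S. \<not> Q w}"
    using assms(1) by (subst sum.union_disjoint[symmetric]) (auto intro: sum.cong)
  also have "sum f {w\<in>S. \<not> Q w} = (\<Sum>w\<in>{w\<in>S. Q w}. f (\<sigma> w))"
    by (rule sum.reindex_bij_witness[of _ \<sigma> \<sigma>]) (use assms in auto)
  finally show ?thesis
    by (simp add: sum.distrib)
qed

definition cdet :: "nat \<Rightarrow> (nat \<Rightarrow> nat \<Rightarrow> 'b::ring_1) \<Rightarrow> 'b" where
  "cdet n F = (\<Sum>w\<in>{w. w permutes {1..n}}.
     of_int (sign w) * prod_list (map (\<lambda>j. F (w j) j) [1..<n + 1]))"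

lemma sign_compose_transpose:
  assumes "w permutes {1..n::nat}" "p \<in> {1..n}" "q \<in> {1..n}" "p \<noteq> q"
  shows "sign (w \<circ> transpose p q) = - sign w" "sign (transpose p q \<circ> w) = - sign w"
    "w \<circ> transpose p q permutes {1..n}" "transpose p q \<circ> w permutes {1..n}"
proof -
  have t: "transpose p q permutes {1..n}"
    using assms(2,3) by (rule permutes_swap_id)
  have "permutation w" "permutation (transpose p q)"
    using assms(1) t by (auto intro: permutes_imp_permutation)
  then show "sign (w \<circ> transpose p q) = - sign w" "sign (transpose p q \<circ> w) = - sign w"
    using assms(4) by (auto simp: sign_compose sign_swap_id)
  show "w \<circ> transpose p q permutes {1..n}" "transpose p q \<circ> w permutes {1..n}"
    using assms(1) t by (auto intro: permutes_compose)
qed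

text \<open>Composing with the transposition on the left permutes rows and keeps the column order of
  the factors, so the usual sign cancellation survives without commutativity.\<close>

lemma cdet_equal_rows:
  assumes "p \<in> {1..n}" "q \<in> {1..n}" "p \<noteq> q" "\<And>j. F p j = F q j"
  shows "cdet n F = 0"
proof -
  let ?\<tau> = "transpose p q"
  let ?f = "\<lambda>w. of_int (sign w) * prod_list (map (\<lambda>j. F (w j) j) [1..<n + 1])"
  have F: "F (?\<tau> i) j = F i j" for i j
    using assms(4) by (auto simp: transpose_def)
  \<comment> \<open>Each pair is represented by the permutation that meets row \<open>p\<close> in
    an earlier column than row \<open>q\<close>.\<close>
  have "cdet n F = (\<Sum>w\<in>{w\<in>{w. w permutes {1..n}}. inv w p < inv w q}. ?f w + ?f (?\<tau> \<circ> w))"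
    unfolding cdet_def
  proof (rule sum_involution)
    fix w assume "w \<in> {w. w permutes {1..n}}"
    then have w: "w permutes {1..n}"
      by simp
    have iw: "inv (?\<tau> \<circ> w) = inv w \<circ> ?\<tau>"
      using w by (simp add: o_inv_distrib permutes_bij)
    have "inv w p \<noteq> inv w q"
      using w assms(3) by (metis permutes_inverses(1))
    then show "inv (?\<tau> \<circ> w) p < inv (?\<tau> \<circ> w) q \<longleftrightarrow> \<not> inv w p < inv w q"
      unfolding iw by auto
    show "?\<tau> \<circ> w \<in> {w. w permutes {1..n}}"
      using sign_compose_transpose(4)[OF w assms(1-3)] by simp
  qed (auto simp: finite_permutations fun_eq_iff)
  also have "\<dots> = 0"
  proof (rule sum.neutral, rule ballI)
    fix w assume "w \<in> {w\<in>{w. w permutes {1..n}}. inv w p < inv w q}"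
    then show "?f w + ?f (?\<tau> \<circ> w) = 0"
      using sign_compose_transpose(2)[of w n p q] assms(1-3) by (simp add: F)
  qed
  finally show ?thesis .
qed

text \<open>Duplicating a column next to itself does not kill a noncommutative column determinant: what
  remains is a sum of commutators inside that column.\<close>

lemma cdet_adjacent_columns:
  fixes M :: "nat \<Rightarrow> nat \<Rightarrow> 'b::ring_1"
  assumes p: "p \<in> {1..n}" and q: "q \<in> {1..n}" and adj: "p = Suc q \<or> q = Suc p"
    and comm: "\<And>i i'. i \<in> {1..n} \<Longrightarrow> i' \<in> {1..n} \<Longrightarrow> i \<noteq> q \<Longrightarrow> i' \<noteq> q \<Longrightarrow> M i q * M i' q = M i' q * M i q"
  shows "(\<Sum>w\<in>{w. w permutes {1..n}}. of_int (sign w) *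
        prod_list (map ((\<lambda>j. M (w j) j)(p := M (w p) q)) [1..<n + 1]))
    = (\<Sum>w\<in>{w. w permutes {1..n} \<and> w p = q}. of_int (sign w) *
        prod_list (map ((\<lambda>j. M (w j) j)(p := 1, q :=
          (if p < q then M q q * M (w q) q - M (w q) q * M q q
           else M (w q) q * M q q - M q q * M (w q) q))) [1..<n + 1]))"
    (is "sum ?f _ = sum ?g _")
proof -
  let ?\<tau> = "transpose p q"
  \<comment> \<open>A pair of permutations is represented by the member sending \<open>p\<close> to
    \<open>q\<close> whenever there is one. Only such pairs contribute; the others involve two
    commuting entries of column \<open>q\<close>.\<close>
  let ?Q = "\<lambda>w. w p = q \<or> (w q \<noteq> q \<and> w p < w q)"
  define lo where "lo = min p q"
  have pq: "p \<noteq> q" and lo: "1 \<le> lo" "lo < n"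
    using p q adj by (auto simp: lo_def)
  \<comment> \<open>Adjacency makes the two factors neighbours, so exchanging them yields a bare
    commutator between fixed outer factors.\<close>
  have split: "[1..<n + 1] = [1..<lo] @ [lo, Suc lo] @ [Suc (Suc lo)..<n + 1]"
  proof -
    have "[1..<n + 1] = [1..<lo] @ [lo..<n + 1]"
      using lo by (metis add.commute le_add2 le_Suc_ex less_imp_le_nat trans_le_add2 upt_add_eq_append)
    also have "[lo..<n + 1] = [lo, Suc lo] @ [Suc (Suc lo)..<n + 1]"
      using lo by (simp add: upt_rec)
    finally show ?thesis .
  qed
  have outer: "map (a(p := u, q := v)) [1..<lo] = map a [1..<lo]"
    "map (a(p := u, q := v)) [Suc (Suc lo)..<n + 1] = map a [Suc (Suc lo)..<n + 1]" for a u v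
    using adj by (auto simp: lo_def)
  have pl: "prod_list (map (a(p := u, q := v)) [1..<n + 1])
      = prod_list (map a [1..<lo]) * (if p < q then u * v else v * u)
        * prod_list (map a [Suc (Suc lo)..<n + 1])" for a :: "nat \<Rightarrow> 'b" and u v
    unfolding split map_append prod_list.append outer
    using adj by (auto simp: lo_def mult.assoc)
  have "sum ?f {w. w permutes {1..n}} = (\<Sum>w\<in>{w\<in>{w. w permutes {1..n}}. ?Q w}. ?f w + ?f (w \<circ> ?\<tau>))"
  proof (rule sum_involution)
    fix w assume "w \<in> {w. w permutes {1..n}}"
    then have w: "w permutes {1..n}"
      by simp
    have "w p \<noteq> w q"
      using w pq by (metis permutes_inverses(2))
    then show "?Q (w \<circ> ?\<tau>) \<longleftrightarrow> \<not> ?Q w"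
      by auto
    show "w \<circ> ?\<tau> \<in> {w. w permutes {1..n}}"
      using sign_compose_transpose(3)[OF w p q pq] by simp
  qed (auto simp: finite_permutations fun_eq_iff)
  also have "\<dots> = (\<Sum>w\<in>{w\<in>{w. w permutes {1..n}}. ?Q w}. if w p = q then ?g w else 0)"
  proof (rule sum.cong[OF refl])
    fix w assume "w \<in> {w\<in>{w. w permutes {1..n}}. ?Q w}"
    then have w: "w permutes {1..n}" and Q: "?Q w"
      by auto
    have wpq: "w p \<noteq> w q"
      using w pq by (metis permutes_inverses(2))
    let ?a = "\<lambda>j. M (w j) j"
    let ?pre = "prod_list (map ?a [1..<lo])"
    let ?post = "prod_list (map ?a [Suc (Suc lo)..<n + 1])"
    have 1: "?a(p := M (w p) q) = ?a(p := M (w p) q, q := M (w q) q)"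
      by (auto simp: fun_eq_iff)
    have 2: "(\<lambda>j. M ((w \<circ> ?\<tau>) j) j)(p := M ((w \<circ> ?\<tau>) p) q) = ?a(p := M (w q) q, q := M (w p) q)"
      by (auto simp: fun_eq_iff transpose_def)
    have 3: "prod_list (map (?a(p := M (w p) q)) [1..<n + 1])
      = ?pre * (if p < q then M (w p) q * M (w q) q else M (w q) q * M (w p) q) * ?post"
      by (subst 1) (rule pl)
    have 4: "prod_list (map ((\<lambda>j. M ((w \<circ> ?\<tau>) j) j)(p := M ((w \<circ> ?\<tau>) p) q)) [1..<n + 1])
      = ?pre * (if p < q then M (w q) q * M (w p) q else M (w p) q * M (w q) q) * ?post"
      by (subst 2) (rule pl)
    have "?f w + ?f (w \<circ> ?\<tau>) = of_int (sign w) * (?pre *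
      (if p < q then M (w p) q * M (w q) q - M (w q) q * M (w p) q
        else M (w q) q * M (w p) q - M (w p) q * M (w q) q) * ?post)"
      unfolding 3 4 sign_compose_transpose(1)[OF w p q pq]
      by (cases "p < q") (simp_all add: left_diff_distrib right_diff_distrib mult.assoc)
    also have "\<dots> = (if w p = q then ?g w else 0)"
    proof (cases "w p = q")
      case True
      then show ?thesis
        unfolding pl by simp
    next
      case False
      then have "M (w p) q * M (w q) q = M (w q) q * M (w p) q"
        using Q w p q by (intro comm) (auto simp: permutes_in_image simp del: atLeastAtMost_iff)
      then show ?thesis
        using False by simp
    qed
    finally show "?f w + ?f (w \<circ> ?\<tau>) = (if w p = q then ?g w else 0)" .
  qed
  also have "\<dots> = sum ?g {w. w permutes {1..n} \<and> w p = q}"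
    by (rule sum.mono_neutral_cong_right) (auto simp: finite_permutations)
  finally show ?thesis .
qed

text \<open>\<open>A\<close> replaces column \<open>p\<close> and \<open>B\<close> replaces row
  \<open>q\<close>, the two effects of bracketing with a matrix unit; \<open>inv w q\<close> is the
  column where \<open>w\<close> meets row \<open>q\<close>. \<open>R\<close> collects the truncation
  errors, and the central \<open>t\<close> will be the power t^s.\<close>

lemma cdet_commutator:
  fixes M :: "nat \<Rightarrow> nat \<Rightarrow> 'b::ring_1"
  assumes p: "p \<in> {1..n}" and q: "q \<in> {1..n}" and t: "\<And>y. t * y = y * t"
    and M: "\<And>i j. i \<in> {1..n} \<Longrightarrow> j \<in> {1..n} \<Longrightarrow> t * (M i j * C - C * M i j)
      = (if j = p then A i else 0) - (if i = q then B j else 0) - R i j"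
  shows "t * (cdet n M * C - C * cdet n M)
    = (\<Sum>w\<in>{w. w permutes {1..n}}. of_int (sign w) *
        prod_list (map ((\<lambda>j. M (w j) j)(p := A (w p))) [1..<n + 1]))
    - (\<Sum>w\<in>{w. w permutes {1..n}}. of_int (sign w) *
        prod_list (map ((\<lambda>j. M (w j) j)(inv w q := B (inv w q))) [1..<n + 1]))
    - (\<Sum>w\<in>{w. w permutes {1..n}}. of_int (sign w) * (\<Sum>k\<in>{1..n}.
        prod_list (map ((\<lambda>j. M (w j) j)(k := R (w k) k)) [1..<n + 1])))"
proof -
  let ?L = "[1..<n + 1]"
  have L: "distinct ?L" "set ?L = {1..n}"
    by auto
  have "t * (of_int (sign w) * prod_list (map (\<lambda>j. M (w j) j) ?L) * C
       - C * (of_int (sign w) * prod_list (map (\<lambda>j. M (w j) j) ?L)))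
    = of_int (sign w) * prod_list (map ((\<lambda>j. M (w j) j)(p := A (w p))) ?L)
    - of_int (sign w) * prod_list (map ((\<lambda>j. M (w j) j)(inv w q := B (inv w q))) ?L)
    - of_int (sign w) * (\<Sum>k\<in>{1..n}. prod_list (map ((\<lambda>j. M (w j) j)(k := R (w k) k)) ?L))"
    if w: "w permutes {1..n}" for w
  proof -
    let ?a = "\<lambda>j. M (w j) j"
    let ?P = "\<lambda>a. prod_list (map a ?L)"
    have iw: "inv w q \<in> {1..n}" "w k = q \<longleftrightarrow> k = inv w q" for k
      using w q permutes_inv[OF w] by (auto simp: permutes_in_image permutes_inverses
          simp del: atLeastAtMost_iff)
    have upd: "?P (?a(k := t * (?a k * C - C * ?a k)))
      = (if k = p then ?P (?a(p := A (w p))) else 0)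
      - (if k = inv w q then ?P (?a(inv w q := B (inv w q))) else 0)
      - ?P (?a(k := R (w k) k))" if k: "k \<in> {1..n}" for k
    proof -
      have wk: "w k \<in> {1..n}"
        using w k by (simp add: permutes_in_image del: atLeastAtMost_iff)
      have kL: "k \<in> set ?L"
        using k L(2) by simp
      have "?P (?a(k := t * (?a k * C - C * ?a k)))
        = ?P (?a(k := (if k = p then A (w k) else 0))) - ?P (?a(k := (if w k = q then B k else 0)))
          - ?P (?a(k := R (w k) k))"
        unfolding M[OF wk k] prod_list_fun_upd_diff[OF L(1) kL] ..
      then show ?thesis
        using prod_list_fun_upd_0[OF L(1) kL, of ?a] by (auto simp: iw(2))
    qed
    have "t * (?P ?a * C - C * ?P ?a) = (\<Sum>k\<in>{1..n}. ?P (?a(k := t * (?a k * C - C * ?a k))))"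
      unfolding prod_list_commutator[OF L(1)] sum_distrib_left L(2)
      by (rule sum.cong[OF refl], rule prod_list_fun_upd_central[OF L(1) _ t, symmetric])
        (use L(2) in auto)
    also have "\<dots> = (\<Sum>k\<in>{1..n}. (if k = p then ?P (?a(p := A (w p))) else 0)
      - (if k = inv w q then ?P (?a(inv w q := B (inv w q))) else 0) - ?P (?a(k := R (w k) k)))"
      by (intro sum.cong refl upd)
    also have "\<dots> = ?P (?a(p := A (w p))) - ?P (?a(inv w q := B (inv w q)))
       - (\<Sum>k\<in>{1..n}. ?P (?a(k := R (w k) k)))"
      using p iw(1) by (simp add: sum_subtractf)
    finally have *: "t * (?P ?a * C - C * ?P ?a) = \<dots>" .
    have "t * (of_int (sign w) * ?P ?a * C - C * (of_int (sign w) * ?P ?a))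
      = of_int (sign w) * (t * (?P ?a * C - C * ?P ?a))"
    proof -
      have "C * (of_int (sign w) * ?P ?a) = of_int (sign w) * (C * ?P ?a)"
        by (metis mult_of_int_commute mult.assoc)
      moreover have "t * (of_int (sign w) * y) = of_int (sign w) * (t * y)" for y
        by (metis t mult.assoc)
      ultimately show ?thesis
        by (simp only: right_diff_distrib mult.assoc)
    qed
    then show ?thesis
      unfolding * by (simp add: right_diff_distrib)
  qed
  then show ?thesis
    unfolding cdet_def sum_distrib_right sum_distrib_left sum_subtractf[symmetric]
    by (intro sum.cong) auto
qed

text \<open>The replaced column and row are the original ones up to \<open>\<kappa>\<close> at
  position (p, p). The correction matters only if \<open>w\<close> fixes \<open>p\<close>, and then
  it changes the same factor in both sums, so all but \<open>R\<close> cancels.\<close>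

lemma cdet_commutator_diagonal:
  fixes M :: "nat \<Rightarrow> nat \<Rightarrow> 'b::ring_1"
  assumes p: "p \<in> {1..n}" and t: "\<And>y. t * y = y * t"
    and M: "\<And>i j. i \<in> {1..n} \<Longrightarrow> j \<in> {1..n} \<Longrightarrow> t * (M i j * C - C * M i j)
      = (if j = p then M i p + (if i = p then \<kappa> else 0) else 0)
        - (if i = p then M p j + (if j = p then \<kappa> else 0) else 0) - R i j"
  shows "t * (cdet n M * C - C * cdet n M)
    = - (\<Sum>w\<in>{w. w permutes {1..n}}. of_int (sign w) * (\<Sum>k\<in>{1..n}.
        prod_list (map ((\<lambda>j. M (w j) j)(k := R (w k) k)) [1..<n + 1])))"
proof -
  let ?L = "[1..<n + 1]"
  have L: "distinct ?L" "set ?L = {1..n}"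
    by auto
  have "prod_list (map ((\<lambda>j. M (w j) j)(p := M (w p) p + (if w p = p then \<kappa> else 0))) ?L)
    = prod_list (map ((\<lambda>j. M (w j) j)(inv w p := M p (inv w p) + (if inv w p = p then \<kappa> else 0))) ?L)"
    if w: "w permutes {1..n}" for w
  proof -
    have iw: "inv w p \<in> {1..n}" "inv w p = p \<longleftrightarrow> w p = p" "M p (inv w p) = M (w (inv w p)) (inv w p)"
      using w p permutes_inv[OF w] by (auto simp: permutes_in_image permutes_inverses
          permutes_inv_eq simp del: atLeastAtMost_iff)
    let ?a = "\<lambda>j. M (w j) j"
    have upd: "prod_list (map (?a(k := ?a k + (if w p = p then \<kappa> else 0))) ?L)
        = prod_list (map ?a ?L) + (if w p = p then prod_list (map (?a(k := \<kappa>)) ?L) else 0)"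
      if "k \<in> {1..n}" for k
    proof -
      have k: "k \<in> set ?L"
        using that L(2) by simp
      have triv: "?a(k := ?a k) = ?a"
        by (rule fun_upd_triv)
      show ?thesis
        unfolding prod_list_fun_upd_add[OF L(1) k] triv
        using prod_list_fun_upd_0[OF L(1) k, of ?a] by auto
    qed
    show ?thesis
      unfolding iw(3) iw(2) upd[OF p] upd[OF iw(1)] using iw(2) by auto
  qed
  then have "(\<Sum>w\<in>{w. w permutes {1..n}}. of_int (sign w) *
        prod_list (map ((\<lambda>j. M (w j) j)(p := M (w p) p + (if w p = p then \<kappa> else 0))) ?L))
    = (\<Sum>w\<in>{w. w permutes {1..n}}. of_int (sign w) * prod_list (map
        ((\<lambda>j. M (w j) j)(inv w p := M p (inv w p) + (if inv w p = p then \<kappa> else 0))) ?L))"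
    by (intro sum.cong refl) (simp only: mem_Collect_eq)
  moreover note cdet_commutator[where A = "\<lambda>i. M i p + (if i = p then \<kappa> else 0)"
        and B = "\<lambda>j. M p j + (if j = p then \<kappa> else 0)" and R = R and M = M and C = C, OF p p t]
  ultimately show ?thesis
    using M by simp
qed

text \<open>The row replacement produces two equal rows and vanishes. The column replacement leaves
  commutators inside column \<open>q\<close>, to which the scalars \<open>\<kappa>p\<close>,
  \<open>\<kappa>q\<close> from the diagonal positions add their difference; the assumption on
  \<open>H\<close> makes the total divisible by \<open>x\<close>.\<close>

lemma cdet_commutator_adjacent:
  fixes M :: "nat \<Rightarrow> nat \<Rightarrow> 'b::ring_1"
  assumes p: "p \<in> {1..n}" and q: "q \<in> {1..n}" and adj: "p = Suc q \<or> q = Suc p"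
    and t: "\<And>y. t * y = y * t" and x: "\<And>y. x * y = y * x"
    and \<kappa>p: "\<And>y. \<kappa>p * y = y * \<kappa>p" and \<kappa>q: "\<And>y. \<kappa>q * y = y * \<kappa>q"
    and M: "\<And>i j. i \<in> {1..n} \<Longrightarrow> j \<in> {1..n} \<Longrightarrow> t * (M i j * C - C * M i j)
      = (if j = p then M i q + (if i = q then \<kappa>q else 0) else 0)
        - (if i = q then M p j + (if j = p then \<kappa>p else 0) else 0) - R i j"
    and comm: "\<And>i i'. i \<in> {1..n} \<Longrightarrow> i' \<in> {1..n} \<Longrightarrow> i \<noteq> q \<Longrightarrow> i' \<noteq> q \<Longrightarrow> M i q * M i' q = M i' q * M i q"
    and H: "\<And>i. i \<in> {1..n} \<Longrightarrow> i \<noteq> q \<Longrightarrow>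
      (if p < q then M q q * M i q - M i q * M q q else M i q * M q q - M q q * M i q)
        + (\<kappa>q - \<kappa>p) * M i q = x * H i"
  shows "t * (cdet n M * C - C * cdet n M)
    = (\<Sum>w\<in>{w. w permutes {1..n} \<and> w p = q}. of_int (sign w) *
        prod_list (map ((\<lambda>j. M (w j) j)(p := x, q := H (w q))) [1..<n + 1]))
    - (\<Sum>w\<in>{w. w permutes {1..n}}. of_int (sign w) * (\<Sum>k\<in>{1..n}.
        prod_list (map ((\<lambda>j. M (w j) j)(k := R (w k) k)) [1..<n + 1])))"
proof -
  let ?L = "[1..<n + 1]"
  let ?P = "\<lambda>a. prod_list (map a ?L)"
  let ?a = "\<lambda>w j. M (w j) j"
  let ?S = "{w. w permutes {1..n}}" and ?Sq = "{w. w permutes {1..n} \<and> w p = q}"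
  have L: "distinct ?L" "set ?L = {1..n}"
    by auto
  have pL: "p \<in> set ?L" and qL: "q \<in> set ?L"
    using p q L(2) by auto
  have pq: "p \<noteq> q"
    using adj by auto
  have restrict: "(\<Sum>w\<in>?S. of_int (sign w) * (if w p = q then f w else 0))
      = (\<Sum>w\<in>?Sq. of_int (sign w) * f w)" for f :: "(nat \<Rightarrow> nat) \<Rightarrow> 'b"
    by (rule sum.mono_neutral_cong_right) (auto simp: finite_permutations)
  let ?K = "\<lambda>w. if p < q then M q q * M (w q) q - M (w q) q * M q q
           else M (w q) q * M q q - M q q * M (w q) q"
  have col: "(\<Sum>w\<in>?S. of_int (sign w) * ?P ((?a w)(p := M (w p) q + (if w p = q then \<kappa>q else 0))))
    = (\<Sum>w\<in>?Sq. of_int (sign w) * (?P ((?a w)(p := 1, q := ?K w)) + ?P ((?a w)(p := \<kappa>q))))"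
  proof -
    have "?P ((?a w)(p := M (w p) q + (if w p = q then \<kappa>q else 0)))
        = ?P ((?a w)(p := M (w p) q)) + (if w p = q then ?P ((?a w)(p := \<kappa>q)) else 0)" for w
      unfolding prod_list_fun_upd_add[OF L(1) pL]
      using prod_list_fun_upd_0[OF L(1) pL, of "?a w"] by simp
    moreover have "(\<Sum>w\<in>?S. of_int (sign w) * ?P ((?a w)(p := M (w p) q)))
      = (\<Sum>w\<in>?Sq. of_int (sign w) * ?P ((?a w)(p := 1, q := ?K w)))"
      by (rule cdet_adjacent_columns[OF p q adj]) (rule comm)
    ultimately show ?thesis
      by (simp only: distrib_left sum.distrib restrict)
  qed
  have row: "(\<Sum>w\<in>?S. of_int (sign w)
        * ?P ((?a w)(inv w q := M p (inv w q) + (if inv w q = p then \<kappa>p else 0))))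
    = (\<Sum>w\<in>?Sq. of_int (sign w) * ?P ((?a w)(p := \<kappa>p)))"
  proof -
    let ?F = "\<lambda>i j. if i = q then M p j else M i j"
    have "?P ((?a w)(inv w q := M p (inv w q) + (if inv w q = p then \<kappa>p else 0)))
        = ?P (\<lambda>j. ?F (w j) j) + (if w p = q then ?P ((?a w)(p := \<kappa>p)) else 0)"
      if w: "w permutes {1..n}" for w
    proof -
      have iw: "inv w q \<in> set ?L" "inv w q = p \<longleftrightarrow> w p = q"
        using w q permutes_inv[OF w] L(2) by (auto simp: permutes_in_image permutes_inverses
            permutes_inv_eq simp del: atLeastAtMost_iff)
      have "(?a w)(inv w q := M p (inv w q)) = (\<lambda>j. ?F (w j) j)"
        using permutes_inverses[OF w] by (auto simp: fun_eq_iff)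
      then show ?thesis
        unfolding prod_list_fun_upd_add[OF L(1) iw(1)]
        using prod_list_fun_upd_0[OF L(1) iw(1), of "?a w"] iw(2) by auto
    qed
    then have "(\<Sum>w\<in>?S. of_int (sign w)
        * ?P ((?a w)(inv w q := M p (inv w q) + (if inv w q = p then \<kappa>p else 0))))
      = (\<Sum>w\<in>?S. of_int (sign w) * (?P (\<lambda>j. ?F (w j) j)
          + (if w p = q then ?P ((?a w)(p := \<kappa>p)) else 0)))"
      by (intro sum.cong) auto
    also have "\<dots> = cdet n ?F + (\<Sum>w\<in>?Sq. of_int (sign w) * ?P ((?a w)(p := \<kappa>p)))"
      by (simp only: distrib_left sum.distrib restrict cdet_def)
    also have "cdet n ?F = 0"
      using p q pq by (intro cdet_equal_rows[of p n q]) auto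
    finally show ?thesis
      by (simp only: add_0_left)
  qed
  have "?P ((?a w)(p := 1, q := ?K w)) + ?P ((?a w)(p := \<kappa>q)) - ?P ((?a w)(p := \<kappa>p))
      = ?P ((?a w)(p := x, q := H (w q)))" if w: "w permutes {1..n}" and wp: "w p = q" for w
  proof -
    have wq: "w q \<in> {1..n}" "w q \<noteq> q"
      using w wp q pq by (auto simp: permutes_in_image simp del: atLeastAtMost_iff)
        (metis permutes_inverses(2))
    have scal: "?P ((?a w)(p := \<kappa>)) = ?P ((?a w)(p := 1, q := \<kappa> * M (w q) q))"
      if \<kappa>: "\<And>y. \<kappa> * y = y * \<kappa>" for \<kappa>
    proof -
      have "?P ((?a w)(p := \<kappa> * 1)) = \<kappa> * ?P ((?a w)(p := 1))"
        by (rule prod_list_fun_upd_central[OF L(1) pL \<kappa>])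
      also have "(?a w)(p := 1) = (?a w)(p := 1, q := M (w q) q)"
        using pq by (auto simp: fun_eq_iff)
      also have "\<kappa> * ?P \<dots> = ?P ((?a w)(p := 1, q := \<kappa> * M (w q) q))"
        by (rule prod_list_fun_upd_central[OF L(1) qL \<kappa>, symmetric])
      finally show ?thesis
        by (simp only: mult_1_right)
    qed
    have "?P ((?a w)(p := 1, q := ?K w)) + ?P ((?a w)(p := \<kappa>q)) - ?P ((?a w)(p := \<kappa>p))
      = ?P ((?a w)(p := 1, q := ?K w + (\<kappa>q * M (w q) q - \<kappa>p * M (w q) q)))"
      unfolding scal[OF \<kappa>q] scal[OF \<kappa>p] prod_list_fun_upd_add[OF L(1) qL]
        prod_list_fun_upd_diff[OF L(1) qL] by (simp only: add_diff_eq)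
    also have "?K w + (\<kappa>q * M (w q) q - \<kappa>p * M (w q) q) = x * H (w q)"
      using H[OF wq] by (simp only: left_diff_distrib)
    \<comment> \<open>The central \<open>x\<close> is moved from column \<open>q\<close> to the
      vacant column \<open>p\<close>; in the application each of the two columns then carries one
      \<open>x\<close>, as the degree count requires.\<close>
    also have "?P ((?a w)(p := 1, q := x * H (w q))) = x * ?P ((?a w)(p := 1, q := H (w q)))"
      by (rule prod_list_fun_upd_central[OF L(1) qL x])
    also have "\<dots> = ?P ((?a w)(q := H (w q), p := x * 1))"
      unfolding prod_list_fun_upd_central[OF L(1) pL x] using pq by (simp only: fun_upd_twist)
    also have "(?a w)(q := H (w q), p := x * 1) = (?a w)(p := x, q := H (w q))"
      using pq by (auto simp: fun_eq_iff)
    finally show ?thesis .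
  qed
  then have "(\<Sum>w\<in>?Sq. of_int (sign w) * (?P ((?a w)(p := 1, q := ?K w)) + ?P ((?a w)(p := \<kappa>q))))
      - (\<Sum>w\<in>?Sq. of_int (sign w) * ?P ((?a w)(p := \<kappa>p)))
    = (\<Sum>w\<in>?Sq. of_int (sign w) * ?P ((?a w)(p := x, q := H (w q))))"
    unfolding sum_subtractf[symmetric] right_diff_distrib[symmetric]
    by (intro sum.cong refl) (simp only: mem_Collect_eq)
  moreover have "t * (cdet n M * C - C * cdet n M)
    = (\<Sum>w\<in>?S. of_int (sign w) * ?P ((?a w)(p := M (w p) q + (if w p = q then \<kappa>q else 0))))
    - (\<Sum>w\<in>?S. of_int (sign w)
        * ?P ((?a w)(inv w q := M p (inv w q) + (if inv w q = p then \<kappa>p else 0))))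
    - (\<Sum>w\<in>?S. of_int (sign w) * (\<Sum>k\<in>{1..n}. ?P ((?a w)(k := R (w k) k))))"
    by (rule cdet_commutator[where A = "\<lambda>i. M i q + (if i = q then \<kappa>q else 0)"
        and B = "\<lambda>j. M p j + (if j = p then \<kappa>p else 0)", OF p q t]) (rule M)
  ultimately show ?thesis
    unfolding col row by simp
qed

section \<open>The degree bound\<close>

text \<open>The outer index is the exponent of \<open>x\<close>, the inner one that of
  \<open>t\<close>. In the iterated series \<open>fps_X\<close> is \<open>x\<close> and
  \<open>fps_const fps_X\<close> is \<open>t\<close>.\<close>

abbreviation coeff2 :: "'a::zero fps fps \<Rightarrow> nat \<Rightarrow> nat \<Rightarrow> 'a" where
  "coeff2 f d m \<equiv> fps_nth (fps_nth f d) m"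

lemma fps_const_X_left_commute: "fps_const c * (fps_X * g) = fps_X * (fps_const c * g)"
  for g :: "'a::ring_1 fps"
  by (metis fps_mult_fps_X_commute mult.assoc)

lemma coeff2_sum: "coeff2 (sum f A) d m = (\<Sum>x\<in>A. coeff2 (f x) d m)"
  by (simp add: fps_sum_nth)

lemma coeff2_of_int_mult: "coeff2 (of_int k * f) d m = of_int k * coeff2 f d m" for f :: "'a::ring_1 fps fps"
  by (simp add: fps_of_int[symmetric] del: fps_of_int)

lemma coeff2_mult_nonzeroE:
  fixes f g :: "'a::ring_1 fps fps"
  assumes "coeff2 (f * g) d m \<noteq> 0"
  obtains d1 m1 where "d1 \<le> d" "m1 \<le> m" "coeff2 f d1 m1 \<noteq> 0" "coeff2 g (d - d1) (m - m1) \<noteq> 0"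
proof -
  have "coeff2 (f * g) d m = (\<Sum>i=0..d. \<Sum>j=0..m. coeff2 f i j * coeff2 g (d - i) (m - j))"
    by (simp add: fps_mult_nth fps_sum_nth)
  then have "(\<Sum>i=0..d. \<Sum>j=0..m. coeff2 f i j * coeff2 g (d - i) (m - j)) \<noteq> 0"
    using assms by simp
  then obtain i where i: "i \<in> {0..d}" "(\<Sum>j=0..m. coeff2 f i j * coeff2 g (d - i) (m - j)) \<noteq> 0"
    by (rule sum.not_neutral_contains_not_neutral)
  from i(2) obtain j where "j \<in> {0..m}" "coeff2 f i j * coeff2 g (d - i) (m - j) \<noteq> 0"
    by (rule sum.not_neutral_contains_not_neutral)
  then show ?thesis
    using i(1) by (intro that[of i j]) auto
qed

text \<open>The columns in \<open>L\<close> are those whose entry has no constant term.\<close>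

lemma coeff2_prod_list_nonzeroE:
  fixes a :: "nat \<Rightarrow> 'a::ring_1 fps fps"
  assumes "distinct l"
    and "\<And>j d m. j \<in> set l \<Longrightarrow> coeff2 (a j) d m \<noteq> 0 \<Longrightarrow>
      (d = 0 \<and> m = 0 \<and> j \<notin> L) \<or> (d = 1 \<and> m + 1 \<le> b j)"
    and "coeff2 (prod_list (map a l)) d m \<noteq> 0"
  obtains I where "I \<subseteq> set l" "set l \<inter> L \<subseteq> I" "card I = d" "m + d \<le> sum b I"
proof -
  \<comment> \<open>\<open>I\<close> consists of the columns contributing a factor \<open>x\<close>;
    each of them brings at most t^(b j - 1).\<close>
  have "\<exists>I. I \<subseteq> set l \<and> set l \<inter> L \<subseteq> I \<and> card I = d \<and> m + d \<le> sum b I"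
    using assms
  proof (induction l arbitrary: d m)
    case Nil
    then have "d = 0" "m = 0"
      by (auto split: if_splits simp: fps_one_nth)
    then show ?case
      by (intro exI[of _ "{}"]) simp
  next
    case (Cons x l)
    have "coeff2 (a x * prod_list (map a l)) d m \<noteq> 0"
      using Cons.prems(3) by simp
    then obtain d1 m1 where dm: "d1 \<le> d" "m1 \<le> m" "coeff2 (a x) d1 m1 \<noteq> 0"
      "coeff2 (prod_list (map a l)) (d - d1) (m - m1) \<noteq> 0"
      by (rule coeff2_mult_nonzeroE)
    have "\<exists>I. I \<subseteq> set l \<and> set l \<inter> L \<subseteq> I \<and> card I = d - d1 \<and> m - m1 + (d - d1) \<le> sum b I"
      using Cons.prems dm(4) by (intro Cons.IH) auto
    then obtain I where I: "I \<subseteq> set l" "set l \<inter> L \<subseteq> I" "card I = d - d1" "m - m1 + (d - d1) \<le> sum b I"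
      by blast
    have fin: "finite I" and x: "x \<notin> I"
      using I(1) Cons.prems(1) by (auto intro: finite_subset)
    consider "d1 = 0" "m1 = 0" "x \<notin> L" | "d1 = 1" "m1 + 1 \<le> b x"
      using Cons.prems(2)[OF _ dm(3)] by auto
    then show ?case
    proof cases
      case 1
      then show ?thesis
        using I by (intro exI[of _ I]) auto
    next
      case 2
      then show ?thesis
        using I fin x dm by (intro exI[of _ "insert x I"]) auto
    qed
  qed
  then show ?thesis
    using that by blast
qed

text \<open>Only the images of the basis in some ring and their brackets are needed, so the argument
  can run where the relations of U(g_e) are equalities. A bracket may leave the index set
  \<open>gbasis\<close>; its value is then 0.\<close>

locale centralizer_rep =
  fixes n :: nat and lam :: "nat \<Rightarrow> nat" and e :: "nat \<Rightarrow> nat \<Rightarrow> nat \<Rightarrow> 'a::ring_1"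
  assumes nondec: "\<And>i j. 1 \<le> i \<Longrightarrow> i \<le> j \<Longrightarrow> j \<le> n \<Longrightarrow> lam i \<le> lam j"
    and e_outside: "\<And>i j r. (i, j, r) \<notin> gbasis n lam \<Longrightarrow> e i j r = 0"
    and e_comm: "\<And>i j r k l s. (i, j, r) \<in> gbasis n lam \<Longrightarrow> (k, l, s) \<in> gbasis n lam \<Longrightarrow>
      e i j r * e k l s - e k l s * e i j r
        = (if j = k then e i l (r + s) else 0) - (if i = l then e k j (r + s) else 0)"
begin

definition eser :: "nat \<Rightarrow> nat \<Rightarrow> 'a fps" where
  "eser i j = Abs_fps (e i j)"

definition cap :: "nat \<Rightarrow> nat" where
  "cap i = (i - 1) * lam i"

definition emx :: "nat \<Rightarrow> nat \<Rightarrow> 'a fps fps" where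
  "emx i j = (if i = j then 1 else 0)
     + fps_X * fps_const (eser i j - (if i = j then of_nat (cap i) else 0))"

lemma eser_nth [simp]: "fps_nth (eser i j) r = e i j r"
  by (simp add: eser_def)

lemma emx_offdiag: "i \<noteq> j \<Longrightarrow> emx i j = fps_X * fps_const (eser i j)"
  by (simp add: emx_def)

text \<open>The element e_{i,q;k} arises only from e_{i,p;k-s}, hence only for k >= s + s_{i,p};
  this is the cutoff. Nothing is lost at the top: k - s >= lam p forces k >= lam q, since s >=
  s_{p,q}.\<close>

lemma eser_shift_commutator:
  assumes "(p, q, s) \<in> gbasis n lam" "i \<in> {1..n}" "j \<in> {1..n}"
  shows "fps_X ^ s * (eser i j * fps_const (e p q s) - fps_const (e p q s) * eser i j)
    = (if j = p then eser i q - fps_cutoff (s + sh lam i p) (eser i q) else 0)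
      - (if i = q then eser p j - fps_cutoff (s + sh lam q j) (eser p j) else 0)"
proof (rule fps_ext)
  fix k
  let ?r = "k - s"
  show "fps_nth (fps_X ^ s * (eser i j * fps_const (e p q s) - fps_const (e p q s) * eser i j)) k
    = fps_nth ((if j = p then eser i q - fps_cutoff (s + sh lam i p) (eser i q) else 0)
      - (if i = q then eser p j - fps_cutoff (s + sh lam q j) (eser p j) else 0)) k"
  proof (cases "k < s")
    case True
    then show ?thesis
      by (simp add: fps_X_power_mult_nth)
  next
    case False
    show ?thesis
    proof (cases "(i, j, ?r) \<in> gbasis n lam")
      case True
      with assms False show ?thesis
        by (auto simp: fps_X_power_mult_nth e_comm gbasis_def)
    next
      case out: False
      have "e i q k = 0" if "j = p" "\<not> k < s + sh lam i p"
      proof -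
        have "lam p \<le> ?r"
          using out assms that False by (auto simp: gbasis_def)
        then have "lam q \<le> k"
          using assms(1) False by (auto simp: gbasis_def sh_def)
        then show ?thesis
          by (intro e_outside) (auto simp: gbasis_def)
      qed
      moreover have "e p j k = 0" if "i = q" "\<not> k < s + sh lam q j"
      proof -
        have "lam j \<le> ?r"
          using out assms that False by (auto simp: gbasis_def)
        then show ?thesis
          by (intro e_outside) (auto simp: gbasis_def)
      qed
      ultimately show ?thesis
        using False e_outside[OF out] by (auto simp: fps_X_power_mult_nth)
    qed
  qed
qed

lemma eser_commute:
  assumes "i \<noteq> q" "i' \<noteq> q"
  shows "eser i q * eser i' q = eser i' q * eser i q"
proof -
  have comm: "e i q r * e i' q s = e i' q s * e i q r" for r s
  proof (cases "(i, q, r) \<in> gbasis n lam \<and> (i', q, s) \<in> gbasis n lam")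
    case True
    then show ?thesis
      using e_comm[of i q r i' q s] assms by auto
  next
    case False
    then show ?thesis
      using e_outside by auto
  qed
  have "(\<Sum>k=0..m. e i q k * e i' q (m - k)) = (\<Sum>k=0..m. e i' q k * e i q (m - k))" for m
    by (rule sum.reindex_bij_witness[of _ "\<lambda>k. m - k" "\<lambda>k. m - k"]) (auto simp: comm)
  then show ?thesis
    by (simp add: fps_eq_iff fps_mult_nth)
qed

text \<open>Every splitting of m into degrees k of e_{q,q} and l of e_{i,q} contributes the same
  -e_{i,q;m}, and the condition l >= s_{i,q} leaves m + 1 - s_{i,q} splittings.\<close>

lemma eser_column_commutator:
  assumes "q \<in> {1..n}" "i \<in> {1..n}" "i \<noteq> q"
  shows "eser q q * eser i q - eser i q * eser q q
    = - Abs_fps (\<lambda>m. of_nat (m + 1 - sh lam i q) * e i q m)"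
proof (rule fps_ext)
  fix m
  have "fps_nth (eser q q * eser i q - eser i q * eser q q) m
    = (\<Sum>k=0..m. e q q k * e i q (m - k)) - (\<Sum>k=0..m. e i q k * e q q (m - k))"
    by (simp add: fps_mult_nth)
  also have "(\<Sum>k=0..m. e i q k * e q q (m - k)) = (\<Sum>k=0..m. e i q (m - k) * e q q k)"
    by (rule sum.reindex_bij_witness[of _ "\<lambda>k. m - k" "\<lambda>k. m - k"]) auto
  also have "(\<Sum>k=0..m. e q q k * e i q (m - k)) - (\<Sum>k=0..m. e i q (m - k) * e q q k)
    = (\<Sum>k=0..m. if k < m + 1 - sh lam i q then - e i q m else 0)"
    unfolding sum_subtractf[symmetric]
  proof (rule sum.cong[OF refl])
    fix k assume k: "k \<in> {0..m}"
    show "e q q k * e i q (m - k) - e i q (m - k) * e q q k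
      = (if k < m + 1 - sh lam i q then - e i q m else 0)"
    proof (cases "(q, q, k) \<in> gbasis n lam \<and> (i, q, m - k) \<in> gbasis n lam")
      case True
      then have "k < m + 1 - sh lam i q"
        using k by (auto simp: gbasis_def)
      then show ?thesis
        using True e_comm[of q q k i q "m - k"] assms k by auto
    next
      case False
      have "e i q m = 0" if "k < m + 1 - sh lam i q"
      proof (intro e_outside notI)
        assume "(i, q, m) \<in> gbasis n lam"
        then show False
          using False that k assms by (auto simp: gbasis_def sh_def)
      qed
      moreover have "e q q k = 0 \<or> e i q (m - k) = 0"
        using False e_outside by blast
      ultimately show ?thesis
        by auto
    qed
  qed
  also have "\<dots> = (\<Sum>k\<in>{k\<in>{0..m}. k < m + 1 - sh lam i q}. - e i q m)"
    by (rule sum.inter_filter[symmetric]) simp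
  also have "{k\<in>{0..m}. k < m + 1 - sh lam i q} = {..<m + 1 - sh lam i q}"
    by auto
  finally show "fps_nth (eser q q * eser i q - eser i q * eser q q) m
    = fps_nth (- Abs_fps (\<lambda>m. of_nat (m + 1 - sh lam i q) * e i q m)) m"
    by simp
qed

lemma coeff2_emx_nonzero:
  assumes "coeff2 (emx i j) d m \<noteq> 0" "j \<in> {1..n}"
  shows "(d = 0 \<and> m = 0 \<and> i = j) \<or> (d = 1 \<and> m + 1 \<le> lam j)"
proof -
  have e: "e i j m \<noteq> 0 \<Longrightarrow> m + 1 \<le> lam j"
  proof -
    assume "e i j m \<noteq> 0"
    then have "(i, j, m) \<in> gbasis n lam"
      using e_outside by blast
    then show "m + 1 \<le> lam j"
      by (simp add: gbasis_def)
  qed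
  \<comment> \<open>\<open>cap i\<close> is a multiple of \<open>lam i\<close>, so a nonzero shift,
    which sits at m = 0, still obeys m + 1 <= lam i.\<close>
  have c: "fps_nth (of_nat (cap i)) m \<noteq> (0::'a) \<Longrightarrow> m = 0 \<and> 1 \<le> lam i"
    by (cases "lam i") (auto simp: cap_def fps_of_nat[symmetric] split: if_splits simp del: fps_of_nat)
  have *: "coeff2 (emx i j) d m = (if i = j \<and> d = 0 \<and> m = 0 then 1 else 0)
      + (if d = 1 then e i j m - (if i = j then fps_nth (of_nat (cap i)) m else 0) else 0)"
    unfolding emx_def by (cases "d = 1") (auto simp: fps_one_nth)
  show ?thesis
  proof (cases "d = 1")
    case True
    then have "e i j m \<noteq> 0 \<or> (i = j \<and> fps_nth (of_nat (cap i)) m \<noteq> (0::'a))"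
      using assms(1) * by (auto split: if_splits)
    then show ?thesis
    proof
      assume "e i j m \<noteq> 0"
      then show ?thesis
        using True e by simp
    next
      assume "i = j \<and> fps_nth (of_nat (cap i)) m \<noteq> (0::'a)"
      moreover from this have "m = 0 \<and> 1 \<le> lam i"
        using c by blast
      ultimately show ?thesis
        using True by simp
    qed
  next
    case False
    then have "i = j \<and> d = 0 \<and> m = 0"
      using assms(1) unfolding * by (simp split: if_splits)
    then show ?thesis
      by simp
  qed
qed

text \<open>The part of \<open>[emx i j, e p q s]\<close> (shifted by \<open>s\<close>) lost by truncating at degree \<open>sh\<close>.\<close>

definition rest :: "nat \<Rightarrow> nat \<Rightarrow> nat \<Rightarrow> nat \<Rightarrow> nat \<Rightarrow> 'a fps fps" where
  "rest p q s i j = fps_X * fps_const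
     ((if j = p then fps_cutoff (s + sh lam i p) (eser i q) else 0)
      - (if i = q then fps_cutoff (s + sh lam q j) (eser p j) else 0))"

lemma coeff2_rest_nonzero:
  assumes "coeff2 (rest p q s i j) d m \<noteq> 0"
  shows "d = 1 \<and> m + 1 \<le> s + sh lam i j"
  using assms unfolding rest_def by (cases "d = 1") (auto split: if_splits)

text \<open>Besides the series, the diagonal of \<open>emx\<close> holds 1 and the scalar shift.
  Expressing the series through \<open>emx\<close> costs x * cap - 1 there, which is the
  \<open>\<kappa>\<close> of the determinant lemmas.\<close>

lemma emx_shift_commutator:
  assumes "(p, q, s) \<in> gbasis n lam" "i \<in> {1..n}" "j \<in> {1..n}"
  shows "fps_const (fps_X ^ s) * (emx i j * fps_const (fps_const (e p q s))
      - fps_const (fps_const (e p q s)) * emx i j)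
    = (if j = p then emx i q + (if i = q then fps_X * fps_const (of_nat (cap q)) - 1 else 0) else 0)
      - (if i = q then emx p j + (if j = p then fps_X * fps_const (of_nat (cap p)) - 1 else 0) else 0)
      - rest p q s i j"
proof -
  let ?C = "fps_const (e p q s)"
  have [simp]: "of_nat k * (y :: 'a fps) = y * of_nat k" for k y
    by (rule mult_of_nat_commute)
  have "emx i j * fps_const ?C - fps_const ?C * emx i j
    = fps_X * fps_const (eser i j * ?C - ?C * eser i j)"
  proof -
    have "(fps_X * fps_const f) * fps_const ?C - fps_const ?C * (fps_X * fps_const f)
      = fps_X * fps_const (f * ?C - ?C * f)" for f
      by (simp only: mult.assoc fps_const_X_left_commute right_diff_distrib[symmetric] fps_const_mult
          fps_const_sub)
    from this[of "eser i j - (if i = j then of_nat (cap i) else 0)"] show ?thesis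
      unfolding emx_def by (cases "i = j") (simp_all add: distrib_left distrib_right algebra_simps)
  qed
  then have "fps_const (fps_X ^ s) * (emx i j * fps_const ?C - fps_const ?C * emx i j)
    = fps_X * fps_const (fps_X ^ s * (eser i j * ?C - ?C * eser i j))"
    by (simp only: fps_const_X_left_commute fps_const_mult)
  also have "\<dots> = (if j = p then fps_X * fps_const (eser i q) else 0)
      - (if i = q then fps_X * fps_const (eser p j) else 0) - rest p q s i j"
    unfolding eser_shift_commutator[OF assms] rest_def
    by (simp add: fps_const_sub[symmetric] right_diff_distrib del: fps_const_sub)
  also have "fps_X * fps_const (eser i q)
      = emx i q + (if i = q then fps_X * fps_const (of_nat (cap q)) - 1 else 0)"
    unfolding emx_def by (simp add: fps_const_sub[symmetric] right_diff_distrib del: fps_const_sub)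
  also have "fps_X * fps_const (eser p j)
      = emx p j + (if j = p then fps_X * fps_const (of_nat (cap p)) - 1 else 0)"
    unfolding emx_def by (simp add: fps_const_sub[symmetric] right_diff_distrib del: fps_const_sub)
  finally show ?thesis .
qed

text \<open>A surviving term uses \<open>d\<close> columns J, among them \<open>k\<close>, whose
  entry has degree below s + s_{w k,k}. As J without \<open>k\<close> is too small, s_{w k,k} > 0,
  that is lam (w k) < lam k. Then \<open>w\<close> moves \<open>w k\<close>, so \<open>w k\<close>
  lies in J, and the bound becomes the sum over J without \<open>w k\<close>, which is again too
  small.\<close>

lemma coeff2_rest_term:
  assumes I: "\<And>I. I \<subseteq> {1..n} \<Longrightarrow> card I = d - 1 \<Longrightarrow> sum lam I < m + d"
    and w: "w permutes {1..n}" and k: "k \<in> {1..n}"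
  shows "coeff2 (prod_list (map ((\<lambda>j. emx (w j) j)(k := rest p q s (w k) k)) [1..<n + 1])) d (m + s) = 0"
proof (rule ccontr)
  let ?a = "(\<lambda>j. emx (w j) j)(k := rest p q s (w k) k)"
  let ?L = "insert k {j. w j \<noteq> j}"
  let ?b = "lam(k := s + sh lam (w k) k)"
  assume nz: "coeff2 (prod_list (map ?a [1..<n + 1])) d (m + s) \<noteq> 0"
  have wk: "w k \<in> {1..n}"
    using w k by (simp add: permutes_in_image del: atLeastAtMost_iff)
  have entry: "(d' = 0 \<and> m' = 0 \<and> j \<notin> ?L) \<or> (d' = 1 \<and> m' + 1 \<le> ?b j)"
    if "j \<in> set [1..<n + 1]" "coeff2 (?a j) d' m' \<noteq> 0" for j d' m'
    using that coeff2_rest_nonzero[of p q s "w k" k d' m'] coeff2_emx_nonzero[of "w j" j d' m']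
    by (cases "j = k") auto
  obtain J where J: "J \<subseteq> set [1..<n + 1]" "set [1..<n + 1] \<inter> ?L \<subseteq> J" "card J = d"
      "m + s + d \<le> sum ?b J"
    by (rule coeff2_prod_list_nonzeroE[OF _ entry nz]) simp
  have J': "J \<subseteq> {1..n}" and kJ: "k \<in> J" and fin: "finite J"
    using J(1,2) k finite_subset[OF J(1)] by auto
  have "sum ?b J = s + sh lam (w k) k + sum lam (J - {k})"
    using sum.remove[OF fin kJ, of ?b] by simp
  then have bound: "m + d \<le> sh lam (w k) k + sum lam (J - {k})"
    using J(4) by simp
  have "sum lam (J - {k}) < m + d"
    using J' kJ fin J(3) by (intro I) auto
  then have less: "lam (w k) < lam k"
    using bound by (auto simp: sh_def min_def split: if_splits)
  then have ne: "w k \<noteq> k"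
    by auto
  then have "w (w k) \<noteq> w k"
    using w by (metis permutes_inverses(2))
  then have wkJ: "w k \<in> J"
    using J(2) wk by auto
  have "sum lam (J - {w k}) < m + d"
    using J' wkJ fin J(3) by (intro I) auto
  moreover have "sum lam J = lam k + sum lam (J - {k})" "sum lam J = lam (w k) + sum lam (J - {w k})"
    using sum.remove[OF fin kJ, of lam] sum.remove[OF fin wkJ, of lam] by auto
  ultimately show False
    using bound less by (simp add: sh_def)
qed

text \<open>What is left after moving an adjacent pair of columns past each other; its coefficient vanishes
  at the top degree exactly because of the shifts \<open>cap\<close> on the diagonal.\<close>

definition corr :: "nat \<Rightarrow> nat \<Rightarrow> nat \<Rightarrow> nat \<Rightarrow> int" where
  "corr p q i m = int (cap q) - int (cap p)
     - (if p < q then 1 else - 1) * int (m + 1 - sh lam i q)"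

definition corr_col :: "nat \<Rightarrow> nat \<Rightarrow> nat \<Rightarrow> 'a fps fps" where
  "corr_col p q i = fps_X * fps_const (Abs_fps (\<lambda>m. of_int (corr p q i m) * e i q m))"

text \<open>In adjacent rows of equal length the shifts differ by lam q, and for lam i >= lam q the
  count m + 1 - s_{i,q} equals lam q at m = lam q - 1.\<close>

lemma corr_top:
  assumes "1 \<le> p" "1 \<le> q" "p = Suc q \<or> q = Suc p" "lam p = lam q" "lam q \<le> lam i" "lam q > 0"
  shows "corr p q i (lam q - 1) = 0"
proof (cases "p < q")
  case True
  then obtain k where "p = Suc k" "q = Suc (Suc k)"
    using assms(1-3) by (cases p) auto
  then show ?thesis
    using assms(4-6) by (simp add: corr_def cap_def sh_def)
next
  case False
  then obtain k where "q = Suc k" "p = Suc (Suc k)"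
    using assms(1-3) by (cases q) auto
  then show ?thesis
    using assms(4-6) by (simp add: corr_def cap_def sh_def)
qed

text \<open>Scalars drop out of the commutator and the constants -1 cancel in the difference. Both
  remaining contributions are divisible by x^2, one factor of which is inside
  \<open>corr_col\<close>.\<close>

lemma emx_column_commutator:
  assumes "q \<in> {1..n}" "i \<in> {1..n}" "i \<noteq> q"
  shows "(if p < q then emx q q * emx i q - emx i q * emx q q else emx i q * emx q q - emx q q * emx i q)
    + ((fps_X * fps_const (of_nat (cap q)) - 1) - (fps_X * fps_const (of_nat (cap p)) - 1)) * emx i q
    = fps_X * corr_col p q i"
proof -
  have 1: "emx q q * emx i q - emx i q * emx q q
    = fps_X * (fps_X * fps_const (- Abs_fps (\<lambda>m. of_nat (m + 1 - sh lam i q) * e i q m)))"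
  proof -
    let ?f = "eser q q - of_nat (cap q)" and ?g = "eser i q"
    have "?f * ?g - ?g * ?f = eser q q * ?g - ?g * eser q q"
      using mult_of_nat_commute[of "cap q" ?g] by (simp add: algebra_simps)
    moreover have "(1 + fps_X * fps_const ?f) * (fps_X * fps_const ?g)
        - (fps_X * fps_const ?g) * (1 + fps_X * fps_const ?f)
      = fps_X * (fps_X * fps_const (?f * ?g - ?g * ?f))"
    proof -
      have "(fps_X * fps_const f) * (fps_X * fps_const g) = fps_X * (fps_X * fps_const (f * g))"
        for f g :: "'a fps"
        by (simp only: mult.assoc fps_const_X_left_commute fps_const_mult)
      then show ?thesis
        by (simp add: distrib_left distrib_right right_diff_distrib[symmetric])
    qed
    ultimately show ?thesis
      using eser_column_commutator[OF assms] assms(3) by (simp add: emx_def)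
  qed
  have 2: "((fps_X * fps_const (of_nat (cap q)) - 1) - (fps_X * fps_const (of_nat (cap p)) - 1)) * emx i q
    = fps_X * (fps_X * fps_const ((of_nat (cap q) - of_nat (cap p)) * eser i q))"
  proof -
    have "(fps_X * fps_const f) * (fps_X * fps_const g) = fps_X * (fps_X * fps_const (f * g))"
      for f g :: "'a fps"
      by (simp only: mult.assoc fps_const_X_left_commute fps_const_mult)
    then show ?thesis
      using assms(3) by (simp add: emx_offdiag left_diff_distrib right_diff_distrib
          fps_const_sub[symmetric] del: fps_const_sub)
  qed
  have 3: "of_nat k * f = Abs_fps (\<lambda>m. of_nat k * fps_nth f m)" for k and f :: "'a fps"
    by (simp add: fps_eq_iff fps_of_nat[symmetric] del: fps_of_nat)
  have 4: "(if p < q then - Abs_fps (\<lambda>m. of_nat (m + 1 - sh lam i q) * e i q m)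
        else Abs_fps (\<lambda>m. of_nat (m + 1 - sh lam i q) * e i q m))
      + (of_nat (cap q) - of_nat (cap p)) * eser i q
    = Abs_fps (\<lambda>m. of_int (corr p q i m) * e i q m)"
    by (simp add: left_diff_distrib 3 fps_eq_iff corr_def algebra_simps)
  have 5: "emx i q * emx q q - emx q q * emx i q
    = fps_X * (fps_X * fps_const (Abs_fps (\<lambda>m. of_nat (m + 1 - sh lam i q) * e i q m)))"
    using arg_cong[OF 1, of uminus] by (simp add: fps_const_neg[symmetric] del: fps_const_neg)
  show ?thesis
    unfolding 1 2 5 corr_col_def 4[symmetric]
    by (simp add: distrib_left[symmetric] fps_const_add[symmetric] del: fps_const_add)
qed

text \<open>The columns J contributing an \<open>x\<close> include p, q and \<open>w q\<close>. The
  bare \<open>x\<close> in column \<open>p\<close> costs lam p - 1 in degree; comparing with J minus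
  \<open>p\<close>, \<open>q\<close> or \<open>w q\<close> leaves only the case s = 0, lam p = lam q
  <= lam (w q) in top degree, where \<open>corr\<close> vanishes.\<close>

lemma coeff2_corr_term:
  assumes I: "\<And>I. I \<subseteq> {1..n} \<Longrightarrow> card I = d - 1 \<Longrightarrow> sum lam I < m + d"
    and w: "w permutes {1..n}" "w p = q" and p: "p \<in> {1..n}" and q: "q \<in> {1..n}"
    and adj: "p = Suc q \<or> q = Suc p" and s: "s = sh lam p q"
    and lamq: "lam q > 0"
  shows "coeff2 (prod_list (map ((\<lambda>j. emx (w j) j)(p := fps_X, q := corr_col p q (w q))) [1..<n + 1])) d (m + s) = 0"
proof (rule ccontr)
  let ?a = "(\<lambda>j. emx (w j) j)(p := fps_X, q := corr_col p q (w q))"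
  let ?L = "{p, q} \<union> {j. w j \<noteq> j}"
  let ?top = "s = 0 \<and> lam p = lam q \<and> lam q \<le> lam (w q)"
  \<comment> \<open>The bound for column \<open>q\<close>, lowered by one exactly where
    \<open>corr_top\<close> kills the leading coefficient.\<close>
  define bq where "bq = (if ?top then lam q - 1 else lam q)"
  let ?b = "lam(p := 1, q := bq)"
  assume nz: "coeff2 (prod_list (map ?a [1..<n + 1])) d (m + s) \<noteq> 0"
  have pq: "p \<noteq> q"
    using adj by auto
  have wq: "w q \<in> {1..n}" "w q \<noteq> q" "w (w q) \<noteq> w q"
    using w pq q by (auto simp: permutes_in_image simp del: atLeastAtMost_iff)
      (metis permutes_inverses(2))+
  have corr: "d' = 1 \<and> m' + 1 \<le> bq" if "coeff2 (corr_col p q (w q)) d' m' \<noteq> 0" for d' m'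
  proof -
    have d': "d' = 1" and nz': "of_int (corr p q (w q) m') * e (w q) q m' \<noteq> 0"
      using that unfolding corr_col_def by (cases "d' = 1"; auto split: if_splits)+
    then have "e (w q) q m' \<noteq> 0"
      by auto
    then have "(w q, q, m') \<in> gbasis n lam"
      using e_outside by blast
    then have m': "m' < lam q"
      by (simp add: gbasis_def)
    moreover have "m' \<noteq> lam q - 1" if ?top
      using corr_top[of p q "w q"] that p q adj m' nz' by auto
    ultimately show ?thesis
      using d' by (auto simp: bq_def)
  qed
  have entry: "(d' = 0 \<and> m' = 0 \<and> j \<notin> ?L) \<or> (d' = 1 \<and> m' + 1 \<le> ?b j)"
    if "j \<in> set [1..<n + 1]" "coeff2 (?a j) d' m' \<noteq> 0" for j d' m'
    using that corr[of d' m'] coeff2_emx_nonzero[of "w j" j d' m'] pq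
    by (cases "j = q"; cases "j = p"; cases "d' = 1") (auto split: if_splits)
  obtain J where J: "J \<subseteq> set [1..<n + 1]" "set [1..<n + 1] \<inter> ?L \<subseteq> J" "card J = d"
      "m + s + d \<le> sum ?b J"
    by (rule coeff2_prod_list_nonzeroE[OF _ entry nz]) simp
  have J': "J \<subseteq> {1..n}" and pJ: "p \<in> J" and qJ: "q \<in> J" and wqJ: "w q \<in> J" and fin: "finite J"
    using J(1,2) p q wq finite_subset[OF J(1)] by auto
  have Ik: "sum lam J < lam k + m + d" if "k \<in> J" for k
  proof -
    have "sum lam (J - {k}) < m + d"
      using J' that fin J(3) by (intro I) auto
    then show ?thesis
      using sum.remove[OF fin that, of lam] by simp
  qed
  have rm: "sum f J = f p + f q + sum f (J - {p} - {q})" for f :: "nat \<Rightarrow> nat"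
    using sum.remove[OF fin pJ, of f] sum.remove[of "J - {p}" q f] fin qJ pq by simp
  have "sum ?b (J - {p} - {q}) = sum lam (J - {p} - {q})"
    by (rule sum.cong) auto
  then have "sum ?b J = 1 + bq + sum lam (J - {p} - {q})"
    by (subst rm) (use pq in simp)
  then have bound: "m + s + d + lam p + lam q \<le> 1 + bq + sum lam J"
    using J(4) rm[of lam] by simp
  have "\<not> ?top"
    using lamq bound Ik[OF pJ] by (auto simp: bq_def)
  then have "bq = lam q"
    by (auto simp: bq_def)
  then have "s = 0" "\<not> (lam p = lam q \<and> lam q \<le> lam (w q))"
    using bound Ik[OF pJ] \<open>\<not> ?top\<close> by auto
  then show False
    using s bound Ik[OF qJ] Ik[OF wqJ] \<open>bq = lam q\<close> by (auto simp: sh_def min_def split: if_splits)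
qed

text \<open>With r = m + d, the assumption \<open>I\<close> says that d - 1 parts never reach r,
  which is what minimality of d = d_r provides.\<close>

lemma coeff2_cdet_commutes:
  assumes g: "(p, q, s) \<in> gbasis n lam" and pq: "p = q \<or> (p = Suc q \<or> q = Suc p) \<and> s = sh lam p q"
    and I: "\<And>I. I \<subseteq> {1..n} \<Longrightarrow> card I = d - 1 \<Longrightarrow> sum lam I < m + d"
  shows "coeff2 (cdet n emx) d m * e p q s = e p q s * coeff2 (cdet n emx) d m"
proof -
  let ?T = "fps_const (fps_X ^ s) :: 'a fps fps" and ?C = "fps_const (fps_const (e p q s))"
  let ?Z = "cdet n emx"
  let ?R = "\<Sum>w\<in>{w. w permutes {1..n}}. of_int (sign w) * (\<Sum>k\<in>{1..n}.
        prod_list (map ((\<lambda>j. emx (w j) j)(k := rest p q s (w k) k)) [1..<n + 1]))"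
  have p: "p \<in> {1..n}" and q: "q \<in> {1..n}"
    using g by (auto simp: gbasis_def)
  have X: "fps_X * y = y * fps_X" for y :: "'a fps fps"
    by (rule fps_mult_fps_X_commute)
  have const: "fps_const c * y = y * fps_const c" if "\<And>z. c * z = z * c" for c :: "'a fps" and y
    by (simp add: fps_eq_iff that)
  have T: "?T * y = y * ?T" for y
    by (rule const) (rule fps_mult_fps_X_power_commute)
  have \<kappa>: "(fps_X * fps_const (of_nat k) - 1) * y = y * (fps_X * fps_const (of_nat k) - 1)"
    for k and y :: "'a fps fps"
  proof -
    have "(fps_X * fps_const (of_nat k)) * y = y * (fps_X * fps_const (of_nat k))"
      by (metis X const mult.assoc mult_of_nat_commute)
    then show ?thesis
      by (simp add: left_diff_distrib right_diff_distrib)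
  qed
  have R: "coeff2 ?R d (m + s) = 0"
    unfolding coeff2_sum coeff2_of_int_mult
    by (intro sum.neutral ballI) (simp only: coeff2_rest_term[OF I] mem_Collect_eq sum.neutral_const mult_zero_right cong: sum.cong)
  have "coeff2 (?T * (?Z * ?C - ?C * ?Z)) d (m + s) = 0"
  proof (cases "p = q")
    case True
    have "?T * (?Z * ?C - ?C * ?Z) = - ?R"
      by (rule cdet_commutator_diagonal[OF p T]) (use emx_shift_commutator[OF g] True in simp)
    then show ?thesis
      using R by simp
  next
    case False
    then have adj: "p = Suc q \<or> q = Suc p" and s: "s = sh lam p q" and lamq: "lam q > 0"
      using pq g by (auto simp: gbasis_def)
    let ?H = "\<Sum>w\<in>{w. w permutes {1..n} \<and> w p = q}. of_int (sign w) *
        prod_list (map ((\<lambda>j. emx (w j) j)(p := fps_X, q := corr_col p q (w q))) [1..<n + 1])"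
    have H: "coeff2 ?H d (m + s) = 0"
      unfolding coeff2_sum coeff2_of_int_mult
    proof (intro sum.neutral ballI)
      fix w assume "w \<in> {w. w permutes {1..n} \<and> w p = q}"
      then have w: "w permutes {1..n}" "w p = q"
        by auto
      have "coeff2 (prod_list (map ((\<lambda>j. emx (w j) j)(p := fps_X, q := corr_col p q (w q))) [1..<n + 1])) d (m + s) = 0"
        by (rule coeff2_corr_term[OF _ w p q adj s lamq]) (rule I)
      then show "of_int (sign w) * coeff2 (prod_list (map ((\<lambda>j. emx (w j) j)
          (p := fps_X, q := corr_col p q (w q))) [1..<n + 1])) d (m + s) = 0"
        by (simp only: mult_zero_right)
    qed
    have "?T * (?Z * ?C - ?C * ?Z) = ?H - ?R"
    proof (rule cdet_commutator_adjacent[OF p q adj T X \<kappa> \<kappa>])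
      show "emx i q * emx i' q = emx i' q * emx i q" if "i \<noteq> q" "i' \<noteq> q" for i i'
        using eser_commute[OF that] that unfolding emx_offdiag[OF that(1)] emx_offdiag[OF that(2)]
        by (simp only: mult.assoc fps_const_X_left_commute fps_const_mult)
    qed (rule emx_shift_commutator[OF g], assumption, assumption, rule emx_column_commutator[OF q])
    then show ?thesis
      using H R by simp
  qed
  \<comment> \<open>Multiplication by t^s moved the coefficient of t^m to t^(m+s).\<close>
  then show ?thesis
    by (simp add: fps_X_power_mult_nth)
qed

end

section \<open>Centrality in the enveloping algebra\<close>

lemma prod_list_zero_mem: "(0::'b::ring_1) \<in> set l \<Longrightarrow> prod_list l = 0"
  by (induction l) auto

lemma prod_list_map_filter_neutral:
  fixes f :: "'i \<Rightarrow> 'b::ring_1"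
  shows "(\<And>x. x \<in> set l \<Longrightarrow> \<not> P x \<Longrightarrow> f x = 1) \<Longrightarrow> prod_list (map f (filter P l)) = prod_list (map f l)"
  by (induction l) auto

section \<open>Expansion of products over the choices \<open>mu\<close>\<close>

definition below :: "nat set \<Rightarrow> (nat \<Rightarrow> nat) \<Rightarrow> (nat \<Rightarrow> nat) set" where
  "below A B = {mu. \<forall>j. mu j \<le> (if j \<in> A then B j else 0)}"

lemma below_le: "mu \<in> below A B \<Longrightarrow> j \<in> A \<Longrightarrow> mu j \<le> B j"
  by (simp add: below_def split: if_splits)

lemma below_outside: "mu \<in> below A B \<Longrightarrow> j \<notin> A \<Longrightarrow> mu j = 0"
  by (simp add: below_def) (metis le_zero_eq)

lemma belowI: "(\<And>j. j \<in> A \<Longrightarrow> mu j \<le> B j) \<Longrightarrow> (\<And>j. j \<notin> A \<Longrightarrow> mu j = 0) \<Longrightarrow> mu \<in> below A B"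
  by (simp add: below_def)

lemma finite_below:
  assumes "finite A"
  shows "finite (below A B)"
proof (rule finite_subset)
  show "below A B \<subseteq> {mu. \<forall>j. (j \<in> A \<longrightarrow> mu j \<in> {..Max (B ` A)}) \<and> (j \<notin> A \<longrightarrow> mu j = 0)}"
  proof
    fix mu assume mu: "mu \<in> below A B"
    have "mu j \<le> Max (B ` A)" if "j \<in> A" for j
      using below_le[OF mu that] that assms by (intro order.trans[OF _ Max_ge]) auto
    moreover have "mu j = 0" if "j \<notin> A" for j
      using below_outside[OF mu that] .
    ultimately show "mu \<in> {mu. \<forall>j. (j \<in> A \<longrightarrow> mu j \<in> {..Max (B ` A)}) \<and> (j \<notin> A \<longrightarrow> mu j = 0)}"
      by auto
  qed
  show "finite {mu :: nat \<Rightarrow> nat. \<forall>j. (j \<in> A \<longrightarrow> mu j \<in> {..Max (B ` A)}) \<and> (j \<notin> A \<longrightarrow> mu j = 0)}"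
    by (rule finite_set_of_finite_funs) (use assms in auto)
qed

lemma prod_list_sum:
  fixes f :: "nat \<Rightarrow> nat \<Rightarrow> 'b::ring_1"
  assumes "distinct l"
  shows "prod_list (map (\<lambda>j. \<Sum>m\<le>B j. f j m) l)
    = (\<Sum>mu\<in>below (set l) B. prod_list (map (\<lambda>j. f j (mu j)) l))"
  using assms
proof (induction l)
  case Nil
  have "below {} B = {\<lambda>_. 0}"
    by (auto simp: below_def)
  then show ?case
    by simp
next
  case (Cons x l)
  let ?P = "\<lambda>mu. prod_list (map (\<lambda>j. f j (mu j)) l)"
  have upd: "?P (mu(x := m)) = ?P mu" for mu m
    using Cons.prems by (intro arg_cong[of _ _ prod_list] map_cong) auto
  have "prod_list (map (\<lambda>j. \<Sum>m\<le>B j. f j m) (x # l)) = (\<Sum>m\<le>B x. f x m) * (\<Sum>mu\<in>below (set l) B. ?P mu)"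
    using Cons by simp
  also have "\<dots> = (\<Sum>(m, mu)\<in>{..B x} \<times> below (set l) B. f x m * ?P mu)"
    by (simp add: sum_product sum.cartesian_product)
  also have "\<dots> = (\<Sum>mu\<in>below (set (x # l)) B. f x (mu x) * ?P mu)"
  proof (rule sum.reindex_bij_witness[of _ "\<lambda>mu. (mu x, mu(x := 0))" "\<lambda>(m, mu). mu(x := m)"])
    fix mu assume mu: "mu \<in> below (set (x # l)) B"
    show "(mu x, mu(x := 0)) \<in> {..B x} \<times> below (set l) B"
      using Cons.prems below_le[OF mu] below_outside[OF mu] by (auto intro!: belowI)
    show "(\<lambda>(m, mu). mu(x := m)) (mu x, mu(x := 0)) = mu"
      by simp
  next
    fix a assume "a \<in> {..B x} \<times> below (set l) B"
    then obtain m mu where a: "a = (m, mu)" "m \<le> B x" and mu: "mu \<in> below (set l) B"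
      by auto
    have mu0: "mu x = 0"
      using Cons.prems below_outside[OF mu, of x] by auto
    show "(\<lambda>(m, mu). mu(x := m)) a \<in> below (set (x # l)) B"
      using a below_le[OF mu] below_outside[OF mu] by (auto intro!: belowI split: if_splits)
    show "(((\<lambda>(m, mu). mu(x := m)) a) x, ((\<lambda>(m, mu). mu(x := m)) a)(x := 0)) = a"
      using a mu0 by auto
    show "f x (((\<lambda>(m, mu). mu(x := m)) a) x) * ?P ((\<lambda>(m, mu). mu(x := m)) a)
        = (case a of (m, mu) \<Rightarrow> f x m * ?P mu)"
      unfolding a by (simp only: prod.case upd fun_upd_same)
  qed
  finally show ?case
    by simp
qed

lemma prod_list_const_X_power:
  fixes c :: "nat \<Rightarrow> 'b::ring_1"
  shows "prod_list (map (\<lambda>j. fps_const (c j) * fps_X ^ k j) l)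
    = fps_const (prod_list (map c l)) * fps_X ^ (\<Sum>j\<leftarrow>l. k j)"
proof (induction l)
  case (Cons x l)
  have "fps_const (c x) * fps_X ^ k x * (fps_const a * fps_X ^ s)
      = fps_const (c x * a) * fps_X ^ (k x + s)" for a s
    by (simp only: fps_const_mult[symmetric] power_add mult.assoc)
      (metis fps_mult_fps_X_power_commute mult.assoc)
  then show ?case
    using Cons by simp
qed simp

text \<open>The terms of an entry are numbered by one integer: 0 for the constant term and k > 0 for
  x * t^(k-1). A choice \<open>mu\<close> then has x-degree equal to its number of nonzero parts,
  and its t-degree is its sum minus that number.\<close>

lemma coeff2_prod_list:
  fixes a :: "nat \<Rightarrow> 'b::ring_1 fps fps"
  assumes l: "distinct l"
    and a: "\<And>j d m. j \<in> set l \<Longrightarrow> coeff2 (a j) d m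
      = (if d = 0 \<and> m = 0 then c j 0 else if d = 1 then c j (Suc m) else 0)"
    and B: "\<And>j m. j \<in> set l \<Longrightarrow> B j < m \<Longrightarrow> c j m = 0"
  shows "coeff2 (prod_list (map a l)) d m
    = (\<Sum>mu\<in>{mu\<in>below (set l) B. sum mu (set l) = m + d \<and> card {j\<in>set l. mu j \<noteq> 0} = d}.
        prod_list (map (\<lambda>j. c j (mu j)) l))"
proof -
  define f where "f j k = (if k = 0 then fps_const (fps_const (c j 0))
    else fps_const (fps_const (c j k) * fps_X ^ (k - 1)) * fps_X ^ 1)" for j k
  \<comment> \<open>The truncated difference k - 1 is 0 for k = 0, so one formula covers both
    cases.\<close>
  have f: "f j k = fps_const (fps_const (c j k) * fps_X ^ (k - 1)) * fps_X ^ (if k = 0 then 0 else 1)"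
    for j k
    by (simp add: f_def)
  have fc: "coeff2 (f j k) d m = (if d = (if k = 0 then 0 else 1) \<and> m = k - 1 then c j k else 0)"
    for j k d m
    unfolding f by (auto simp: fps_X_power_mult_right_nth)
  have "a j = (\<Sum>k\<le>B j. f j k)" if j: "j \<in> set l" for j
  proof (intro fps_ext)
    fix d m :: nat
    have "d = (if k = 0 then 0 else 1) \<and> m = k - 1
        \<longleftrightarrow> k = (if d = 0 then 0 else Suc m) \<and> (d = 0 \<longrightarrow> m = 0) \<and> d \<le> 1" for k
      by (cases k; cases "d = 0") auto
    then have "coeff2 (\<Sum>k\<le>B j. f j k) d m
      = (\<Sum>k\<le>B j. if k = (if d = 0 then 0 else Suc m) \<and> (d = 0 \<longrightarrow> m = 0) \<and> d \<le> 1 then c j k else 0)"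
      unfolding coeff2_sum fc by (simp only:)
    also have "\<dots> = (if (d = 0 \<longrightarrow> m = 0) \<and> d \<le> 1 then c j (if d = 0 then 0 else Suc m) else 0)"
      using B[OF j] by (cases "(d = 0 \<longrightarrow> m = 0) \<and> d \<le> 1") (auto simp: sum.delta)
    finally show "coeff2 (a j) d m = coeff2 (\<Sum>k\<le>B j. f j k) d m"
      unfolding a[OF j] by auto
  qed
  then have "map a l = map (\<lambda>j. \<Sum>k\<le>B j. f j k) l"
    by simp
  then have "prod_list (map a l) = (\<Sum>mu\<in>below (set l) B. prod_list (map (\<lambda>j. f j (mu j)) l))"
    by (simp only: prod_list_sum[OF l])
  moreover have "coeff2 (prod_list (map (\<lambda>j. f j (mu j)) l)) d m
    = (if sum mu (set l) = m + d \<and> card {j\<in>set l. mu j \<noteq> 0} = d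
        then prod_list (map (\<lambda>j. c j (mu j)) l) else 0)" for mu
  proof -
    have s1: "(\<Sum>j\<leftarrow>l. if mu j = 0 then 0 else 1) = card {j\<in>set l. mu j \<noteq> 0}"
      using l by (simp add: sum_list_distinct_conv_sum_set sum.If_cases Int_def)
    have "(\<Sum>j\<leftarrow>l. mu j - 1) + (\<Sum>j\<leftarrow>l. if mu j = 0 then 0 else 1) = (\<Sum>j\<leftarrow>l. mu j)"
      by (induction l) auto
    then have s2: "(\<Sum>j\<leftarrow>l. mu j - 1) + card {j\<in>set l. mu j \<noteq> 0} = sum mu (set l)"
      unfolding s1 using l by (simp add: sum_list_distinct_conv_sum_set)
    show ?thesis
      unfolding f prod_list_const_X_power s1 using s2
      by (auto simp: fps_X_power_mult_right_nth)
  qed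
  ultimately show ?thesis
    by (simp add: coeff2_sum sum.inter_filter finite_below)
qed

text \<open>Entries with \<open>mu j = 0\<close> are Kronecker deltas, so only permutations of the support contribute.\<close>

lemma sum_permutes_support:
  fixes c :: "nat \<Rightarrow> nat \<Rightarrow> nat \<Rightarrow> 'b::ring_1" and mu :: "nat \<Rightarrow> nat" and n :: nat
  assumes c0: "\<And>i j. c i j 0 = (if i = j then 1 else 0)"
  defines "js \<equiv> sorted_list_of_set (supp_mu n mu)"
  shows "(\<Sum>w\<in>{w. w permutes {1..n}}. of_int (sign w) * prod_list (map (\<lambda>j. c (w j) j (mu j)) [1..<n + 1]))
    = (\<Sum>w\<in>{w. w permutes {0..<length js}}. of_int (sign w) *
        prod_list (map (\<lambda>k. c (js ! w k) (js ! k) (mu (js ! k))) [0..<length js]))"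
proof -
  let ?S = "supp_mu n mu" and ?d = "length js"
  let ?f = "\<lambda>w. of_int (sign w) * prod_list (map (\<lambda>j. c (w j) j (mu j)) [1..<n + 1])"
  let ?g = "\<lambda>w. of_int (sign w) * prod_list (map (\<lambda>k. c (js ! w k) (js ! k) (mu (js ! k))) [0..<?d])"
  have finS: "finite ?S" and S: "?S \<subseteq> {1..n}"
    by (auto simp: supp_mu_def)
  have "set (filter (\<lambda>j. mu j \<noteq> 0) [1..<n + 1]) = ?S"
    by (auto simp: supp_mu_def)
  then have js_filter: "js = filter (\<lambda>j. mu j \<noteq> 0) [1..<n + 1]"
    unfolding js_def by (metis distinct_filter distinct_upt sorted_distinct_set_unique finS
        set_sorted_list_of_set sorted_upt sorted_wrt_filter distinct_sorted_list_of_set sorted_sorted_list_of_set)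
  have set_js: "set js = ?S" and dist: "distinct js"
    using finS by (auto simp: js_def)
  have bij: "bij_betw ((!) js) {0..<?d} ?S"
    using bij_betw_nth[OF dist refl, of ?S] set_js by (simp add: atLeast0LessThan)
  have inj: "inj_on ((!) js) {0..<?d}"
    using bij by (rule bij_betw_imp_inj_on)
  have "sum ?f {w. w permutes {1..n}} = sum ?f {w. w permutes ?S}"
  proof (rule sum.mono_neutral_right)
    show "finite {w. w permutes {1..n}}"
      by (simp add: finite_permutations)
    show "{w. w permutes ?S} \<subseteq> {w. w permutes {1..n}}"
      using S by (auto intro: permutes_subset)
    show "\<forall>w\<in>{w. w permutes {1..n}} - {w. w permutes ?S}. ?f w = 0"
    proof
      fix w assume "w \<in> {w. w permutes {1..n}} - {w. w permutes ?S}"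
      then have w: "w permutes {1..n}" "\<not> w permutes ?S"
        by auto
      obtain j where j: "j \<in> {1..n}" "j \<notin> ?S" "w j \<noteq> j"
        using w permutes_superset[OF w(1), of ?S] by auto
      have "mu j = 0"
        using j(1,2) by (auto simp: supp_mu_def)
      then have "0 = c (w j) j (mu j)"
        using j(3) c0 by simp
      then have "0 \<in> set (map (\<lambda>j. c (w j) j (mu j)) [1..<n + 1])"
        using j(1) by force
      from prod_list_zero_mem[OF this] show "?f w = 0"
        by (simp only: mult_zero_right)
    qed
  qed
  also have "\<dots> = (\<Sum>w\<in>{w. w permutes ?S}. of_int (sign w) * prod_list (map (\<lambda>j. c (w j) j (mu j)) js))"
  proof (rule sum.cong[OF refl])
    fix w assume "w \<in> {w. w permutes ?S}"
    then have "w j = j" if "mu j = 0" for j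
      using that by (auto simp: permutes_def supp_mu_def)
    then have "prod_list (map (\<lambda>j. c (w j) j (mu j)) js) = prod_list (map (\<lambda>j. c (w j) j (mu j)) [1..<n + 1])"
      unfolding js_filter by (intro prod_list_map_filter_neutral) (auto simp: c0)
    then show "?f w = of_int (sign w) * prod_list (map (\<lambda>j. c (w j) j (mu j)) js)"
      by (simp only:)
  qed
  also have "\<dots> = sum ?g {w. w permutes {0..<?d}}"
  \<comment> \<open>Permutations are conjugated by the increasing enumeration \<open>js\<close> of
    the support, which preserves signs.\<close>
  proof (rule sum.reindex_bij_witness[of _ "map_permutation {0..<?d} ((!) js)"
        "map_permutation ?S (inv_into {0..<?d} ((!) js))"])
    let ?inv = "inv_into {0..<?d} ((!) js)"
    have bij': "bij_betw ?inv ?S {0..<?d}"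
      using bij by (rule bij_betw_inv_into)
    fix w
    show "map_permutation ?S ?inv (map_permutation {0..<?d} ((!) js) w) = w"
      "map_permutation {0..<?d} ((!) js) w \<in> {w. w permutes ?S}"
      if "w \<in> {w. w permutes {0..<?d}}"
      using that bij inj by (auto intro!: map_permutation_compose_inv map_permutation_permutes)
    show "map_permutation {0..<?d} ((!) js) (map_permutation ?S ?inv w) = w"
      "map_permutation ?S ?inv w \<in> {w. w permutes {0..<?d}}"
      if "w \<in> {w. w permutes ?S}"
      using that bij bij' by (auto intro!: map_permutation_compose_inv map_permutation_permutes
          simp: bij_betw_inv_into_right)
    assume "w \<in> {w. w permutes ?S}"
    then have w: "w permutes ?S"
      by simp
    let ?w' = "map_permutation ?S ?inv w"
    have app: "js ! ?w' k = w (js ! k)" if k: "k \<in> {0..<?d}" for k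
    proof -
      have "js ! k \<in> ?S"
        using k set_js by (metis atLeastLessThan_iff nth_mem)
      have "?inv (js ! k) = k"
        using inj k by (rule inv_into_f_f)
      then have "?w' k = ?inv (w (js ! k))"
        using map_permutation_apply[OF bij_betw_imp_inj_on[OF bij'] \<open>js ! k \<in> ?S\<close>, of w] by simp
      moreover have "w (js ! k) \<in> ?S"
        using w \<open>js ! k \<in> ?S\<close> by (simp add: permutes_in_image)
      ultimately show ?thesis
        using bij_betw_inv_into_right[OF bij] by simp
    qed
    have "sign ?w' = sign w"
      using bij_betw_imp_inj_on[OF bij'] w finS by (rule sign_map_permutation)
    moreover have "map (\<lambda>k. c (js ! ?w' k) (js ! k) (mu (js ! k))) [0..<?d] = map (\<lambda>j. c (w j) j (mu j)) js"
      using app by (intro nth_equalityI) auto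
    ultimately show "?g ?w' = of_int (sign w) * prod_list (map (\<lambda>j. c (w j) j (mu j)) js)"
      by (simp only:)
  qed
  finally show ?thesis .
qed

section \<open>Largest parts and the sequence d_r\<close>

lemma Mus_eq_below:
  "Mus n lam r = {mu\<in>below {1..n} lam. sum mu {1..n} = r \<and> card (supp_mu n mu) = dseq n lam r}"
  by (auto simp: Mus_def below_def)

text \<open>The right-hand side sums the card I largest parts. Removing the maximum of
  \<open>I\<close> leaves a subset of a shorter interval, and the removed part is at most the last
  one.\<close>

lemma sum_le_top:
  assumes nondec: "\<And>i j. 1 \<le> i \<Longrightarrow> i \<le> j \<Longrightarrow> j \<le> n \<Longrightarrow> lam i \<le> (lam j :: nat)"
    and "I \<subseteq> {1..n}"
  shows "sum lam I \<le> (\<Sum>t<card I. lam (n - t))"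
  using assms
proof (induction n arbitrary: I)
  case 0
  then show ?case
    by simp
next
  case (Suc n)
  have fin: "finite I"
    using Suc.prems(2) by (rule finite_subset) simp
  show ?case
  proof (cases "I = {}")
    case False
    define x where "x = Max I"
    have x: "x \<in> I" "\<And>i. i \<in> I \<Longrightarrow> i \<le> x"
      using False fin by (auto simp: x_def)
    have "I - {x} \<subseteq> {1..n}"
      using Suc.prems(2) x by fastforce
    then have IH: "sum lam (I - {x}) \<le> (\<Sum>t<card (I - {x}). lam (n - t))"
      using Suc.prems(1) by (intro Suc.IH) auto
    have "lam x \<le> lam (Suc n)"
      using Suc.prems x(1) by auto
    moreover have "(\<Sum>t<card I. lam (Suc n - t)) = lam (Suc n) + (\<Sum>t<card (I - {x}). lam (n - t))"
      unfolding card.remove[OF fin x(1)] sum.lessThan_Suc_shift by (simp only: diff_Suc_Suc minus_nat.diff_0)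
    ultimately show ?thesis
      using IH sum.remove[OF fin x(1), of lam] by simp
  qed simp
qed

lemma dseq_props:
  assumes "r \<in> {1..NN n lam}"
  shows "1 \<le> dseq n lam r" "(\<Sum>t<dseq n lam r - 1. lam (n - t)) < r"
    "\<And>k. r \<le> (\<Sum>t<k. lam (n - t)) \<Longrightarrow> dseq n lam r \<le> k"
proof -
  have "NN n lam = (\<Sum>t<n. lam (n - t))"
    unfolding NN_def by (rule sum.reindex_bij_witness[of _ "\<lambda>t. n - t" "\<lambda>i. n - i"]) auto
  then have ex: "r \<le> (\<Sum>t<n. lam (n - t))"
    using assms by simp
  have d: "r \<le> (\<Sum>t<dseq n lam r. lam (n - t))"
    unfolding dseq_def by (rule LeastI[of _ n]) (rule ex)
  then show "1 \<le> dseq n lam r"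
    using assms by (cases "dseq n lam r") auto
  then have "dseq n lam r - 1 < dseq n lam r"
    by simp
  then have "\<not> r \<le> (\<Sum>t<dseq n lam r - 1. lam (n - t))"
    unfolding dseq_def by (rule not_less_Least)
  then show "(\<Sum>t<dseq n lam r - 1. lam (n - t)) < r"
    by simp
  show "dseq n lam r \<le> k" if "r \<le> (\<Sum>t<k. lam (n - t))" for k
    unfolding dseq_def using that by (rule Least_le)
qed

text \<open>The parts of \<open>mu\<close> sum to at most as many largest parts of lambda.
  Consequently r - d_r is the highest loop degree among all \<open>mu\<close> of size r.\<close>

lemma dseq_le_card_supp:
  assumes nondec: "\<And>i j. 1 \<le> i \<Longrightarrow> i \<le> j \<Longrightarrow> j \<le> n \<Longrightarrow> lam i \<le> lam j"
    and r: "r \<in> {1..NN n lam}" and mu: "mu \<in> below {1..n} lam" "sum mu {1..n} = r"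
  shows "dseq n lam r \<le> card (supp_mu n mu)"
proof (rule dseq_props(3)[OF r])
  have "r = sum mu (supp_mu n mu)"
    unfolding mu(2)[symmetric] by (rule sum.mono_neutral_right) (auto simp: supp_mu_def)
  also have "\<dots> \<le> sum lam (supp_mu n mu)"
    using mu(1) by (intro sum_mono) (auto simp: below_def supp_mu_def split: if_splits)
  also have "\<dots> \<le> (\<Sum>t<card (supp_mu n mu). lam (n - t))"
    by (rule sum_le_top[OF nondec]) (auto simp: supp_mu_def)
  finally show "r \<le> (\<Sum>t<card (supp_mu n mu). lam (n - t))" .
qed

text \<open>Indexed by the part mu_j instead of the degree mu_j - 1; part 0 is a Kronecker delta, so
  all \<open>mu\<close> share the symmetric group on {1..n}. The parameter \<open>e\<close> lets one
  formula serve the free algebra and its quotient.\<close>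

definition part_entry :: "(nat \<Rightarrow> nat) \<Rightarrow> (nat \<Rightarrow> nat \<Rightarrow> nat \<Rightarrow> 'b::ring_1) \<Rightarrow> nat \<Rightarrow> nat \<Rightarrow> nat \<Rightarrow> 'b" where
  "part_entry lam e i j m = (if m = 0 then if i = j then 1 else 0
     else e i j (m - 1) - (if m = 1 \<and> i = j then of_nat ((i - 1) * lam i) else 0))"

definition zgen :: "nat \<Rightarrow> (nat \<Rightarrow> nat) \<Rightarrow> (nat \<Rightarrow> nat \<Rightarrow> nat \<Rightarrow> 'b::ring_1) \<Rightarrow> nat \<Rightarrow> 'b" where
  "zgen n lam e r = (\<Sum>mu\<in>Mus n lam r. \<Sum>w\<in>{w. w permutes {1..n}}. of_int (sign w) *
     prod_list (map (\<lambda>j. part_entry lam e (w j) j (mu j)) [1..<n + 1]))"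

lemma fconst_of_nat: "fconst (of_nat k) = of_nat k"
  by (simp add: fconst_def single_of_nat)

lemma zU_eq_zgen: "(zU n lam r :: 'a::ring_1 ufree) = zgen n lam egen r"
  unfolding zU_def zgen_def
proof (rule sum.cong[OF refl])
  fix mu
  let ?is = "sorted_list_of_set (supp_mu n mu)"
  have nz: "mu (?is ! k) \<noteq> 0" if "k < length ?is" for k
    using nth_mem[OF that] by (auto simp: supp_mu_def)
  have "etil lam (?is ! w k) (?is ! k) (mu (?is ! k) - 1)
      = (part_entry lam egen (?is ! w k) (?is ! k) (mu (?is ! k)) :: 'a ufree)" if "k < length ?is" for w k
    using nz[OF that] by (cases "mu (?is ! k) = 1")
      (auto simp: etil_def part_entry_def fconst_of_nat simp del: of_nat_mult)
  then have "map (\<lambda>k. etil lam (?is ! w k) (?is ! k) (mu (?is ! k) - 1)) [0..<length ?is]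
    = map (\<lambda>k. part_entry lam egen (?is ! w k) (?is ! k) (mu (?is ! k)) :: 'a ufree) [0..<length ?is]" for w
    by (intro map_cong refl) (simp only: set_upt atLeastLessThan_iff)
  then have "(cdet_mu n lam mu :: 'a ufree) = (\<Sum>w\<in>{w. w permutes {0..<length ?is}}. of_int (sign w) * prod_list
      (map (\<lambda>k. part_entry lam egen (?is ! w k) (?is ! k) (mu (?is ! k)) :: 'a ufree) [0..<length ?is]))"
    unfolding cdet_mu_def Let_def by (simp only:)
  also have "\<dots> = (\<Sum>w\<in>{w. w permutes {1..n}}. of_int (sign w) *
     prod_list (map (\<lambda>j. part_entry lam egen (w j) j (mu j)) [1..<n + 1]))"
    by (rule sum_permutes_support[symmetric]) (simp add: part_entry_def)
  finally show "(cdet_mu n lam mu :: 'a ufree) = (\<Sum>w\<in>{w. w permutes {1..n}}. of_int (sign w) *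
     prod_list (map (\<lambda>j. part_entry lam egen (w j) j (mu j)) [1..<n + 1]))"
    .
qed

text \<open>The d - 1 largest parts are positive and sum to less than r. It makes the truncated r -
  d_r an honest difference.\<close>

lemma dseq_le:
  assumes pos: "\<And>i. i \<in> {1..n} \<Longrightarrow> lam i > 0" and r: "r \<in> {1..NN n lam}"
  shows "dseq n lam r \<le> r"
proof -
  let ?d = "dseq n lam r"
  have "NN n lam = (\<Sum>t<n. lam (n - t))"
    unfolding NN_def by (rule sum.reindex_bij_witness[of _ "\<lambda>t. n - t" "\<lambda>i. n - i"]) auto
  then have "?d \<le> n"
    using r by (intro dseq_props(3)[OF r]) simp
  then have "(\<Sum>t<?d - 1. 1) \<le> (\<Sum>t<?d - 1. lam (n - t))"
    using pos by (intro sum_mono) (simp add: Suc_leI)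
  then show ?thesis
    using dseq_props(2)[OF r] by simp
qed

section \<open>Commutation with the whole basis\<close>

context centralizer_rep
begin

lemma coeff2_emx:
  "coeff2 (emx i j) d m = (if d = 0 \<and> m = 0 then part_entry lam e i j 0
     else if d = 1 then part_entry lam e i j (Suc m) else 0)"
  by (cases "d = 1"; cases "i = j") (auto simp: emx_def part_entry_def cap_def fps_one_nth
      fps_of_nat[symmetric] simp del: fps_of_nat of_nat_mult)

lemma part_entry_outside:
  assumes "j \<in> {1..n}" "lam j < m"
  shows "part_entry lam e i j m = 0"
proof -
  have "e i j (m - 1) = 0"
    using assms by (intro e_outside) (auto simp: gbasis_def)
  then show ?thesis
    using assms by (auto simp: part_entry_def)
qed

lemma coeff2_cdet_emx:
  assumes pos: "\<And>i. i \<in> {1..n} \<Longrightarrow> lam i > 0" and r: "r \<in> {1..NN n lam}"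
  shows "coeff2 (cdet n emx) (dseq n lam r) (r - dseq n lam r) = zgen n lam e r"
proof -
  let ?d = "dseq n lam r"
  have set: "set [1..<n + 1] = {1..n}"
    by auto
  have "{mu\<in>below (set [1..<n + 1]) lam. sum mu (set [1..<n + 1]) = r - ?d + ?d
      \<and> card {j\<in>set [1..<n + 1]. mu j \<noteq> 0} = ?d} = Mus n lam r"
    using dseq_le[OF pos r] unfolding Mus_eq_below supp_mu_def set by simp
  then have "coeff2 (prod_list (map (\<lambda>j. emx (w j) j) [1..<n + 1])) ?d (r - ?d)
    = (\<Sum>mu\<in>Mus n lam r. prod_list (map (\<lambda>j. part_entry lam e (w j) j (mu j)) [1..<n + 1]))" for w
    by (subst coeff2_prod_list[where c = "\<lambda>j. part_entry lam e (w j) j" and B = lam])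
      (auto simp: coeff2_emx part_entry_outside)
  then have "coeff2 (cdet n emx) ?d (r - ?d) = (\<Sum>w\<in>{w. w permutes {1..n}}. \<Sum>mu\<in>Mus n lam r.
      of_int (sign w) * prod_list (map (\<lambda>j. part_entry lam e (w j) j (mu j)) [1..<n + 1]))"
    unfolding cdet_def coeff2_sum coeff2_of_int_mult by (simp only: sum_distrib_left)
  also have "\<dots> = zgen n lam e r"
    unfolding zgen_def by (rule sum.swap)
  finally show ?thesis .
qed

text \<open>Commuting with \<open>z\<close> passes to brackets. Above the diagonal e_{i,j+1;r} is
  the bracket of e_{i,j;r-s} and the lowest e_{j,j+1;s}; below it e_{i,j;r} is the bracket of
  e_{i,j+1;r} and e_{j+1,j;0}. Monotonicity of lambda keeps these indices in
  \<open>gbasis\<close>.\<close>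

lemma commutes_all:
  assumes z: "\<And>p q s. (p, q, s) \<in> gbasis n lam \<Longrightarrow> p = q \<or> (p = Suc q \<or> q = Suc p) \<and> s = sh lam p q \<Longrightarrow>
      z * e p q s = e p q s * z"
    and ijr: "(i, j, r) \<in> gbasis n lam"
  shows "z * e i j r = e i j r * z"
proof -
  have br: "z * (x * y - y * x) = (x * y - y * x) * z" if "z * x = x * z" "z * y = y * z" for x y
  proof -
    have "z * (x * y) = x * y * z" "z * (y * x) = y * x * z"
      using that by (metis mult.assoc)+
    then show ?thesis
      by (simp only: right_diff_distrib left_diff_distrib)
  qed
  have upper: "z * e i (i + k) r = e i (i + k) r * z" if "(i, i + k, r) \<in> gbasis n lam" for k r
    using that
  proof (induction k arbitrary: r)
    case 0
    then show ?case
      using z by simp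
  next
    case (Suc k)
    let ?j = "i + k" and ?s = "sh lam (i + k) (Suc (i + k))"
    have mono: "lam i \<le> lam ?j" "lam ?j \<le> lam (Suc ?j)"
      using Suc.prems nondec by (auto simp: gbasis_def)
    have g1: "(i, ?j, r - ?s) \<in> gbasis n lam" and g2: "(?j, Suc ?j, ?s) \<in> gbasis n lam"
      and r: "r - ?s + ?s = r"
      using Suc.prems mono by (auto simp: gbasis_def sh_def)
    have "e i (Suc ?j) r = e i ?j (r - ?s) * e ?j (Suc ?j) ?s - e ?j (Suc ?j) ?s * e i ?j (r - ?s)"
      using e_comm[OF g1 g2] r by simp
    moreover have "z * e i ?j (r - ?s) = e i ?j (r - ?s) * z"
      by (rule Suc.IH) (rule g1)
    moreover have "z * e ?j (Suc ?j) ?s = e ?j (Suc ?j) ?s * z"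
      using g2 by (rule z) simp
    ultimately show ?case
      using br by simp
  qed
  have lower: "z * e (j + k) j r = e (j + k) j r * z" if "(j + k, j, r) \<in> gbasis n lam" for j k r
    using that
  proof (induction k arbitrary: j r)
    case 0
    then show ?case
      using z by simp
  next
    case (Suc k)
    have mono: "lam j \<le> lam (Suc j)" "lam (Suc j) \<le> lam (j + Suc k)"
      using Suc.prems nondec by (auto simp: gbasis_def)
    have g1: "(Suc j + k, Suc j, r) \<in> gbasis n lam" and g2: "(Suc j, j, 0) \<in> gbasis n lam"
      using Suc.prems mono by (auto simp: gbasis_def sh_def)
    have "e (j + Suc k) j r = e (Suc j + k) (Suc j) r * e (Suc j) j 0 - e (Suc j) j 0 * e (Suc j + k) (Suc j) r"
      using e_comm[OF g1 g2] by simp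
    moreover have "z * e (Suc j + k) (Suc j) r = e (Suc j + k) (Suc j) r * z"
      by (rule Suc.IH) (rule g1)
    moreover have "z * e (Suc j) j 0 = e (Suc j) j 0 * z"
      using g2 by (rule z) (use mono in \<open>simp add: sh_def\<close>)
    ultimately show ?case
      using br by simp
  qed
  show ?thesis
    using upper[of "j - i" r] lower[of j "i - j" r] ijr by (cases "i \<le> j") auto
qed

lemma zgen_commutes:
  assumes pos: "\<And>i. i \<in> {1..n} \<Longrightarrow> lam i > 0" and r: "r \<in> {1..NN n lam}"
    and ijs: "(i, j, s) \<in> gbasis n lam"
  shows "zgen n lam e r * e i j s = e i j s * zgen n lam e r"
proof (rule commutes_all[OF _ ijs])
  let ?d = "dseq n lam r"
  have less: "sum lam I < r - ?d + ?d" if "I \<subseteq> {1..n}" "card I = ?d - 1" for I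
  proof -
    have "sum lam I \<le> (\<Sum>t<card I. lam (n - t))"
      by (rule sum_le_top[OF nondec that(1)])
    then show ?thesis
      using that(2) dseq_props(2)[OF r] dseq_le[OF pos r] by simp
  qed
  have eq: "zgen n lam e r = coeff2 (cdet n emx) ?d (r - ?d)"
    by (rule coeff2_cdet_emx[OF pos r, symmetric])
  show "zgen n lam e r * e p q s = e p q s * zgen n lam e r"
    if "(p, q, s) \<in> gbasis n lam" "p = q \<or> (p = Suc q \<or> q = Suc p) \<and> s = sh lam p q" for p q s
    unfolding eq by (rule coeff2_cdet_commutes[OF that]) (rule less)
qed

end

section \<open>Matrices of the centralizer basis and their brackets\<close>

lemma sum_parts_mono: "i \<le> j \<Longrightarrow> (\<Sum>k\<in>{1..i}. lam k) \<le> (\<Sum>k\<in>{1..j}. (lam k :: nat))" for i j :: nat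
  by (rule sum_mono2) auto

text \<open>The box in row \<open>i\<close> and column \<open>c\<close>.\<close>

lemma rowof_colof:
  assumes "i \<in> {1..n}" "1 \<le> c" "c \<le> lam i"
  shows "rowof n lam ((\<Sum>k\<in>{1..<i}. lam k) + c) = i" "colof n lam ((\<Sum>k\<in>{1..<i}. lam k) + c) = c"
    "(\<Sum>k\<in>{1..<i}. lam k) + c \<in> {1..NN n lam}"
proof -
  let ?h = "(\<Sum>k\<in>{1..<i}. lam k) + c"
  have i: "{1..i} = insert i {1..<i}" "{1..<i} = {1..i - 1}"
    using assms(1) by auto
  have si: "(\<Sum>k\<in>{1..i}. lam k) = (\<Sum>k\<in>{1..<i}. lam k) + lam i"
    unfolding i(1) by simp
  show row: "rowof n lam ?h = i"
    unfolding rowof_def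
  proof (rule Least_equality)
    show "?h \<le> (\<Sum>k\<in>{1..i}. lam k)"
      using si assms by simp
    fix y assume y: "?h \<le> (\<Sum>k\<in>{1..y}. lam k)"
    show "i \<le> y"
    proof (rule ccontr)
      assume "\<not> i \<le> y"
      then have "(\<Sum>k\<in>{1..y}. lam k) \<le> (\<Sum>k\<in>{1..<i}. lam k)"
        unfolding i(2) by (intro sum_parts_mono) simp
      then show False
        using y assms(2) by simp
    qed
  qed
  then show "colof n lam ?h = c"
    by (simp add: colof_def)
  show "?h \<in> {1..NN n lam}"
    using sum_parts_mono[of i n lam] si assms by (auto simp: NN_def)
qed

lemma rowof_colof_inverse:
  assumes "h \<in> {1..NN n lam}"
  shows "rowof n lam h \<in> {1..n}" "1 \<le> colof n lam h" "colof n lam h \<le> lam (rowof n lam h)"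
    "h = (\<Sum>k\<in>{1..<rowof n lam h}. lam k) + colof n lam h"
proof -
  let ?i = "rowof n lam h"
  have h: "h \<le> (\<Sum>k\<in>{1..n}. lam k)" "1 \<le> h"
    using assms by (auto simp: NN_def)
  have le: "h \<le> (\<Sum>k\<in>{1..?i}. lam k)"
    unfolding rowof_def using h(1) by (rule LeastI)
  have "?i \<le> n"
    unfolding rowof_def using h(1) by (rule Least_le)
  moreover have i1: "1 \<le> ?i"
    using le h(2) by (cases ?i) auto
  ultimately show "?i \<in> {1..n}"
    by simp
  have i: "{1..?i} = insert ?i {1..<?i}" "{1..<?i} = {1..?i - 1}"
    using i1 by auto
  have "\<not> h \<le> (\<Sum>k\<in>{1..?i - 1}. lam k)"
    using i1 unfolding rowof_def by (intro not_less_Least) simp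
  then have gt: "(\<Sum>k\<in>{1..<?i}. lam k) < h"
    unfolding i(2) by simp
  then show "1 \<le> colof n lam h" "h = (\<Sum>k\<in>{1..<?i}. lam k) + colof n lam h"
    by (auto simp: colof_def)
  have "(\<Sum>k\<in>{1..?i}. lam k) = (\<Sum>k\<in>{1..<?i}. lam k) + lam ?i"
    unfolding i(1) by simp
  then show "colof n lam h \<le> lam ?i"
    using le by (simp add: colof_def)
qed

text \<open>The only possible middle box lies in row \<open>j\<close> and column col(a) + r. It
  exists: col(b) <= lam l and s >= s_{k,l} give col(a) + r <= lam k.\<close>

lemma emat_mult:
  assumes ijr: "(i, j, r) \<in> gbasis n lam" and kls: "(k, l, s) \<in> gbasis n lam"
  shows "(\<Sum>t\<in>{1..NN n lam}. emat n lam (i, j, r) a t * emat n lam (k, l, s) t b)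
    = (if j = k then emat n lam (i, l, r + s) a b else (0 :: 'a::ring_1))"
proof (cases "j = k")
  case False
  then show ?thesis
    by (auto simp: emat_def intro!: sum.neutral)
next
  case True
  let ?P = "a \<in> {1..NN n lam} \<and> b \<in> {1..NN n lam} \<and> rowof n lam a = i \<and> rowof n lam b = l
      \<and> colof n lam b = colof n lam a + (r + s)"
  define t0 where "t0 = (\<Sum>k\<in>{1..<j}. lam k) + (colof n lam a + r)"
  have t0: "rowof n lam t0 = j" "colof n lam t0 = colof n lam a + r" "t0 \<in> {1..NN n lam}" if ?P
  proof -
    have "colof n lam b \<le> lam l" "1 \<le> colof n lam a" "colof n lam a \<le> lam i"
      using rowof_colof_inverse[of b n lam] rowof_colof_inverse[of a n lam] that by auto
    then have c: "1 \<le> colof n lam a + r" "colof n lam a + r \<le> lam j"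
      using that ijr kls True by (auto simp: gbasis_def sh_def min_def split: if_splits)
    have j: "j \<in> {1..n}"
      using ijr by (auto simp: gbasis_def)
    show "rowof n lam t0 = j" "colof n lam t0 = colof n lam a + r" "t0 \<in> {1..NN n lam}"
      unfolding t0_def using rowof_colof[of j n "colof n lam a + r" lam, OF j c] by auto
  qed
  have "emat n lam (i, j, r) a t * emat n lam (k, l, s) t b = (if t = t0 then if ?P then 1 else 0 else (0::'a))"
    if t: "t \<in> {1..NN n lam}" for t
  proof (cases "t = t0 \<and> ?P")
    case tP: True
    then show ?thesis
      using t0 True by (simp add: emat_def)
  next
    case False
    have "\<not> (emat n lam (i, j, r) a t \<noteq> (0::'a) \<and> emat n lam (k, l, s) t b \<noteq> (0::'a))"
    proof
      assume "emat n lam (i, j, r) a t \<noteq> (0::'a) \<and> emat n lam (k, l, s) t b \<noteq> (0::'a)"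
      then have *: "a \<in> {1..NN n lam}" "rowof n lam a = i" "rowof n lam t = j" "colof n lam t = colof n lam a + r"
        "b \<in> {1..NN n lam}" "rowof n lam b = l" "colof n lam b = colof n lam t + s"
        by (auto simp: emat_def split: if_splits)
      then have "t = t0"
        using rowof_colof_inverse(4)[OF t] by (simp add: t0_def)
      then show False
        using False * by simp
    qed
    then show ?thesis
      using False by auto
  qed
  then have "(\<Sum>t\<in>{1..NN n lam}. emat n lam (i, j, r) a t * emat n lam (k, l, s) t b)
    = (\<Sum>t\<in>{1..NN n lam}. if t = t0 then if ?P then 1 else 0 else (0::'a))"
    by (intro sum.cong) auto
  also have "\<dots> = (if ?P then 1 else 0)"
    using t0 by simp
  finally show ?thesis
    using True by (simp add: emat_def)
qed

text \<open>A shift by r >= lam j would lead past the end of row \<open>j\<close>.\<close>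

lemma emat_outside:
  assumes "(i, j, r) \<notin> gbasis n lam" "i \<in> {1..n}" "j \<in> {1..n}" "sh lam i j \<le> r"
  shows "emat n lam (i, j, r) a b = 0"
proof -
  have r: "lam j \<le> r"
    using assms by (auto simp: gbasis_def)
  have "colof n lam b \<le> lam j" if "b \<in> {1..NN n lam}" "rowof n lam b = j"
    using rowof_colof_inverse(3)[OF that(1)] that(2) by simp
  moreover have "1 \<le> colof n lam a" if "a \<in> {1..NN n lam}"
    using rowof_colof_inverse(2)[OF that] .
  ultimately show ?thesis
    using r by (fastforce simp: emat_def)
qed

lemma gbasis_add:
  assumes "(i, j, r) \<in> gbasis n lam" "(j, l, s) \<in> gbasis n lam"
  shows "i \<in> {1..n}" "l \<in> {1..n}" "sh lam i l \<le> r + s"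
  using assms by (auto simp: gbasis_def sh_def)

lemma finite_gbasis: "finite (gbasis n lam)"
proof (rule finite_subset)
  show "gbasis n lam \<subseteq> {1..n} \<times> {1..n} \<times> {..Max (lam ` {1..n})}"
  proof
    fix b assume "b \<in> gbasis n lam"
    moreover have "lam j \<le> Max (lam ` {1..n})" if "j \<in> {1..n}" for j
      using that by (intro Max_ge) auto
    ultimately show "b \<in> {1..n} \<times> {1..n} \<times> {..Max (lam ` {1..n})}"
      unfolding gbasis_def by (cases b) (auto intro: order.trans less_imp_le)
  qed
qed auto

lemma fgen_outside: "b \<notin> gbasis n lam \<Longrightarrow> fgen b \<in> Kset n lam"
  unfolding Kset_def Urel_def by (rule ideal_gen_base, rule UnI2) blast

lemma fconst_0: "fconst 0 = 0" and fconst_1: "fconst 1 = 1"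
  by (simp_all add: fconst_def single_one)

text \<open>A bracket may produce an index outside \<open>gbasis\<close>. There the matrix vanishes,
  so the structure constants omit it, and the generator is killed by \<open>Urel\<close>; the
  formula holds uniformly.\<close>

lemma egen_commutator:
  assumes ijr: "(i, j, r) \<in> gbasis n lam" and kls: "(k, l, s) \<in> gbasis n lam"
  shows "(egen i j r * egen k l s - egen k l s * egen i j r
    - ((if j = k then egen i l (r + s) else 0) - (if i = l then egen k j (r + s) else 0))
      :: 'a::ring_1 ufree) \<in> Kset n lam"
proof -
  define u where "u P x c = (if P \<and> c = x then 1 else (0::'a))" for P and x c :: "nat \<times> nat \<times> nat"
  define \<alpha> where "\<alpha> c = u (j = k) (i, l, r + s) c - u (i = l) (k, j, r + s) c" for c
  let ?G = "gbasis n lam"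
  have one: "(\<Sum>c\<in>?G. u P x c * emat n lam c a b) = (if P then emat n lam x a b else 0)"
    if "P \<Longrightarrow> x \<notin> ?G \<Longrightarrow> emat n lam x a b = (0::'a)" for P x a b
  proof -
    have "(\<Sum>c\<in>?G. u P x c * emat n lam c a b) = (\<Sum>c\<in>?G. if c = x then if P then emat n lam x a b else 0 else 0)"
      by (rule sum.cong) (auto simp: u_def)
    then show ?thesis
      using that finite_gbasis[of n lam] by auto
  qed
  have out1: "emat n lam (i, l, r + s) a b = (0::'a)" if "j = k" "(i, l, r + s) \<notin> ?G" for a b
    using gbasis_add[OF ijr, of l s] kls that by (intro emat_outside) auto
  have out2: "emat n lam (k, j, r + s) a b = (0::'a)" if "i = l" "(k, j, r + s) \<notin> ?G" for a b
    using gbasis_add[OF kls, of j r] ijr that by (intro emat_outside) (auto simp: add.commute)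
  have "mcomm (NN n lam) (emat n lam (i, j, r)) (emat n lam (k, l, s)) a b
      = (\<Sum>c\<in>?G. \<alpha> c * emat n lam c a b)" for a b
    unfolding mcomm_def sum_subtractf \<alpha>_def left_diff_distrib emat_mult[OF ijr kls] emat_mult[OF kls ijr]
    by (subst (1 2) one) (auto simp: out1 out2 add.commute)
  then have mc: "\<forall>a b. mcomm (NN n lam) (emat n lam (i, j, r)) (emat n lam (k, l, s)) a b
      = (\<Sum>c\<in>?G. \<alpha> c * emat n lam c a b)"
    by blast
  have rel: "fgen (i, j, r) * fgen (k, l, s) - fgen (k, l, s) * fgen (i, j, r)
      - (\<Sum>c\<in>?G. fconst (\<alpha> c) * fgen c) \<in> Kset n lam"
    unfolding Kset_def Urel_def using mc ijr kls by (intro ideal_gen_base, intro UnI1) blast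
  have one': "(\<Sum>c\<in>?G. fconst (u P x c) * fgen c) - (if P then fgen x else 0) \<in> Kset n lam" for P x
  proof -
    have "(\<Sum>c\<in>?G. fconst (u P x c) * fgen c) = (\<Sum>c\<in>?G. if c = x then if P then fgen x else 0 else 0)"
      by (rule sum.cong) (auto simp: u_def fconst_0 fconst_1)
    then show ?thesis
      using finite_gbasis[of n lam] fgen_outside[of x n lam]
      by (auto simp: Kset_def ideal_gen_zero intro: ideal_gen_uminus)
  qed
  have "(fconst (\<alpha> c) :: 'a ufree) = fconst (u (j = k) (i, l, r + s) c) - fconst (u (i = l) (k, j, r + s) c)" for c
    by (simp add: \<alpha>_def fconst_def single_diff)
  then have sum: "(\<Sum>c\<in>?G. fconst (\<alpha> c) * fgen c) = (\<Sum>c\<in>?G. fconst (u (j = k) (i, l, r + s) c) * fgen c)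
      - (\<Sum>c\<in>?G. fconst (u (i = l) (k, j, r + s) c) * fgen c)"
    by (simp add: left_diff_distrib sum_subtractf)
  show ?thesis
    using ideal_gen_add[OF rel[unfolded Kset_def sum] ideal_gen_diff[OF one'[unfolded Kset_def, of "j = k" "(i, l, r + s)"]
          one'[unfolded Kset_def, of "i = l" "(k, j, r + s)"]]]
    unfolding Kset_def egen_def by (simp add: algebra_simps)
qed

text \<open>The images of the basis in the product of quotients form a
  \<open>centralizer_rep\<close>. Commutation is an equality there and is pulled back to a
  congruence at the component \<open>Urel\<close>.\<close>

lemma zU_commutes_fgen:
  fixes n :: nat and lam :: "nat \<Rightarrow> nat"
  assumes pos: "\<And>i. i \<in> {1..n} \<Longrightarrow> lam i > 0"
    and nondec: "\<And>i j. 1 \<le> i \<Longrightarrow> i \<le> j \<Longrightarrow> j \<le> n \<Longrightarrow> lam i \<le> lam j"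
    and r: "r \<in> {1..NN n lam}"
  shows "(zU n lam r * fgen b - fgen b * zU n lam r :: 'a::ring_1 ufree) \<in> Kset n lam"
proof (cases "b \<in> gbasis n lam")
  case False
  then show ?thesis
    using fgen_outside[OF False] unfolding Kset_def
    by (intro ideal_gen_diff ideal_gen_mult_left ideal_gen_mult_right)
next
  case True
  obtain i j s where b: "b = (i, j, s)"
    by (cases b)
  let ?U = "Urel n lam :: 'a ufree set"
  define e where "e i j r = quot_at ?U (egen i j r)" for i j r
  interpret centralizer_rep n lam e
  proof
    show "lam i \<le> lam j" if "1 \<le> i" "i \<le> j" "j \<le> n" for i j
      using nondec that .
    show "e i j r = 0" if "(i, j, r) \<notin> gbasis n lam" for i j r
      using fgen_outside[OF that] quot_at_eqI[of "egen i j r" 0 ?U] by (simp add: e_def egen_def Kset_def)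
    show "e i j r * e k l s - e k l s * e i j r
        = (if j = k then e i l (r + s) else 0) - (if i = l then e k j (r + s) else 0)"
      if "(i, j, r) \<in> gbasis n lam" "(k, l, s) \<in> gbasis n lam" for i j r k l s
    proof -
      have "(if P then quot_at ?U x else 0) = quot_at ?U (if P then x else 0)" for P x
        by simp
      then show ?thesis
        using quot_at_eqI[OF egen_commutator[OF that, unfolded Kset_def]]
        by (simp only: e_def quot_at_diff quot_at_mult)
    qed
  qed
  have "represents ?U (part_entry lam e i j m) (part_entry lam egen i j m)" for i j m
    unfolding part_entry_def e_def
    by (simp add: represents_0 represents_1 represents_of_nat represents_diff represents_quot_at
        del: of_nat_mult)
  then have "represents ?U (zgen n lam e r) (zU n lam r)"
    unfolding zU_eq_zgen zgen_def
    by (intro represents_sum represents_mult represents_of_int represents_prod_list)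
  moreover have "represents ?U (e i j s) (fgen b)"
    by (simp add: e_def egen_def b represents_quot_at)
  ultimately have "represents ?U (zgen n lam e r * e i j s - e i j s * zgen n lam e r)
      (zU n lam r * fgen b - fgen b * zU n lam r)"
    by (intro represents_diff represents_mult)
  moreover have "zgen n lam e r * e i j s - e i j s * zgen n lam e r = 0"
    using zgen_commutes[OF pos r] True b by simp
  ultimately show ?thesis
    by (simp add: represents_0_iff Kset_def)
qed

lemma falg_induct [case_names const gen add mult]:
  fixes x :: "('x, 'a::ring_1) falg"
  assumes const: "\<And>c. P (fconst c)" and gen: "\<And>g. P (fgen g)"
    and add: "\<And>x y. P x \<Longrightarrow> P y \<Longrightarrow> P (x + y)" and mult: "\<And>x y. P x \<Longrightarrow> P y \<Longrightarrow> P (x * y)"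
  shows "P x"
proof -
  have single: "P (Poly_Mapping.single w c)" for w :: "'x word" and c :: 'a
  proof -
    obtain l where w: "w = Word l"
      by (cases w)
    have "P (Poly_Mapping.single (Word l) 1)"
    proof (induction l)
      case Nil
      then show ?case
        using const[of 1] by (simp add: fconst_def zero_word_def)
    next
      case (Cons x l)
      have "Poly_Mapping.single (Word (x # l)) 1 = fgen x * Poly_Mapping.single (Word l) (1 :: 'a)"
        by (simp add: fgen_def mult_single)
      then show ?case
        using gen Cons mult by metis
    qed
    moreover have "Poly_Mapping.single w c = fconst c * Poly_Mapping.single (Word l) 1"
      by (simp add: fconst_def mult_single w)
    ultimately show ?thesis
      using const mult by metis
  qed
  show ?thesis
  proof (induction x rule: update_induct)
    case const
    then show ?case
      using single[of 0 0] by simp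
  next
    case (update f a b)
    have "Poly_Mapping.update a b f = f + Poly_Mapping.single a b"
      using update(1) by (intro poly_mapping_eqI)
        (auto simp: lookup_update lookup_add lookup_single in_keys_iff)
    then show ?case
      using update add single by metis
  qed
qed

lemma fconst_central: "fconst c * x = x * fconst (c :: 'a::comm_ring_1)"
proof (induction x rule: falg_induct)
  case (const d)
  then show ?case
    by (simp add: fconst_def mult_single mult.commute)
next
  case (gen g)
  then show ?case
    by (simp add: fconst_def fgen_def mult_single)
next
  case (add x y)
  then show ?case
    by (simp add: distrib_left distrib_right)
next
  case (mult x y)
  then show ?case
    by (metis mult.assoc)
qed

lemma zU_central:
  fixes b :: "'a::comm_ring_1 ufree"
  assumes pos: "\<And>i. i \<in> {1..n} \<Longrightarrow> lam i > 0"
    and nondec: "\<And>i j. 1 \<le> i \<Longrightarrow> i \<le> j \<Longrightarrow> j \<le> n \<Longrightarrow> lam i \<le> lam j"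
    and r: "r \<in> {1..NN n lam}"
  shows "zU n lam r * b - b * zU n lam r \<in> Kset n lam"
proof (induction b rule: falg_induct)
  case (const c)
  then show ?case
    by (simp add: fconst_central Kset_def ideal_gen_zero)
next
  case (gen g)
  then show ?case
    by (rule zU_commutes_fgen[OF pos nondec r])
next
  case (add x y)
  let ?z = "zU n lam r"
  have "?z * (x + y) - (x + y) * ?z = (?z * x - x * ?z) + (?z * y - y * ?z)"
    by (simp add: algebra_simps)
  then show ?case
    using add unfolding Kset_def by (simp only: ideal_gen_add)
next
  case (mult x y)
  let ?z = "zU n lam r"
  have "?z * (x * y) - (x * y) * ?z = (?z * x - x * ?z) * y + x * (?z * y - y * ?z)"
    by (simp add: algebra_simps)
  then show ?case
    using mult unfolding Kset_def by (simp only: ideal_gen_add ideal_gen_mult_left ideal_gen_mult_right)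
qed

section \<open>Leading terms of the coefficients of Z\<close>

lemma sum_pred_add_card:
  fixes mu :: "'i \<Rightarrow> nat"
  assumes "finite A"
  shows "(\<Sum>j\<in>A. mu j - 1) + card {j\<in>A. mu j \<noteq> 0} = sum mu A"
proof -
  have "card {j\<in>A. mu j \<noteq> 0} = (\<Sum>j\<in>A. if mu j \<noteq> 0 then 1 else 0)"
    using assms by (simp add: sum.If_cases Int_def)
  then show ?thesis
    by (simp add: sum.distrib[symmetric]) (rule sum.cong, auto)
qed

lemma fconst_of_int: "fconst (of_int k) = of_int k"
  by (cases k rule: int_cases2) (simp_all add: fconst_def single_uminus)

section \<open>Spans of monomials and the loop filtration\<close>

lemma fspan_zero: "0 \<in> fspan X"
  unfolding fspan_def by (auto intro: exI[of _ 0])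

lemma fspan_base: "x \<in> X \<Longrightarrow> x \<in> fspan X"
  unfolding fspan_def
  by (intro CollectI exI[of _ 1] exI[of _ "\<lambda>_. 1"] exI[of _ "\<lambda>_. x"]) (simp add: fconst_1)

lemma fspan_add:
  fixes x y :: "('x, 'a::ring_1) falg"
  assumes "x \<in> fspan X" "y \<in> fspan X"
  shows "x + y \<in> fspan X"
proof -
  obtain m c v where x: "\<forall>k<m. v k \<in> X" "x = (\<Sum>k<(m::nat). fconst (c k) * v k)"
    using assms(1) unfolding fspan_def by blast
  obtain m' c' v' where y: "\<forall>k<m'. v' k \<in> X" "y = (\<Sum>k<(m'::nat). fconst (c' k) * v' k)"
    using assms(2) unfolding fspan_def by blast
  let ?c = "\<lambda>k. if k < m then c k else c' (k - m)" and ?v = "\<lambda>k. if k < m then v k else v' (k - m)"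
  have "(\<Sum>k<m + m'. h k) = (\<Sum>k<m. h k) + (\<Sum>k<m'. h (m + k))" for h :: "nat \<Rightarrow> ('x, 'a) falg"
    by (induction m') (simp_all add: add.assoc)
  then have "x + y = (\<Sum>k<m + m'. fconst (?c k) * ?v k)"
    unfolding x y by simp
  moreover have "\<forall>k<m + m'. ?v k \<in> X"
    using x(1) y(1) by auto
  ultimately show ?thesis
    unfolding fspan_def by (intro CollectI exI[of _ "m + m'"] exI[of _ ?c] exI[of _ ?v]) simp
qed

lemma fspan_uminus:
  fixes x :: "('x, 'a::ring_1) falg"
  assumes "x \<in> fspan X"
  shows "- x \<in> fspan X"
proof -
  obtain m c v where x: "\<forall>k<m. v k \<in> X" "x = (\<Sum>k<(m::nat). fconst (c k) * v k)"
    using assms unfolding fspan_def by blast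
  have "- x = (\<Sum>k<m. fconst (- c k) * v k)"
    unfolding x by (simp add: sum_negf fconst_def single_uminus)
  then show ?thesis
    using x(1) unfolding fspan_def
    by (intro CollectI exI[of _ m] exI[of _ "\<lambda>k. - c k"] exI[of _ v]) simp
qed

text \<open>Integral spans are closed under multiplication even when the scalars do not commute, which
  matters since the filtration is considered over an arbitrary ring.\<close>

inductive_set zspan :: "'r::ring_1 set \<Rightarrow> 'r set" for X where
  zspan_zero: "0 \<in> zspan X"
| zspan_base: "x \<in> X \<Longrightarrow> x \<in> zspan X"
| zspan_add: "x \<in> zspan X \<Longrightarrow> y \<in> zspan X \<Longrightarrow> x + y \<in> zspan X"
| zspan_uminus: "x \<in> zspan X \<Longrightarrow> - x \<in> zspan X"

lemma zspan_fspan: "x \<in> zspan X \<Longrightarrow> x \<in> fspan X"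
  by (induction rule: zspan.induct) (auto intro: fspan_zero fspan_base fspan_add fspan_uminus)

lemma zspan_mono: "x \<in> zspan X \<Longrightarrow> X \<subseteq> Y \<Longrightarrow> x \<in> zspan Y"
  by (induction rule: zspan.induct) (auto intro: zspan.intros)

lemma zspan_of_int_mult: "x \<in> zspan X \<Longrightarrow> of_int k * x \<in> zspan X"
proof -
  assume x: "x \<in> zspan X"
  have "of_nat m * x \<in> zspan X" for m
    by (induction m) (auto simp: distrib_right intro: zspan.intros x)
  then show ?thesis
    by (cases k rule: int_cases2) (auto intro: zspan_uminus)
qed

lemma zspan_mult:
  assumes "x \<in> zspan X" "y \<in> zspan Y" "\<And>v w. v \<in> X \<Longrightarrow> w \<in> Y \<Longrightarrow> v * w \<in> Z"
  shows "x * y \<in> zspan Z"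
  using assms(1)
proof (induction rule: zspan.induct)
  case (zspan_base v)
  show ?case
    using assms(2)
    by (induction rule: zspan.induct) (auto simp: distrib_left intro: zspan.intros assms(3) zspan_base)
qed (auto simp: distrib_right intro: zspan.intros)

lemma Tmonos_mono: "m \<le> m' \<Longrightarrow> Tmonos n lam m \<subseteq> Tmonos n lam m'"
  unfolding Tmonos_def by fastforce

lemma Tmonos_mult: "v \<in> Tmonos n lam m \<Longrightarrow> w \<in> Tmonos n lam m' \<Longrightarrow> v * w \<in> Tmonos n lam (m + m')"
proof -
  assume "v \<in> Tmonos n lam m" "w \<in> Tmonos n lam m'"
  then obtain l l' where
    "v = prod_list (map (\<lambda>(i, j, r). Tw lam i j (r + 1)) l)" "\<forall>(i, j, r)\<in>set l. i \<in> {1..n} \<and> j \<in> {1..n}"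
    "sum_list (map (\<lambda>(i, j, r). r) l) \<le> m"
    "w = prod_list (map (\<lambda>(i, j, r). Tw lam i j (r + 1)) l')" "\<forall>(i, j, r)\<in>set l'. i \<in> {1..n} \<and> j \<in> {1..n}"
    "sum_list (map (\<lambda>(i, j, r). r) l') \<le> m'"
    unfolding Tmonos_def by blast
  then show ?thesis
    unfolding Tmonos_def by (intro CollectI exI[of _ "l @ l'"]) auto
qed

lemma one_in_Tmonos: "1 \<in> Tmonos n lam m"
  unfolding Tmonos_def by (intro CollectI exI[of _ "[]"]) simp

lemma Tw_in_Tmonos:
  assumes "i \<in> {1..n}" "j \<in> {1..n}" "1 \<le> t"
  shows "Tw lam i j t \<in> Tmonos n lam (t - 1)"
  unfolding Tmonos_def using assms by (intro CollectI exI[of _ "[(i, j, t - 1)]"]) simp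

lemma fspan_Tmonos_Filt: "fspan (Tmonos n lam m) \<subseteq> (Filt n lam m :: 'a::ring_1 yfree set)"
proof
  fix x :: "'a yfree" assume x: "x \<in> fspan (Tmonos n lam m)"
  have "(0 :: 'a yfree) \<in> ideal_in (Sgen n lam) {Dc 1 r | r. r > lam 1}"
    unfolding ideal_in_def by (auto intro: exI[of _ 0])
  then have "(0 :: 'a yfree) \<in> Jset n lam"
    unfolding Jset_def Ryang_def using ideal_gen_zero by (intro CollectI exI[of _ 0]) simp
  then show "x \<in> Filt n lam m"
    using x unfolding Filt_def by (intro CollectI bexI[of _ x]) simp_all
qed

section \<open>Coefficients of the entries of Z(u)\<close>

lemma resid_nth_0: "k < i \<Longrightarrow> k < j \<Longrightarrow> fps_nth (resid k i j) 0 = (if i = j then 1 else 0)"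
  by (induction k arbitrary: i j) (auto simp: Tser_def T0_def)

lemma Tw_0:
  assumes "i \<in> {1..n}" "j \<in> {1..n}"
  shows "Tw lam i j 0 = (if i = j then 1 else 0)"
proof -
  have F: "fps_nth (sigFser lam k i) 0 = (if k = i then 1 else 0)" for k
    by (simp add: sigFser_def)
  have E: "fps_nth (sigEser lam k j) 0 = (if k = j then 1 else 0)" for k
    by (simp add: sigEser_def)
  have D: "fps_nth (Dser k) 0 = 1" if "1 \<le> k" for k
    using that by (simp add: Dser_def resid_nth_0)
  have "Tw lam i j 0 = (\<Sum>k\<in>{1..min i j}. if k = i then if k = j then 1 else 0 else 0)"
    unfolding Tw_def sigT_def fps_sum_nth by (intro sum.cong refl) (auto simp: F E D)
  then show ?thesis
    using assms by auto
qed

text \<open>Every summand has k <= i, so s_{k,j} >= s_{i,j}, and its last factor starts only beyond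
  s_{k,j}.\<close>

lemma Tw_below_shift:
  assumes nondec: "\<And>i j. 1 \<le> i \<Longrightarrow> i \<le> j \<Longrightarrow> j \<le> n \<Longrightarrow> lam i \<le> lam j"
    and ij: "i \<in> {1..n}" "j \<in> {1..n}" "i < j" and r: "r \<le> sh lam i j"
  shows "Tw lam i j r = (0 :: 'a::ring_1 yfree)"
  unfolding Tw_def sigT_def fps_sum_nth
proof (rule sum.neutral, rule ballI)
  fix k assume k: "k \<in> {1..min i j}"
  then have kj: "k \<noteq> j" and "lam k \<le> lam i"
    using ij nondec by auto
  then have "sh lam i j \<le> sh lam k j"
    by (auto simp: sh_def)
  then have "fps_nth (sigEser lam k j) (r - l) = (0 :: 'a yfree)" for l
  proof -
    have "\<not> sh lam k j < r - l"
      using r \<open>sh lam i j \<le> sh lam k j\<close> by simp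
    then show ?thesis
      using kj by (simp add: sigEser_def)
  qed
  then show "fps_nth (sigFser lam k i * Dser k * sigEser lam k j) r = (0 :: 'a yfree)"
    by (simp add: fps_mult_nth[of "sigFser lam k i * Dser k"])
qed

text \<open>Binomial expansion with integer coefficients made explicit; integrality keeps the later
  expansions inside \<open>zspan\<close>.\<close>

lemma fps_X_minus_power_nth:
  "fps_nth ((fps_X - of_nat c) ^ k :: 'b::ring_1 fps) l = of_int (int (k choose l) * (- int c) ^ (k - l))"
proof (induction k arbitrary: l)
  case 0
  then show ?case
    by (cases l) simp_all
next
  case (Suc k)
  let ?q = "(fps_X - of_nat c) ^ k :: 'b fps"
  have c: "fps_nth (of_nat c * ?q) l = of_nat c * fps_nth ?q l" for l
    by (simp add: fps_of_nat[symmetric] del: fps_of_nat)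
  have step: "fps_nth ((fps_X - of_nat c) ^ Suc k :: 'b fps) l
      = (if l = 0 then 0 else fps_nth ?q (l - 1)) - of_nat c * fps_nth ?q l"
    by (simp add: left_diff_distrib c)
  have "(if l = 0 then 0 else int (k choose (l - 1)) * (- int c) ^ (k - (l - 1)))
      - int c * (int (k choose l) * (- int c) ^ (k - l))
    = int (Suc k choose l) * (- int c) ^ (Suc k - l)"
  proof (cases l)
    case (Suc l')
    have "int c * (int (k choose Suc l') * (- int c) ^ (k - Suc l'))
        = - (int (k choose Suc l') * (- int c) ^ (k - l'))"
    proof (cases "l' < k")
      case True
      then have "k - l' = Suc (k - Suc l')"
        by simp
      then show ?thesis
        by simp
    qed (simp add: binomial_eq_0)
    then show ?thesis
      using Suc by (simp add: algebra_simps)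
  qed simp
  moreover have "(if l = 0 then 0 else of_int x) - of_nat c * of_int y
      = (of_int ((if l = 0 then 0 else x) - int c * y) :: 'b)" for x y
    by simp
  ultimately show ?case
    unfolding step Suc.IH by (simp only:)
qed

text \<open>Counted from the top power of \<open>u\<close>, so that the choices of indices summing
  to r are those that contribute to Z_r.\<close>

definition Zcoeff :: "(nat \<Rightarrow> nat) \<Rightarrow> nat \<Rightarrow> nat \<Rightarrow> nat \<Rightarrow> 'a::ring_1 yfree" where
  "Zcoeff lam i j m = fps_nth (Zentry lam i j) (lam j - m)"

lemma Zentry_nth:
  "fps_nth (Zentry lam i j) l
    = (\<Sum>t\<le>lam j. Tw lam i j t * of_int (int (lam j - t choose l) * (- int (j - 1)) ^ (lam j - t - l)))"
  unfolding Zentry_def fps_sum_nth fps_mult_left_const_nth fps_X_minus_power_nth ..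

lemma Zentry_eq: "(Zentry lam i j :: 'a::ring_1 yfree fps) = (\<Sum>m\<le>lam j. fps_const (Zcoeff lam i j m) * fps_X ^ (lam j - m))"
proof (rule fps_ext)
  fix l
  have "fps_nth (\<Sum>m\<le>lam j. fps_const (Zcoeff lam i j m) * fps_X ^ (lam j - m) :: 'a yfree fps) l
    = (\<Sum>m\<le>lam j. if m = lam j - l then if l \<le> lam j then fps_nth (Zentry lam i j) l else 0 else 0)"
    unfolding fps_sum_nth by (intro sum.cong) (auto simp: Zcoeff_def)
  also have "\<dots> = (if l \<le> lam j then fps_nth (Zentry lam i j) l else 0)"
    by simp
  also have "\<dots> = fps_nth (Zentry lam i j) l"
    unfolding Zentry_nth by (auto simp: binomial_eq_0 intro!: sum.neutral)
  finally show "fps_nth (Zentry lam i j) l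
      = fps_nth (\<Sum>m\<le>lam j. fps_const (Zcoeff lam i j m) * fps_X ^ (lam j - m) :: 'a yfree fps) l"
    by simp
qed

lemma Zcoeff_eq:
  assumes "m \<le> lam j"
  shows "Zcoeff lam i j m = (\<Sum>t\<le>m. of_int (int (lam j - t choose (lam j - m)) * (- int (j - 1)) ^ (m - t)) * Tw lam i j t)"
proof -
  have "Zcoeff lam i j m = (\<Sum>t\<le>m. Tw lam i j t *
      of_int (int (lam j - t choose (lam j - m)) * (- int (j - 1)) ^ (lam j - t - (lam j - m))))"
    unfolding Zcoeff_def Zentry_nth
  proof (intro sum.mono_neutral_right ballI)
    fix t assume "t \<in> {..lam j} - {..m}"
    then have "lam j - t < lam j - m"
      using assms by auto
    then show "Tw lam i j t * of_int (int (lam j - t choose (lam j - m)) * (- int (j - 1)) ^ (lam j - t - (lam j - m))) = 0"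
      by (simp add: binomial_eq_0)
  qed (use assms in auto)
  also have "\<dots> = (\<Sum>t\<le>m. of_int (int (lam j - t choose (lam j - m)) * (- int (j - 1)) ^ (m - t)) * Tw lam i j t)"
  proof (rule sum.cong[OF refl])
    fix t assume "t \<in> {..m}"
    then have "lam j - t - (lam j - m) = m - t"
      using assms by auto
    then show "Tw lam i j t * of_int (int (lam j - t choose (lam j - m)) * (- int (j - 1)) ^ (lam j - t - (lam j - m)))
      = of_int (int (lam j - t choose (lam j - m)) * (- int (j - 1)) ^ (m - t)) * Tw lam i j t"
      by (metis mult_of_int_commute)
  qed
  finally show ?thesis .
qed

lemma Zc_eq:
  assumes r: "r \<le> NN n lam"
  shows "(Zc n lam r :: 'a::ring_1 yfree) = (\<Sum>mu\<in>{mu\<in>below {1..n} lam. sum mu {1..n} = r}. \<Sum>w\<in>{w. w permutes {1..n}}.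
     of_int (sign w) * prod_list (map (\<lambda>j. Zcoeff lam (w j) j (mu j)) [1..<n + 1]))"
proof -
  let ?L = "[1..<n + 1]" and ?B = "below {1..n} lam"
  have L: "distinct ?L" "set ?L = {1..n}"
    by auto
  have fin: "finite {mu\<in>?B. sum mu {1..n} = r}"
  proof (rule finite_subset)
    show "{mu\<in>?B. sum mu {1..n} = r} \<subseteq> {mu. \<forall>j. (j \<in> {1..n} \<longrightarrow> mu j \<in> {..r}) \<and> (j \<notin> {1..n} \<longrightarrow> mu j = 0)}"
    proof
      fix mu assume mu: "mu \<in> {mu\<in>?B. sum mu {1..n} = r}"
      have "mu j \<le> r" if "j \<in> {1..n}" for j
        using mu member_le_sum[OF that, of mu] by simp
      moreover have "mu j = 0" if "j \<notin> {1..n}" for j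
        using mu that by (auto intro: below_outside)
      ultimately show "mu \<in> {mu. \<forall>j. (j \<in> {1..n} \<longrightarrow> mu j \<in> {..r}) \<and> (j \<notin> {1..n} \<longrightarrow> mu j = 0)}"
        by (simp del: atLeastAtMost_iff)
    qed
    show "finite {mu :: nat \<Rightarrow> nat. \<forall>j. (j \<in> {1..n} \<longrightarrow> mu j \<in> {..r}) \<and> (j \<notin> {1..n} \<longrightarrow> mu j = 0)}"
      by (rule finite_set_of_finite_funs) auto
  qed
  have of_int: "fps_nth (of_int k * f) l = of_int k * fps_nth f l" for k l and f :: "'a yfree fps"
    by (simp add: fps_of_int[symmetric] del: fps_of_int)
  have exp: "fps_nth (prod_list (map (\<lambda>j. Zentry lam (w j) j) ?L)) (NN n lam - r)
    = (\<Sum>mu\<in>{mu\<in>?B. sum mu {1..n} = r}. prod_list (map (\<lambda>j. Zcoeff lam (w j) j (mu j)) ?L) :: 'a yfree)" for w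
  proof -
    have e: "(prod_list (map (\<lambda>j. Zentry lam (w j) j) ?L) :: 'a yfree fps)
      = (\<Sum>mu\<in>?B. prod_list (map (\<lambda>j. fps_const (Zcoeff lam (w j) j (mu j)) * fps_X ^ (lam j - mu j)) ?L))"
      unfolding Zentry_eq prod_list_sum[OF L(1)] L(2) ..
    have "fps_nth (prod_list (map (\<lambda>j. Zentry lam (w j) j) ?L)) (NN n lam - r)
      = (\<Sum>mu\<in>?B. if sum mu {1..n} = r then prod_list (map (\<lambda>j. Zcoeff lam (w j) j (mu j)) ?L) else 0 :: 'a yfree)"
      unfolding e fps_sum_nth
    proof (intro sum.cong refl)
      fix mu assume mu: "mu \<in> ?B"
      have s: "(\<Sum>j\<leftarrow>?L. lam j - mu j) + sum mu {1..n} = NN n lam"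
        unfolding sum_list_distinct_conv_sum_set[OF L(1)] L(2) NN_def sum.distrib[symmetric]
        using below_le[OF mu] by (intro sum.cong) auto
      then have "NN n lam - r = (\<Sum>j\<leftarrow>?L. lam j - mu j) \<longleftrightarrow> sum mu {1..n} = r"
        using r by linarith
      then show "fps_nth (prod_list (map (\<lambda>j. fps_const (Zcoeff lam (w j) j (mu j)) * fps_X ^ (lam j - mu j)) ?L)) (NN n lam - r)
        = (if sum mu {1..n} = r then prod_list (map (\<lambda>j. Zcoeff lam (w j) j (mu j)) ?L) else 0 :: 'a yfree)"
        unfolding prod_list_const_X_power by simp
    qed
    also have "\<dots> = (\<Sum>mu\<in>{mu\<in>?B. sum mu {1..n} = r}. prod_list (map (\<lambda>j. Zcoeff lam (w j) j (mu j)) ?L))"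
      using fin by (intro sum.mono_neutral_cong_right) (auto simp: finite_below)
    finally show ?thesis .
  qed
  have "(Zc n lam r :: 'a yfree) = (\<Sum>w\<in>{w. w permutes {1..n}}. \<Sum>mu\<in>{mu\<in>?B. sum mu {1..n} = r}.
     of_int (sign w) * prod_list (map (\<lambda>j. Zcoeff lam (w j) j (mu j)) ?L))"
    unfolding Zc_def Zpoly_def fps_sum_nth of_int exp sum_distrib_left ..
  also have "\<dots> = (\<Sum>mu\<in>{mu\<in>?B. sum mu {1..n} = r}. \<Sum>w\<in>{w. w permutes {1..n}}.
     of_int (sign w) * prod_list (map (\<lambda>j. Zcoeff lam (w j) j (mu j)) ?L))"
    by (rule sum.swap)
  finally show ?thesis .
qed

section \<open>Symbols in the associated graded algebra\<close>

lemma prod_list_sign: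
  fixes g :: "nat \<Rightarrow> 'b::ring_1"
  shows "prod_list (map (\<lambda>j. (- 1) ^ k j * g j) l) = (- 1) ^ (\<Sum>j\<leftarrow>l. k j) * prod_list (map g l)"
proof (induction l)
  case (Cons x l)
  have "(- 1) ^ k x * g x * ((- 1) ^ a * y) = (- 1) ^ (k x + a) * (g x * y)" for a y
    by (cases "even (k x)"; cases "even a") auto
  then show ?case
    using Cons by simp
qed simp

text \<open>The membership \<open>Zc n lam r \<in> Filt n lam m\<close> has to be shown over every ring, whereas \<open>Phi\<close> is only
  given over a field. Hence the ideal is a parameter: the trivial instance with the unit ideal still
  yields the filtration degree.\<close>

locale symbol_calculus =
  fixes n :: nat and lam :: "nat \<Rightarrow> nat" and Phi :: "nat \<Rightarrow> 'b::ring_1 yfree \<Rightarrow> 'c::ring_1 ufree"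
    and G :: "'c ufree set"
  assumes Phi_add: "\<And>m x y. x \<in> zspan (Tmonos n lam m) \<Longrightarrow> y \<in> zspan (Tmonos n lam m) \<Longrightarrow>
      Phi m (x + y) - Phi m x - Phi m y \<in> ideal_gen G"
    and Phi_of_int: "\<And>m x k. x \<in> zspan (Tmonos n lam m) \<Longrightarrow>
      Phi m (of_int k * x) - of_int k * Phi m x \<in> ideal_gen G"
    and Phi_mult: "\<And>m m' x y. x \<in> zspan (Tmonos n lam m) \<Longrightarrow> y \<in> zspan (Tmonos n lam m') \<Longrightarrow>
      Phi (m + m') (x * y) - Phi m x * Phi m' y \<in> ideal_gen G"
    and Phi_one: "Phi 0 1 - 1 \<in> ideal_gen G"
    and Phi_lower: "\<And>m m' x. x \<in> zspan (Tmonos n lam m') \<Longrightarrow> m' < m \<Longrightarrow> Phi m x \<in> ideal_gen G"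
    and Phi_Tw: "\<And>i j r. (i, j, r) \<in> gbasis n lam \<Longrightarrow>
      Phi r (Tw lam i j (r + 1)) - (- 1) ^ r * egen i j r \<in> ideal_gen G"
    and egen_outside: "\<And>i j r. (i, j, r) \<notin> gbasis n lam \<Longrightarrow> egen i j r \<in> ideal_gen G"
begin

text \<open>Degree bound and leading term are recorded together, so a single pass through the
  structure of \<open>Zc\<close> proves both.\<close>

definition symbol :: "nat \<Rightarrow> 'b yfree \<Rightarrow> 'c ufree \<Rightarrow> bool" where
  "symbol m x u \<longleftrightarrow> x \<in> zspan (Tmonos n lam m) \<and> Phi m x - u \<in> ideal_gen G"

lemma symbol_cong: "symbol m x u \<Longrightarrow> u - v \<in> ideal_gen G \<Longrightarrow> symbol m x v"
  unfolding symbol_def using ideal_gen_add[of "Phi m x - u" _ "u - v"] by simp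

lemma symbol_add:
  assumes "symbol m x u" "symbol m y v"
  shows "symbol m (x + y) (u + v)"
proof -
  have "(Phi m (x + y) - Phi m x - Phi m y) + ((Phi m x - u) + (Phi m y - v)) \<in> ideal_gen G"
    using assms unfolding symbol_def by (intro ideal_gen_add Phi_add) auto
  then show ?thesis
    using assms unfolding symbol_def by (simp add: zspan_add algebra_simps)
qed

lemma symbol_mult:
  assumes "symbol m x u" "symbol m' y v"
  shows "symbol (m + m') (x * y) (u * v)"
proof -
  have "(Phi (m + m') (x * y) - Phi m x * Phi m' y) + ((Phi m x - u) * Phi m' y + u * (Phi m' y - v))
      \<in> ideal_gen G"
    using assms unfolding symbol_def
    by (intro ideal_gen_add ideal_gen_mult_left ideal_gen_mult_right Phi_mult) auto
  moreover have "x * y \<in> zspan (Tmonos n lam (m + m'))"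
    using assms unfolding symbol_def by (intro zspan_mult[OF _ _ Tmonos_mult]) auto
  ultimately show ?thesis
    unfolding symbol_def by (simp add: algebra_simps)
qed

lemma symbol_of_int:
  assumes "symbol m x u"
  shows "symbol m (of_int k * x) (of_int k * u)"
proof -
  have "(Phi m (of_int k * x) - of_int k * Phi m x) + of_int k * (Phi m x - u) \<in> ideal_gen G"
    using assms unfolding symbol_def by (intro ideal_gen_add ideal_gen_mult_left Phi_of_int) auto
  then show ?thesis
    using assms zspan_of_int_mult[of x _ k] unfolding symbol_def by (simp add: algebra_simps)
qed

lemma symbol_one: "symbol 0 1 1"
  using Phi_one by (simp add: symbol_def zspan_base one_in_Tmonos)

lemma symbol_lower:
  assumes "x \<in> zspan (Tmonos n lam m')" "m' < m"
  shows "symbol m x 0"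
proof -
  have "x \<in> zspan (Tmonos n lam m)"
    by (rule zspan_mono[OF assms(1) Tmonos_mono]) (use assms(2) in simp)
  then show ?thesis
    using Phi_lower[OF assms] by (simp add: symbol_def)
qed

lemma symbol_zero: "symbol m 0 0"
proof -
  have "symbol m (of_int 0 * 0) (of_int 0 * Phi m 0)"
    by (intro symbol_of_int) (simp add: symbol_def zspan_zero ideal_gen_zero)
  then show ?thesis
    by simp
qed

lemma symbol_sum: "(\<And>i. i \<in> A \<Longrightarrow> symbol m (f i) (g i)) \<Longrightarrow> symbol m (sum f A) (sum g A)"
  by (induction A rule: infinite_finite_induct) (auto simp: symbol_zero intro: symbol_add)

lemma symbol_prod_list:
  "(\<And>i. i \<in> set l \<Longrightarrow> symbol (k i) (f i) (g i)) \<Longrightarrow>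
    symbol (\<Sum>i\<leftarrow>l. k i) (prod_list (map f l)) (prod_list (map g l))"
  by (induction l) (auto simp: symbol_one intro: symbol_mult)

text \<open>For r < s_{i,j} both sides vanish in their quotients: the Yangian series starts later,
  and the generator lies in the ideal.\<close>

lemma symbol_Tw:
  assumes nondec: "\<And>i j. 1 \<le> i \<Longrightarrow> i \<le> j \<Longrightarrow> j \<le> n \<Longrightarrow> lam i \<le> lam j"
    and ij: "i \<in> {1..n}" "j \<in> {1..n}" and r: "r < lam j"
  shows "symbol r (Tw lam i j (r + 1)) ((- 1) ^ r * egen i j r)"
proof (cases "(i, j, r) \<in> gbasis n lam")
  case True
  then show ?thesis
    using Phi_Tw zspan_base[OF Tw_in_Tmonos[OF ij, of "r + 1"]] by (simp add: symbol_def)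
next
  case False
  then have sh: "r < sh lam i j"
    using ij r by (auto simp: gbasis_def)
  then have "i < j"
    using nondec[of j i] ij by (cases "i < j") (auto simp: sh_def min_def split: if_splits)
  then have "Tw lam i j (r + 1) = (0 :: 'b yfree)"
    using sh by (intro Tw_below_shift[OF nondec ij]) auto
  moreover have "- ((- 1) ^ r * egen i j r) \<in> ideal_gen G"
    using egen_outside[OF False] by (intro ideal_gen_uminus ideal_gen_mult_left)
  ultimately show ?thesis
    using symbol_cong[OF symbol_zero, of "(- 1) ^ r * egen i j r" r] by simp
qed

text \<open>The term t = m has coefficient 1 and gives the symbol, and those with 1 <= t < m have
  lower degree. The scalar t = 0 is visible only for m = 1, where on the diagonal it equals
  -(j-1)*lam j: the shift in the modified generators.\<close>

lemma symbol_Zcoeff: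
  assumes nondec: "\<And>i j. 1 \<le> i \<Longrightarrow> i \<le> j \<Longrightarrow> j \<le> n \<Longrightarrow> lam i \<le> lam j"
    and ij: "i \<in> {1..n}" "j \<in> {1..n}" and m: "m \<le> lam j"
  shows "symbol (m - 1) (Zcoeff lam i j m) ((- 1) ^ (m - 1) * part_entry lam egen i j m)"
proof -
  let ?b = "\<lambda>t. int (lam j - t choose (lam j - m)) * (- int (j - 1)) ^ (m - t)"
  have delta: "symbol 0 (Tw lam i j 0) (if i = j then 1 else 0)"
    using symbol_one symbol_zero by (simp add: Tw_0[OF ij])
  show ?thesis
  proof (cases m)
    case 0
    then show ?thesis
      using delta m by (simp add: Zcoeff_eq part_entry_def)
  next
    case (Suc r)
    have top: "?b m = 1"
      by simp
    have "symbol r (Tw lam i j m) ((- 1) ^ r * egen i j r)"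
      using symbol_Tw[OF nondec ij, of r] m Suc by simp
    moreover have "symbol r (\<Sum>t\<in>{1..r}. of_int (?b t) * Tw lam i j t) (\<Sum>t\<in>{1..r}. of_int (?b t) * 0)"
    proof (intro symbol_sum symbol_of_int)
      fix t assume t: "t \<in> {1..r}"
      show "symbol r (Tw lam i j t) 0"
        by (rule symbol_lower[OF zspan_base[OF Tw_in_Tmonos[OF ij]]]) (use t in auto)
    qed
    moreover have "symbol r (of_int (?b 0) * Tw lam i j 0)
      (if r = 0 \<and> i = j then - of_nat ((i - 1) * lam i) else 0)"
    proof (cases "r = 0")
      case True
      have "lam j > 0"
        using m Suc by simp
      then have "lam j choose (lam j - 1) = lam j"
        using binomial_symmetric[of 1 "lam j"] by simp
      then have b0: "?b 0 = - int ((j - 1) * lam j)"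
        using Suc True by simp
      have "(of_int (?b 0) * (if i = j then 1 else 0) :: 'c ufree)
          = (if r = 0 \<and> i = j then - of_nat ((i - 1) * lam i) else 0)"
        unfolding b0 using True by (simp del: of_nat_mult)
      then show ?thesis
        using symbol_of_int[OF delta, of "?b 0"] True by (simp only:)
    next
      case False
      have "symbol r (of_int (?b 0) * Tw lam i j 0) (of_int (?b 0) * 0)"
        using False by (intro symbol_of_int symbol_lower[of _ 0])
          (auto simp: Tw_0[OF ij] zspan_zero intro: zspan_base one_in_Tmonos)
      then show ?thesis
        using False by simp
    qed
    ultimately have "symbol r (Tw lam i j m + ((\<Sum>t\<in>{1..r}. of_int (?b t) * Tw lam i j t) + of_int (?b 0) * Tw lam i j 0))
      ((- 1) ^ r * egen i j r + ((\<Sum>t\<in>{1..r}. of_int (?b t) * 0)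
        + (if r = 0 \<and> i = j then - of_nat ((i - 1) * lam i) else 0)))"
      by (intro symbol_add)
    moreover have "Tw lam i j m + ((\<Sum>t\<in>{1..r}. of_int (?b t) * Tw lam i j t) + of_int (?b 0) * Tw lam i j 0)
      = (Zcoeff lam i j m :: 'b yfree)"
    proof -
      have "{..m} = insert m (insert 0 {1..r})"
        using Suc by auto
      then show ?thesis
        unfolding Zcoeff_eq[of m lam j i, OF m] using Suc top by (simp add: add.commute add.assoc add.left_commute)
    qed
    moreover have "(- 1) ^ r * egen i j r + ((\<Sum>t\<in>{1..r}. of_int (?b t) * 0)
        + (if r = 0 \<and> i = j then - of_nat ((i - 1) * lam i) else 0))
      = ((- 1) ^ (m - 1) * part_entry lam egen i j m :: 'c ufree)"
      using Suc by (auto simp: part_entry_def)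
    ultimately show ?thesis
      using Suc by (simp only: diff_Suc_1)
  qed
qed

text \<open>Only \<open>mu\<close> with exactly d_r nonzero parts reach degree r - d_r. Their column
  signs (-1)^(mu_j - 1) multiply to the common sign (-1)^(r - d_r).\<close>

lemma symbol_Zc:
  assumes nondec: "\<And>i j. 1 \<le> i \<Longrightarrow> i \<le> j \<Longrightarrow> j \<le> n \<Longrightarrow> lam i \<le> lam j"
    and r: "r \<in> {1..NN n lam}"
  shows "symbol (r - dseq n lam r) (Zc n lam r) ((- 1) ^ (r - dseq n lam r) * zU n lam r)"
proof -
  let ?d = "dseq n lam r" and ?L = "[1..<n + 1]"
  let ?S = "{mu\<in>below {1..n} lam. sum mu {1..n} = r}" and ?W = "{w. w permutes {1..n}}"
  let ?Z = "\<lambda>mu. \<Sum>w\<in>?W. of_int (sign w) * prod_list (map (\<lambda>j. Zcoeff lam (w j) j (mu j)) ?L) :: 'b yfree"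
  let ?z = "\<lambda>mu. \<Sum>w\<in>?W. of_int (sign w) * prod_list (map (\<lambda>j. part_entry lam egen (w j) j (mu j)) ?L) :: 'c ufree"
  have L: "distinct ?L" "set ?L = {1..n}"
    by auto
  have symbol_mu: "symbol (r - card (supp_mu n mu)) (?Z mu) ((- 1) ^ (r - card (supp_mu n mu)) * ?z mu)"
    if mu: "mu \<in> ?S" for mu
  proof -
    have deg: "(\<Sum>j\<leftarrow>?L. mu j - 1) = r - card (supp_mu n mu)"
      unfolding sum_list_distinct_conv_sum_set[OF L(1)] L(2)
      using sum_pred_add_card[of "{1..n}" mu] mu by (simp add: supp_mu_def)
    have "symbol (\<Sum>j\<leftarrow>?L. mu j - 1) (prod_list (map (\<lambda>j. Zcoeff lam (w j) j (mu j)) ?L))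
        (prod_list (map (\<lambda>j. (- 1) ^ (mu j - 1) * part_entry lam egen (w j) j (mu j)) ?L))"
      if "w \<in> ?W" for w
    proof (rule symbol_prod_list)
      fix j assume "j \<in> set ?L"
      then have j: "j \<in> {1..n}"
        using L(2) by simp
      have wj: "w j \<in> {1..n}"
        using that j by (simp add: permutes_in_image del: atLeastAtMost_iff)
      have le: "mu j \<le> lam j"
        using mu j by (auto intro: below_le)
      show "symbol (mu j - 1) (Zcoeff lam (w j) j (mu j)) ((- 1) ^ (mu j - 1) * part_entry lam egen (w j) j (mu j))"
        by (rule symbol_Zcoeff) (use nondec wj j le in auto)
    qed
    then have "symbol (r - card (supp_mu n mu)) (?Z mu) (\<Sum>w\<in>?W. of_int (sign w) *
        ((- 1) ^ (r - card (supp_mu n mu)) * prod_list (map (\<lambda>j. part_entry lam egen (w j) j (mu j)) ?L)))"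
      unfolding prod_list_sign deg by (intro symbol_sum symbol_of_int)
    moreover have "of_int a * ((- 1) ^ b * y) = (- 1) ^ b * (of_int a * y)" for a b and y :: "'c ufree"
      by (cases "even b") auto
    ultimately show ?thesis
      by (simp only: sum_distrib_left)
  qed
  have "symbol (r - ?d) (sum ?Z ?S)
      (\<Sum>mu\<in>?S. if card (supp_mu n mu) = ?d then (- 1) ^ (r - ?d) * ?z mu else 0)"
  proof (rule symbol_sum)
    fix mu assume mu: "mu \<in> ?S"
    show "symbol (r - ?d) (?Z mu) (if card (supp_mu n mu) = ?d then (- 1) ^ (r - ?d) * ?z mu else 0)"
    proof (cases "card (supp_mu n mu) = ?d")
      case True
      then show ?thesis
        using symbol_mu[OF mu] by simp
    next
      case False
      have "?d \<le> card (supp_mu n mu)"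
        using mu by (intro dseq_le_card_supp[OF nondec r]) auto
      moreover have "card (supp_mu n mu) \<le> r"
        using sum_pred_add_card[of "{1..n}" mu] mu by (simp add: supp_mu_def)
      ultimately have "r - card (supp_mu n mu) < r - ?d"
        using False by simp
      moreover have "?Z mu \<in> zspan (Tmonos n lam (r - card (supp_mu n mu)))"
        using symbol_mu[OF mu] by (simp only: symbol_def)
      ultimately have "symbol (r - ?d) (?Z mu) 0"
        by (intro symbol_lower)
      then show ?thesis
        using False by (simp only: if_False)
    qed
  qed
  also have "(\<Sum>mu\<in>?S. if card (supp_mu n mu) = ?d then (- 1) ^ (r - ?d) * ?z mu else 0)
      = (- 1) ^ (r - ?d) * zU n lam r"
    unfolding zU_eq_zgen zgen_def sum_distrib_left Mus_eq_below
    by (rule sum.mono_neutral_cong_right) (auto simp: finite_below)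
  also have "sum ?Z ?S = Zc n lam r"
    using r by (intro Zc_eq[symmetric]) simp
  finally show ?thesis .
qed

end

lemma is_gr_iso_symbol_calculus:
  fixes Phi :: "nat \<Rightarrow> 'a::ring_1 yfree \<Rightarrow> 'a ufree"
  assumes "is_gr_iso n lam Phi"
  shows "symbol_calculus n lam Phi (Urel n lam)"
proof
  note iso = assms[unfolded is_gr_iso_def Kset_def]
  note iso_zero = iso[THEN conjunct1, rule_format]
    and iso_add = iso[THEN conjunct2, THEN conjunct1, rule_format]
    and iso_scale = iso[THEN conjunct2, THEN conjunct2, THEN conjunct1, rule_format]
    and iso_mult = iso[THEN conjunct2, THEN conjunct2, THEN conjunct2, THEN conjunct1, rule_format]
  have Filt: "x \<in> Filt n lam m" if "x \<in> zspan (Tmonos n lam m)" for x :: "'a yfree" and m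
    using zspan_fspan[OF that] fspan_Tmonos_Filt by blast
  show "Phi m (x + y) - Phi m x - Phi m y \<in> ideal_gen (Urel n lam)"
    if "x \<in> zspan (Tmonos n lam m)" "y \<in> zspan (Tmonos n lam m)" for m x y
    using that by (intro iso_add Filt)
  show "Phi m (of_int k * x) - of_int k * Phi m x \<in> ideal_gen (Urel n lam)"
    if "x \<in> zspan (Tmonos n lam m)" for m x k
    using iso_scale[OF Filt[OF that], of "of_int k"] by (simp add: fconst_of_int)
  show "Phi (m + m') (x * y) - Phi m x * Phi m' y \<in> ideal_gen (Urel n lam)"
    if "x \<in> zspan (Tmonos n lam m)" "y \<in> zspan (Tmonos n lam m')" for m m' x y
    using that by (intro iso_mult Filt)
  show "Phi 0 1 - 1 \<in> ideal_gen (Urel n lam)"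
    using iso by simp
  \<comment> \<open>Here m > 0, so \<open>Fprev\<close> at \<open>m\<close> is the filtration step m
    - 1, which contains \<open>x\<close>.\<close>
  show "Phi m x \<in> ideal_gen (Urel n lam)" if x: "x \<in> zspan (Tmonos n lam m')" and m: "m' < m" for m m' x
  proof -
    have "x \<in> Filt n lam (m - 1)" "x \<in> Filt n lam m"
      by (rule Filt, rule zspan_mono[OF x Tmonos_mono], use m in simp)+
    then show ?thesis
      using iso_zero[of x m] m by (simp add: Fprev_def)
  qed
  show "Phi r (Tw lam i j (r + 1)) - (- 1) ^ r * egen i j r \<in> ideal_gen (Urel n lam)"
    if "(i, j, r) \<in> gbasis n lam" for i j r
    using iso that by blast
  show "egen i j r \<in> ideal_gen (Urel n lam)" if "(i, j, r) \<notin> gbasis n lam" for i j r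
    using fgen_outside[OF that] by (simp add: egen_def Kset_def)
qed

lemma Zc_in_Filt:
  assumes nondec: "\<And>i j. 1 \<le> i \<Longrightarrow> i \<le> j \<Longrightarrow> j \<le> n \<Longrightarrow> lam i \<le> lam j"
    and r: "r \<in> {1..NN n lam}"
  shows "(Zc n lam r :: 'b::ring_1 yfree) \<in> Filt n lam (r - dseq n lam r)"
proof -
  have [simp]: "x \<in> ideal_gen UNIV" for x :: "int ufree"
    by (rule ideal_gen_base) simp
  \<comment> \<open>Modulo the unit ideal every congruence is trivial, so \<open>symbol\<close>
    reduces to membership in \<open>zspan\<close>.\<close>
  interpret symbol_calculus n lam "\<lambda>_ (_ :: 'b yfree). 0 :: int ufree" UNIV
    by standard simp_all
  have "(Zc n lam r :: 'b yfree) \<in> zspan (Tmonos n lam (r - dseq n lam r))"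
    using symbol_Zc[OF nondec r] by (simp add: symbol_def)
  then show ?thesis
    using zspan_fspan fspan_Tmonos_Filt by blast
qed

theorem theorem3p4:
  fixes n :: nat and lam :: "nat \<Rightarrow> nat"
  assumes alg_closed: "\<forall>p :: 'a::field_char_0 poly. degree p > 0 \<longrightarrow> (\<exists>x. poly p x = 0)"
    and pos: "\<forall>i\<in>{1..n}. lam i > 0"
    and nondec: "\<forall>i j. 1 \<le> i \<longrightarrow> i \<le> j \<longrightarrow> j \<le> n \<longrightarrow> lam i \<le> lam j"
  shows "(\<forall>Phi :: nat \<Rightarrow> 'a yfree \<Rightarrow> 'a ufree. is_gr_iso n lam Phi \<longrightarrow>
            (\<forall>r\<in>{1..NN n lam}.
               Zc n lam r \<in> Filt n lam (r - dseq n lam r)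
             \<and> Phi (r - dseq n lam r) (Zc n lam r) - (- 1) ^ (r - dseq n lam r) * zU n lam r
                 \<in> Kset n lam))
       \<and> (\<forall>r\<in>{1..NN n lam}. \<forall>b :: 'a ufree. zU n lam r * b - b * zU n lam r \<in> Kset n lam)"
proof (intro conjI allI impI ballI)
  have mono: "\<And>i j. 1 \<le> i \<Longrightarrow> i \<le> j \<Longrightarrow> j \<le> n \<Longrightarrow> lam i \<le> lam j"
    using nondec by blast
  fix r assume r: "r \<in> {1..NN n lam}"
  show "zU n lam r * b - b * zU n lam r \<in> Kset n lam" for b :: "'a ufree"
    by (rule zU_central[OF _ mono r]) (use pos in auto)
  fix Phi :: "nat \<Rightarrow> 'a yfree \<Rightarrow> 'a ufree"
  show "(Zc n lam r :: 'b yfree) \<in> Filt n lam (r - dseq n lam r)"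
    by (rule Zc_in_Filt[OF mono r])
  assume "is_gr_iso n lam Phi"
  then interpret symbol_calculus n lam Phi "Urel n lam"
    by (rule is_gr_iso_symbol_calculus)
  have "symbol (r - dseq n lam r) (Zc n lam r) ((- 1) ^ (r - dseq n lam r) * zU n lam r)"
    by (rule symbol_Zc[OF mono r])
  then show "Phi (r - dseq n lam r) (Zc n lam r) - (- 1) ^ (r - dseq n lam r) * zU n lam r \<in> Kset n lam"
    by (simp add: symbol_def Kset_def)
qed

end
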